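(* Let $\eta_1,\eta_2,\ldots$ be independent copies of a random variable $\eta$ with $\mathbb{E}[\eta]=0$ and $\sigma^2=\mathrm{Var}[\eta]\in(0,\infty)$. Let $(a_k)_{k\ge1}$ be a sequence of real numbers such that, for some $c>0$ and $\beta>0$, $$\sum_{k\le n}\frac{a_k^2}{k}\sim c(\log n)^\beta,\quad n\to\infty,$$ and such that, with $\mathcal{S}:=\{k\ge16: a_k\ne0\}$ and the same $\beta$, $$\#\Big\{k\in\mathcal{S}:\ \frac{k(\log k)^\beta}{a_k^2(\log\log k)^2\log^{(3)}k}\le x\Big\}=O(x),\quad x\to\infty.$$ Then $$C\Big(\Big(\frac{1}{(2v(s)\log\log v(s))^{1/2}}\sum_{k\ge1}\frac{a_k\eta_k}{k^{1/2+s}}:\ s>0\text{ sufficiently close to }0\Big)\Big)=[-1,1]\quad\text{a.s.}$$ and $$v(s)\sim\frac{\sigma^2c\,\Gamma(1+\beta)}{(2s)^\beta},\quad s\to0+.$$ In particular, $$\limsup_{s\to0+}\frac{1}{(2v(s)\log\log v(s))^{1/2}}\sum_{k\ge1}\frac{a_k\eta_k}{k^{1/2+s}}=1\quad\text{a.s.}$$ and $$\liminf_{s\to0+}\frac{1}{(2v(s)\log\log v(s))^{1/2}}\sum_{k\ge1}\frac{a_k\eta_k}{k^{1/2+s}}=-1\quad\text{a.s.}$$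
   Context: For $s>0$, $X(s):=\sum_{k\ge1}\frac{a_k\eta_k}{k^{1/2+s}}$ (the series converges a.s. for each $s>0$) and $v(s):=\mathrm{Var}[X(s)]$. For a family $(x_s)$ of real numbers, $C((x_s))$ denotes the set of its limit points as $s\to0+$. $\log^{(3)}x:=\log\log\log x$, $\Gamma$ is the Euler gamma function, $\#$ denotes cardinality, and $f\sim g$ means that $f/g$ tends to $1$. *)

theory Defs
  imports "HOL-Probability.Probability" "HOL-Library.Landau_Symbols"
begin

unbundle asymp_equiv_syntax

text \<open>
  Sequences are indexed by \<open>k \<ge> 1\<close> (the value at \<open>0\<close> is never used), hence the shift by
  \<open>Suc\<close>. The series is in general only conditionally convergent; \<^const>\<open>suminf\<close> is the
  limit of its partial sums.
\<close>
definition random_dirichlet ::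
    "(nat \<Rightarrow> real) \<Rightarrow> (nat \<Rightarrow> 'a \<Rightarrow> real) \<Rightarrow> real \<Rightarrow> 'a \<Rightarrow> real" where
  "random_dirichlet a \<eta> s \<omega> =
     (\<Sum>k. a (Suc k) * \<eta> (Suc k) \<omega> / real (Suc k) powr (1/2 + s))"

definition dirichlet_variance ::
    "'a measure \<Rightarrow> (nat \<Rightarrow> real) \<Rightarrow> (nat \<Rightarrow> 'a \<Rightarrow> real) \<Rightarrow> real \<Rightarrow> real" where
  "dirichlet_variance M a \<eta> s = prob_space.variance M (random_dirichlet a \<eta> s)"

definition normalized_dirichlet ::
    "'a measure \<Rightarrow> (nat \<Rightarrow> real) \<Rightarrow> (nat \<Rightarrow> 'a \<Rightarrow> real) \<Rightarrow> real \<Rightarrow> 'a \<Rightarrow> real" where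
  "normalized_dirichlet M a \<eta> s \<omega> =
     1 / sqrt (2 * dirichlet_variance M a \<eta> s * ln (ln (dirichlet_variance M a \<eta> s)))
       * random_dirichlet a \<eta> s \<omega>"

definition limit_points_at_right_0 :: "(real \<Rightarrow> real) \<Rightarrow> real set" where
  "limit_points_at_right_0 x =
     {y. \<exists>s. filterlim s (at_right 0) sequentially \<and> (\<lambda>n. x (s n)) \<longlonglongrightarrow> y}"

definition growth_set :: "(nat \<Rightarrow> real) \<Rightarrow> real \<Rightarrow> real \<Rightarrow> nat set" where
  "growth_set a \<beta> x =
     {k. k \<ge> 16 \<and> a k \<noteq> 0 \<and>
         real k * ln (real k) powr \<beta>
           / ((a k)\<^sup>2 * (ln (ln (real k)))\<^sup>2 * ln (ln (ln (real k)))) \<le> x}"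

end

theory Submission
  imports Defs "HOL-Real_Asymp.Real_Asymp"
begin

text \<open>
  Truncate \<open>\<eta>\<^sub>k\<close> at the level \<open>\<surd>m\<^sub>k\<close> read off from the counting hypothesis. Since
  \<open>#{k. m\<^sub>k \<le> x} = O(x)\<close> and \<open>E[\<eta>\<^sup>2] < \<infinity>\<close>, almost surely only finitely many terms are truncated, and
  by the inequality between the arithmetic and the geometric mean the partial sums of the centering
  terms are \<open>O((log n)\<^bsup>\<beta>/2\<^esup>)\<close>; by Abel summation both are negligible. The truncated terms at scale
  \<open>s\<close> are \<open>O(s\<^bsup>-\<beta>/2\<^esup> / log (1/s))\<close>, so their moment generating functions are Gaussian up to a factor
  tending to one on the whole range relevant to the law of the iterated logarithm.

  The upper bound follows from Chernoff bounds along the geometric grids \<open>s = r\<^sup>j\<close>. Between grid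
  points one uses only a crude iterated logarithm bound for the partial sums, from the exponential
  maximal inequality, because the modulus of continuity of a Dirichlet series is controlled by its
  partial sums. The lower bound uses \<open>s = A\<^bsup>-2j\<^esup>\<close>, for which most of the variance is carried by the
  disjoint blocks \<open>1/(A s) < log k \<le> A/s\<close>, together with exponential tilting and the second
  Borel-Cantelli lemma. As the series is continuous in \<open>s\<close>, the intermediate value theorem yields
  the whole interval of limit points. The variance asymptotics is the Abelian theorem for
  \<open>\<Sum> z\<^sub>k k\<^bsup>-s\<^esup>\<close>.
\<close>

section \<open>Abel summation and an Abelian theorem\<close>

text \<open>The Chernoff parameters at scale s are of order s^(beta/2) sqrt(log log(1/s)).
  Multiplied by the size of the truncated terms this gives sqrt(log log(1/s)) / log(1/s), which
  tends to 0, so a second order expansion of the exponential loses nothing. Every other error only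
  has to be beaten by the factor sqrt(log log(1/s)) of the normalizer: a remainder O(s^(-beta/2))
  disappears. Tail bounds speak about one s, limit points about all s at once. On s = r^j, log
  log(1/s) equals log j up to a constant, so a tail exp(-p log log(1/s)) becomes a power j^(-p) and
  p = 1 is the border of summability. Off the grid a crude constant is harmless because it is
  multiplied by 1/r - 1 and does not depend on r: the loss vanishes as r tends to 1. The values of
  the series at different s are dependent, so the second Borel-Cantelli lemma cannot be applied to
  them directly. It is applied to the blocks, and what a block leaves out is again handled by the
  Chernoff bound, now with a small variance.\<close>

lemma powr_neg_Suc:
  fixes u g :: real
  assumes "u > 0"
  shows "u powr (-(1+g)) = u powr (-g) / u"
proof -
  have "-(1+g) = -g - 1" by simp
  thus ?thesis using assms by (simp only: powr_diff) (simp add: powr_one)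
qed

text \<open>The Gamma integral after the substitution t -> u * t. This Laplace transform is the
  comparison object for all Dirichlet series below.\<close>

lemma has_bochner_integral_powr_exp:
  fixes u g :: real
  assumes "u > 0" "g > -1"
  shows "has_bochner_integral lborel (\<lambda>t. indicator {0..} t *\<^sub>R (t powr g * exp (-(u*t))))
           (Gamma (1 + g) * u powr (-(1+g)))"
proof -
  have nn: "Gamma (1+g) = nn_integral lborel (\<lambda>t. ennreal (indicator {0..} t * t powr (1+g - 1) / exp t))"
    using assms by (intro Gamma_conv_nn_integral_real) auto
  have G: "has_bochner_integral lborel (\<lambda>t. indicator {0..} t * t powr g / exp t) (Gamma (1+g))"
    using nn assms by (intro has_bochner_integral_nn_integral) (auto intro: Gamma_real_nonneg)
  have "has_bochner_integral lborel (\<lambda>t. indicator {0..} (0 + u*t) * (0+u*t) powr g / exp (0+u*t)) (Gamma (1+g) /\<^sub>R \<bar>u\<bar>)"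
    using G assms lborel_has_bochner_integral_real_affine_iff[of u "\<lambda>t. indicator {0..} t * t powr g / exp t" "Gamma (1+g)" 0] by simp
  hence "has_bochner_integral lborel (\<lambda>t. u powr (-g) * (indicator {0..} (0 + u*t) * (0+u*t) powr g / exp (0+u*t))) (u powr (-g) * (Gamma (1+g) /\<^sub>R \<bar>u\<bar>))"
    by (intro has_bochner_integral_mult_right) auto
  also have "(\<lambda>t. u powr (-g) * (indicator {0..} (0 + u*t) * (0+u*t) powr g / exp (0+u*t))) = (\<lambda>t. indicator {0..} t *\<^sub>R (t powr g * exp (-(u*t))))"
  proof
    fix t :: real
    show "u powr (-g) * (indicator {0..} (0 + u*t) * (0+u*t) powr g / exp (0+u*t)) = indicator {0..} t *\<^sub>R (t powr g * exp (-(u*t)))"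
    proof (cases "t \<ge> 0")
      case True
      then show ?thesis using assms by (simp add: powr_mult powr_minus exp_minus field_simps)
    next
      case False
      then have "u * t < 0" using assms by (simp add: mult_pos_neg)
      then show ?thesis using False by simp
    qed
  qed
  also have "u powr (-g) * (Gamma (1+g) /\<^sub>R \<bar>u\<bar>) = Gamma (1+g) * u powr (-(1+g))"
    using assms by (simp only: powr_neg_Suc) (simp add: field_simps)
  finally show ?thesis .
qed

lemma set_integrable_powr_exp:
  fixes u g :: real
  assumes "u > 0" "g > -1"
  shows "set_integrable lborel {0..} (\<lambda>t. t powr g * exp (-(u*t)))"
    and "(LBINT t:{0..}. t powr g * exp (-(u*t))) = Gamma (1 + g) * u powr (-(1+g))"
  using has_bochner_integral_powr_exp[OF assms]
  by (auto simp: set_integrable_def set_lebesgue_integral_def has_bochner_integral_iff)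

lemma set_integrable_exp:
  fixes u :: real
  assumes "u > 0"
  shows "set_integrable lborel {0..} (\<lambda>t. exp (-(u*t)))"
    and "(LBINT t:{0..}. exp (-(u*t))) = 1 / u"
proof -
  \<comment> \<open>\<open>0 powr 0 = 0\<close>, so the case g = 0 of the Gamma integral agrees with
    the plain exponential only away from t = 0.\<close>
  have eq: "AE t in lborel. indicator {0..} t *\<^sub>R (t powr 0 * exp (-(u*t))) = indicator {0..} t *\<^sub>R exp (-(u*t))"
    using AE_lborel_singleton[of "0::real"] by eventually_elim auto
  have "has_bochner_integral lborel (\<lambda>t. indicator {0..} t *\<^sub>R exp (-(u*t))) (Gamma (1 + 0) * u powr (-(1+0)))"
    by (rule iffD1[OF has_bochner_integral_cong_AE[OF _ _ eq]])
       (use has_bochner_integral_powr_exp[OF assms, of 0] in auto)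
  thus "set_integrable lborel {0..} (\<lambda>t. exp (-(u*t)))" and "(LBINT t:{0..}. exp (-(u*t))) = 1 / u"
    using assms by (auto simp: set_integrable_def set_lebesgue_integral_def has_bochner_integral_iff powr_minus field_simps)
qed

lemma set_integral_exp_piece:
  fixes s a b :: real
  assumes "a \<le> b"
  shows "(LBINT t:{a..b}. s * exp (-(s*t))) = exp (-(s*a)) - exp (-(s*b))"
proof -
  have "(\<integral>t. indicator {a..b} t *\<^sub>R (s * exp (-(s*t))) \<partial>lborel) = (- exp (-(s*b))) - (- exp (-(s*a)))"
    by (rule integral_FTC_Icc[OF assms])
       (auto intro!: derivative_eq_intros continuous_intros simp: has_real_derivative_iff_has_vector_derivative[symmetric])
  thus ?thesis unfolding set_lebesgue_integral_def by linarith
qed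

text \<open>On the interior of \<open>piece n\<close> the number of integers k \<ge> 1 with ln k
  \<le> t is constantly n. Cutting the half-line here turns an Abel sum into a Laplace integral of a
  step function.\<close>

definition piece :: "nat \<Rightarrow> real set" where "piece n = {ln (real n)..ln (real (Suc n))}"

text \<open>The weight of the n-th partial sum in Abel summation; it is the mass that s * exp (-s t)
  gives to \<open>piece n\<close>.\<close>

definition powr_drop :: "real \<Rightarrow> nat \<Rightarrow> real" where "powr_drop s n = real n powr (-s) - real (Suc n) powr (-s)"

lemma piece_subset: "piece n \<subseteq> {0..}"
  unfolding piece_def by (cases "n = 0") auto

lemma set_integral_piece_exp:
  assumes "n \<ge> 1"
  shows "(LBINT t:piece n. s * exp (-(s*t))) = powr_drop s n"
  unfolding piece_def using assms
  by (subst set_integral_exp_piece) (auto simp: powr_drop_def powr_def)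

lemma sum_set_integral_piece:
  fixes f :: "real \<Rightarrow> real"
  assumes "set_integrable lborel {0..} f"
  shows "(\<Sum>n=1..N. LBINT t:piece n. f t) = (LBINT t:{0..ln (real (Suc N))}. f t)"
proof (induction N)
  case 0
  have "(LBINT t:{0::real}. f t) = 0"
    unfolding set_lebesgue_integral_def
    by (rule integral_eq_zero_AE) (use AE_lborel_singleton[of "0::real"] in eventually_elim, auto)
  then show ?case by simp
next
  case (Suc N)
  let ?a = "ln (real (Suc N))" and ?b = "ln (real (Suc (Suc N)))"
  have ab: "0 \<le> ?a" "?a \<le> ?b" by (auto simp del: of_nat_Suc)
  have "(LBINT t:{0..?a}\<union>{?a..?b}. f t) = (LBINT t:{0..?a}. f t) + (LBINT t:{?a..?b}. f t)"
  proof (rule set_integral_Un_AE)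
    \<comment> \<open>Neighbouring pieces share an endpoint, so they are disjoint only up to a null
      set.\<close>
    show "AE x in lborel. \<not> (x \<in> {0..?a} \<and> x \<in> {?a..?b})"
      using AE_lborel_singleton[of ?a] by eventually_elim auto
    show "set_integrable lborel {0..?a} f" "set_integrable lborel {?a..?b} f"
      using ab by (auto intro!: set_integrable_subset[OF assms] intro: order_trans[of 0 ?a] simp del: of_nat_Suc)
  qed auto
  moreover have "{0..?a}\<union>{?a..?b} = {0..?b}" using ab by (intro ivl_disj_un_two_touch)
  ultimately show ?case using Suc by (simp add: piece_def)
qed

lemma set_integral_piece_sums:
  fixes f :: "real \<Rightarrow> real"
  assumes "set_integrable lborel {0..} f"
  shows "(\<lambda>n. LBINT t:piece (Suc n). f t) sums (LBINT t:{0..}. f t)"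
proof -
  have 1: "((\<lambda>b. LBINT t:{0..b}. f t) \<longlongrightarrow> (LBINT t:{0..}. f t)) at_top"
    by (rule tendsto_set_lebesgue_integral_at_top[OF _ assms]) auto
  have 2: "filterlim (\<lambda>N. ln (real (Suc N))) at_top sequentially"
    by real_asymp
  have "(\<lambda>N. \<Sum>n=1..N. LBINT t:piece n. f t) \<longlonglongrightarrow> (LBINT t:{0..}. f t)"
    using filterlim_compose[OF 1 2] by (simp only: sum_set_integral_piece[OF assms])
  moreover have "(\<Sum>n=1..N. LBINT t:piece n. f t) = (\<Sum>n<N. LBINT t:piece (Suc n). f t)" for N
    using sum.atLeast1_atMost_eq[of "\<lambda>n. LBINT t:piece n. f t" N] by simp
  ultimately show ?thesis unfolding sums_def by simp
qed

text \<open>The errors on the pieces are dominated by the integrals of \<open>h\<close>, which add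
  up, so they form an absolutely convergent series. With \<open>f\<close> a power times an
  exponential this yields asymptotics, with \<open>f = 0\<close> a bound for differences.\<close>

lemma piece_compare:
  fixes f h :: "real \<Rightarrow> real"
  assumes f: "set_integrable lborel {0..} f" and h: "set_integrable lborel {0..} h"
    and q: "\<And>n. n \<ge> 1 \<Longrightarrow> \<bar>q n - (LBINT t:piece n. f t)\<bar> \<le> (LBINT t:piece n. h t)"
  shows "summable (\<lambda>n. q (Suc n))" "\<bar>(\<Sum>n. q (Suc n)) - (LBINT t:{0..}. f t)\<bar> \<le> (LBINT t:{0..}. h t)"
proof -
  define r where "r n = q (Suc n) - (LBINT t:piece (Suc n). f t)" for n
  have r: "\<bar>r n\<bar> \<le> (LBINT t:piece (Suc n). h t)" for n
    unfolding r_def by (rule q) simp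
  note hs = set_integral_piece_sums[OF h] and fs = set_integral_piece_sums[OF f]
  have sr: "summable (\<lambda>n. \<bar>r n\<bar>)"
    by (rule summable_comparison_test'[OF sums_summable[OF hs], of 0]) (use r in auto)
  hence sr': "summable r" by (rule summable_rabs_cancel)
  have "(\<lambda>n. r n + (LBINT t:piece (Suc n). f t)) sums (suminf r + (LBINT t:{0..}. f t))"
    by (intro sums_add summable_sums sr' fs)
  hence qs: "(\<lambda>n. q (Suc n)) sums (suminf r + (LBINT t:{0..}. f t))" by (simp add: r_def)
  thus "summable (\<lambda>n. q (Suc n))" by (rule sums_summable)
  have "\<bar>suminf r\<bar> \<le> (\<Sum>n. \<bar>r n\<bar>)" by (rule summable_rabs[OF sr])
  also have "\<dots> \<le> (LBINT t:{0..}. h t)"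
    using suminf_le[OF r sr sums_summable[OF hs]] hs by (simp add: sums_iff)
  finally show "\<bar>(\<Sum>n. q (Suc n)) - (LBINT t:{0..}. f t)\<bar> \<le> (LBINT t:{0..}. h t)"
    using qs by (simp add: sums_iff)
qed

section \<open>Abel summation: convergence, size and modulus of continuity from partial sums\<close>

lemma abel_summation:
  fixes z :: "nat \<Rightarrow> real"
  shows "(\<Sum>k=1..n. z k * real k powr (-s)) =
    (\<Sum>k=1..n. z k) * real (Suc n) powr (-s) + (\<Sum>m=1..n. (\<Sum>k=1..m. z k) * powr_drop s m)"
proof (induction n)
  case (Suc n)
  then show ?case by (simp add: powr_drop_def algebra_simps)
qed simp

definition dsum :: "(nat \<Rightarrow> real) \<Rightarrow> real \<Rightarrow> real" where
  "dsum z s = (\<Sum>k. z (Suc k) * real (Suc k) powr (-s))"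

lemma pieceD: "n \<ge> 1 \<Longrightarrow> t \<in> piece n \<Longrightarrow> 0 \<le> ln (real n) \<and> ln (real n) \<le> t \<and> 0 \<le> t"
  by (auto simp: piece_def intro: order_trans[of _ "ln (real n)"])

lemma set_integrable_pieceI:
  fixes f :: "real \<Rightarrow> real"
  shows "set_integrable lborel {0..} f \<Longrightarrow> set_integrable lborel (piece n) f"
  by (rule set_integrable_subset[OF _ _ piece_subset]) (auto simp: piece_def)

lemma powr_ln_tendsto_0:
  fixes A B g s :: real assumes "s > 0" "g > 0"
  shows "(\<lambda>n. (A + B * ln (real n) powr g) * real (Suc n) powr (-s)) \<longlonglongrightarrow> 0"
  using assms by real_asymp

text \<open>Partial sums growing like a power of the logarithm are killed by n^(-s), so the boundary
  term of Abel summation vanishes. No absolute convergence is involved.\<close>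

lemma abel_sums:
  fixes z :: "nat \<Rightarrow> real" and A B g s :: real
  defines "S \<equiv> \<lambda>n. \<Sum>k=1..n. z k"
  assumes s: "s > 0" and g: "g > 0"
    and bd: "\<And>n. n \<ge> 1 \<Longrightarrow> \<bar>S n\<bar> \<le> A + B * ln (real n) powr g"
    and sm: "summable (\<lambda>n. S (Suc n) * powr_drop s (Suc n))"
  shows "(\<lambda>k. z (Suc k) * real (Suc k) powr (-s)) sums (\<Sum>n. S (Suc n) * powr_drop s (Suc n))"
proof -
  have b0: "(\<lambda>n. S n * real (Suc n) powr (-s)) \<longlonglongrightarrow> 0"
  proof (rule Lim_null_comparison[OF _ powr_ln_tendsto_0[OF s g]])
    show "\<forall>\<^sub>F n in sequentially. norm (S n * real (Suc n) powr (-s)) \<le> (A + B * ln (real n) powr g) * real (Suc n) powr (-s)"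
      using eventually_ge_at_top[of 1]
      by eventually_elim (auto simp: abs_mult intro!: mult_right_mono bd)
  qed
  have "(\<lambda>n. \<Sum>m=1..n. S m * powr_drop s m) \<longlonglongrightarrow> (\<Sum>n. S (Suc n) * powr_drop s (Suc n))"
    using summable_LIMSEQ[OF sm] sum.atLeast1_atMost_eq[of "\<lambda>m. S m * powr_drop s m"] by simp
  from tendsto_add[OF b0 this] have "(\<lambda>n. \<Sum>k=1..n. z k * real k powr (-s)) \<longlonglongrightarrow> (\<Sum>n. S (Suc n) * powr_drop s (Suc n))"
    unfolding abel_summation S_def by (simp only: add_0_left)
  thus ?thesis unfolding sums_def
    using sum.atLeast1_atMost_eq[of "\<lambda>k. z k * real k powr (-s)"] by simp
qed

text \<open>Multiply the bound for the step function by s * exp (-s t) and integrate: t^g turns into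
  Gamma (1 + g) s^(-g), and a constant stays a constant. Keeping \<open>C\<close> and
  \<open>B\<close> separate serves two purposes: \<open>B\<close> small gives the Abelian
  asymptotics, \<open>C = 0\<close> a plain bound.\<close>

lemma abel_compare:
  fixes z :: "nat \<Rightarrow> real" and A B C g s :: real
  defines "S \<equiv> \<lambda>n. \<Sum>k=1..n. z k"
  assumes s: "s > 0" and g: "g > 0"
    and bd: "\<And>n t. n \<ge> 1 \<Longrightarrow> t \<in> piece n \<Longrightarrow> \<bar>S n - C * t powr g\<bar> \<le> A + B * t powr g"
  shows "summable (\<lambda>k. z (Suc k) * real (Suc k) powr (-s))"
    and "(\<lambda>n. S (Suc n) * powr_drop s (Suc n)) sums dsum z s"
    and "\<bar>dsum z s - C * Gamma (1 + g) * s powr (-g)\<bar> \<le> A + B * Gamma (1 + g) * s powr (-g)"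
proof -
  define f where "f t = C * s * (t powr g * exp (-(s*t)))" for t
  define h where "h t = A * s * exp (-(s*t)) + B * s * (t powr g * exp (-(s*t)))" for t
  have g1: "g > -1" using g by simp
  note i1 = set_integrable_powr_exp[OF s g1] and i2 = set_integrable_exp[OF s]
  have s1: "s * s powr (-(1+g)) = s powr (-g)"
    using s by (simp only: powr_neg_Suc) simp
  have f: "set_integrable lborel {0..} f" "(LBINT t:{0..}. f t) = C * Gamma (1 + g) * s powr (-g)"
    unfolding f_def using i1 s1 by (auto simp: mult.assoc)
  have h: "set_integrable lborel {0..} h" "(LBINT t:{0..}. h t) = A + B * Gamma (1 + g) * s powr (-g)"
    unfolding h_def using i1 i2 s1 s by (auto simp: mult.assoc set_integral_add)
  have q: "\<bar>S n * powr_drop s n - (LBINT t:piece n. f t)\<bar> \<le> (LBINT t:piece n. h t)" if n: "n \<ge> 1" for n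
  proof -
    have e: "set_integrable lborel (piece n) (\<lambda>t. S n * (s * exp (-(s*t))))"
      by (intro set_integrable_pieceI) (use i2 in auto)
    note fi = set_integrable_pieceI[OF f(1), of n] and hi = set_integrable_pieceI[OF h(1), of n]
    have "S n * powr_drop s n - (LBINT t:piece n. f t) = (LBINT t:piece n. S n * (s * exp (-(s*t))) - f t)"
      using set_integral_piece_exp[OF n, of s] by (subst set_integral_diff[OF e fi]) simp
    also have "\<bar>\<dots>\<bar> \<le> (LBINT t:piece n. \<bar>S n * (s * exp (-(s*t))) - f t\<bar>)"
      using set_integral_norm_bound[OF set_integral_diff(1)[OF e fi]] by simp
    also have "\<dots> \<le> (LBINT t:piece n. h t)"
    proof (rule set_integral_mono[OF _ hi])
      show "set_integrable lborel (piece n) (\<lambda>t. \<bar>S n * (s * exp (-(s*t))) - f t\<bar>)"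
        using set_integrable_abs[OF set_integral_diff(1)[OF e fi]] by simp
      fix t assume t: "t \<in> piece n"
      have "\<bar>S n * (s * exp (-(s*t))) - f t\<bar> = \<bar>S n - C * t powr g\<bar> * (s * exp (-(s*t)))"
      proof -
        have "S n * (s * exp (-(s*t))) - f t = (S n - C * t powr g) * (s * exp (-(s*t)))"
          by (simp add: f_def algebra_simps)
        thus ?thesis using s by (simp add: abs_mult)
      qed
      also have "\<dots> \<le> (A + B * t powr g) * (s * exp (-(s*t)))"
        using s bd[OF n t] by (intro mult_right_mono) auto
      also have "\<dots> = h t" by (simp add: h_def algebra_simps)
      finally show "\<bar>S n * (s * exp (-(s*t))) - f t\<bar> \<le> h t" .
    qed
    finally show ?thesis .
  qed
  have c: "summable (\<lambda>n. S (Suc n) * powr_drop s (Suc n))"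
    "\<bar>(\<Sum>n. S (Suc n) * powr_drop s (Suc n)) - (LBINT t:{0..}. f t)\<bar> \<le> (LBINT t:{0..}. h t)"
    by (rule piece_compare[OF f(1) h(1), of "\<lambda>n. S n * powr_drop s n"]; rule q; assumption)+
  have S: "\<bar>S n\<bar> \<le> A + (B + \<bar>C\<bar>) * ln (real n) powr g" if n: "n \<ge> 1" for n
  proof -
    have "\<bar>S n - C * ln (real n) powr g\<bar> \<le> A + B * ln (real n) powr g"
      using bd[OF n, of "ln (real n)"] n by (auto simp: piece_def)
    moreover have "\<bar>C * ln (real n) powr g\<bar> = \<bar>C\<bar> * ln (real n) powr g" by (simp add: abs_mult)
    ultimately show ?thesis by (simp add: algebra_simps)
  qed
  have "(\<lambda>k. z (Suc k) * real (Suc k) powr (-s)) sums (\<Sum>n. S (Suc n) * powr_drop s (Suc n))"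
    unfolding S_def by (rule abel_sums[OF s g S[unfolded S_def] c(1)[unfolded S_def]])
  thus "summable (\<lambda>k. z (Suc k) * real (Suc k) powr (-s))"
    and "(\<lambda>n. S (Suc n) * powr_drop s (Suc n)) sums dsum z s"
    and "\<bar>dsum z s - C * Gamma (1 + g) * s powr (-g)\<bar> \<le> A + B * Gamma (1 + g) * s powr (-g)"
    using c f h by (auto simp: dsum_def sums_iff)
qed

lemma abel_bound:
  fixes z :: "nat \<Rightarrow> real" and A B g s :: real
  assumes s: "s > 0" and g: "g > 0" and B: "B \<ge> 0"
    and bd: "\<And>n. n \<ge> 1 \<Longrightarrow> \<bar>\<Sum>k=1..n. z k\<bar> \<le> A + B * ln (real n) powr g"
  shows "summable (\<lambda>k. z (Suc k) * real (Suc k) powr (-s))"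
    and "\<bar>dsum z s\<bar> \<le> A + B * Gamma (1 + g) * s powr (-g)"
    and "(\<lambda>n. (\<Sum>k=1..Suc n. z k) * powr_drop s (Suc n)) sums dsum z s"
proof -
  have "\<bar>(\<Sum>k=1..n. z k) - 0 * t powr g\<bar> \<le> A + B * t powr g" if "n \<ge> 1" "t \<in> piece n" for n t
  proof -
    have "ln (real n) powr g \<le> t powr g"
      using pieceD[OF that] g by (intro powr_mono2) auto
    then show ?thesis using bd[OF that(1)] B mult_left_mono[of _ _ B] by fastforce
  qed
  from abel_compare[OF s g this]
  show "summable (\<lambda>k. z (Suc k) * real (Suc k) powr (-s))"
    and "\<bar>dsum z s\<bar> \<le> A + B * Gamma (1 + g) * s powr (-g)"
    and "(\<lambda>n. (\<Sum>k=1..Suc n. z k) * powr_drop s (Suc n)) sums dsum z s" by (simp_all only: mult_zero_left diff_0_right)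
qed

text \<open>The kernel s * exp (-s t) changes between s and s' by at most (s' - s) (1 + s t) exp (-s
  t). Integrating this against A + B t^g produces 2 A / s from the constant, and Gamma (1 + g) and
  Gamma (2 + g) from the power. The result is a relative modulus of continuity that depends on the
  coefficients only through their partial sums.\<close>

lemma abel_lipschitz:
  fixes z :: "nat \<Rightarrow> real" and A B g s s' :: real
  assumes s: "0 < s" "s \<le> s'" and g: "g > 0" and B: "B \<ge> 0"
    and bd: "\<And>n. n \<ge> 1 \<Longrightarrow> \<bar>\<Sum>k=1..n. z k\<bar> \<le> A + B * ln (real n) powr g"
  shows "\<bar>dsum z s' - dsum z s\<bar> \<le> (s' - s) / s * (2 * A + B * (Gamma (1 + g) + Gamma (2 + g)) * s powr (-g))"
proof -
  define S where "S n = (\<Sum>k=1..n. z k)" for n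
  have g1: "g > -1" using g by simp
  have g2: "g + 1 > -1" using g by simp
  have one: "(1::real) > -1" by simp
  have s': "s' > 0" using s by simp
  note i1 = set_integrable_powr_exp[OF s(1) g1] and i2 = set_integrable_exp[OF s(1)]
    and i3 = set_integrable_powr_exp[OF s(1) g2] and i4 = set_integrable_powr_exp[OF s(1) one]
  note i5 = set_integrable_exp[OF s']
  \<comment> \<open>The expanded product of A + B t^g and (s' - s) (1 + s t) exp (-s t), one Gamma
    integral for each summand.\<close>
  define h where "h t = (s' - s) * (A * exp (-(s*t)) + A * s * (t powr 1 * exp (-(s*t)))
     + B * (t powr g * exp (-(s*t))) + B * s * (t powr (g+1) * exp (-(s*t))))" for t
  have e1: "s * s powr (-(1+(g+1))) = s powr (-g) / s" "s powr (-(1+g)) = s powr (-g) / s"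
     "s * s powr (-(1+1)) = 1 / s"
    using s by (simp_all only: powr_neg_Suc, simp_all only: powr_neg_Suc[of s g] add.commute[of g 1])
       (simp_all add: powr_minus field_simps)
  have h: "set_integrable lborel {0..} h"
    unfolding h_def using i1 i2 i3 i4 by auto
  have "(LBINT t:{0..}. h t) = (s' - s) * (A * (1/s) + A * s * (Gamma (1 + 1) * s powr (-(1+1))) + B * (Gamma (1 + g) * s powr (-(1+g))) + B * s * (Gamma (1 + (g + 1)) * s powr (-(1+(g+1)))))"
    unfolding h_def using i1 i2 i3 i4 by (simp add: set_integral_add)
  also have "\<dots> = (s' - s) * (A * (1/s) + A * Gamma (1+1) * (s * s powr (-(1+1))) + B * (Gamma (1 + g) * s powr (-(1+g))) + B * Gamma (1 + (g + 1)) * (s * s powr (-(1+(g+1)))))"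
    by (simp only: ac_simps)
  also have "\<dots> = (s' - s) / s * (2 * A + B * (Gamma (1 + g) + Gamma (2 + g)) * s powr (-g))"
  proof -
    have "Gamma (1 + 1 :: real) = 1" using Gamma_fact[of 1, where 'a=real] by simp
    moreover have "1 + (g + 1) = 2 + g" by simp
    ultimately show ?thesis using s unfolding e1 by (simp add: field_simps)
  qed
  finally have hv: "(LBINT t:{0..}. h t) = (s' - s) / s * (2 * A + B * (Gamma (1 + g) + Gamma (2 + g)) * s powr (-g))" .
  have q: "\<bar>S n * (powr_drop s' n - powr_drop s n) - (LBINT t:piece n. 0)\<bar> \<le> (LBINT t:piece n. h t)" if n: "n \<ge> 1" for n
  proof -
    have e: "set_integrable lborel (piece n) (\<lambda>t. S n * (s' * exp (-(s'*t)) - s * exp (-(s*t))))"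
      by (intro set_integrable_pieceI) (use i2 i5 in auto)
    have e': "set_integrable lborel (piece n) (\<lambda>t. s' * exp (-(s'*t)))" "set_integrable lborel (piece n) (\<lambda>t. s * exp (-(s*t)))"
      by (intro set_integrable_pieceI; use i2 i5 in auto)+
    note hi = set_integrable_pieceI[OF h(1), of n]
    have "S n * (powr_drop s' n - powr_drop s n) - (LBINT t:piece n. 0) = (LBINT t:piece n. S n * (s' * exp (-(s'*t)) - s * exp (-(s*t))))"
      using set_integral_piece_exp[OF n, of s] set_integral_piece_exp[OF n, of s']
      by (simp only: set_integral_mult_right set_integral_diff(2)[OF e']) (simp add: set_lebesgue_integral_def)
    also have "\<bar>\<dots>\<bar> \<le> (LBINT t:piece n. \<bar>S n * (s' * exp (-(s'*t)) - s * exp (-(s*t)))\<bar>)"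
      using set_integral_norm_bound[OF e] by simp
    also have "\<dots> \<le> (LBINT t:piece n. h t)"
    proof (rule set_integral_mono[OF _ hi])
      show "set_integrable lborel (piece n) (\<lambda>t. \<bar>S n * (s' * exp (-(s'*t)) - s * exp (-(s*t)))\<bar>)"
        using set_integrable_abs[OF e] by simp
      fix t assume t: "t \<in> piece n"
      note tp = pieceD[OF n t]
      have E: "exp (-(s'*t)) \<le> exp (-(s*t))" using tp s by (auto intro!: mult_right_mono)
      have "exp (-(s'*t)) = exp (-(s*t)) * exp (-((s'-s)*t))" by (simp add: exp_add[symmetric] algebra_simps)
      moreover have "exp (-((s'-s)*t)) \<ge> 1 - (s'-s)*t" using exp_ge_add_one_self[of "-((s'-s)*t)"] by simp
      ultimately have E2: "exp (-(s'*t)) \<ge> exp (-(s*t)) * (1 - (s'-s)*t)" by simp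
      have "\<bar>s' * exp (-(s'*t)) - s * exp (-(s*t))\<bar> = \<bar>(s'-s) * exp (-(s'*t)) - s * (exp (-(s*t)) - exp (-(s'*t)))\<bar>"
        by (simp add: algebra_simps)
      also have "\<dots> \<le> (s'-s) * exp (-(s'*t)) + s * (exp (-(s*t)) - exp (-(s'*t)))"
        using s E by (intro order_trans[OF abs_triangle_ineq4]) (auto simp: abs_mult)
      also have "\<dots> \<le> (s'-s) * exp (-(s*t)) + s * (exp (-(s*t)) * ((s'-s)*t))"
        using s E E2 by (intro add_mono mult_left_mono) (auto simp: algebra_simps)
      finally have k: "\<bar>s' * exp (-(s'*t)) - s * exp (-(s*t))\<bar> \<le> (s'-s) * (exp (-(s*t)) + s * t * exp (-(s*t)))"
        by (simp add: algebra_simps)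
      have "ln (real n) powr g \<le> t powr g"
        using tp g by (intro powr_mono2) auto
      hence Sn: "\<bar>S n\<bar> \<le> A + B * t powr g" using bd[OF n] B mult_left_mono[of _ _ B] unfolding S_def by fastforce
      have "\<bar>S n * (s' * exp (-(s'*t)) - s * exp (-(s*t)))\<bar> \<le> (A + B * t powr g) * ((s'-s) * (exp (-(s*t)) + s * t * exp (-(s*t))))"
        unfolding abs_mult using Sn k by (intro mult_mono) auto
      also have "\<dots> = h t" using tp by (cases "t = 0") (auto simp: h_def algebra_simps powr_add)
      finally show "\<bar>S n * (s' * exp (-(s'*t)) - s * exp (-(s*t)))\<bar> \<le> h t" .
    qed
    finally show ?thesis .
  qed
  have "set_integrable lborel {0::real..} (\<lambda>t. 0 :: real)" by (simp add: set_integrable_def)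
  note c = piece_compare[OF this h(1) q]
  note ab = abel_bound(3)[OF _ g B bd, folded S_def]
  have "dsum z s' - dsum z s = (\<Sum>n. S (Suc n) * powr_drop s' (Suc n)) - (\<Sum>n. S (Suc n) * powr_drop s (Suc n))"
    using ab[OF s'] ab[OF s(1)] by (simp add: sums_iff)
  also have "\<dots> = (\<Sum>n. S (Suc n) * (powr_drop s' (Suc n) - powr_drop s (Suc n)))"
    using ab[OF s'] ab[OF s(1)] by (subst suminf_diff) (auto simp: algebra_simps sums_iff)
  finally show ?thesis using c(2) hv by (simp add: set_lebesgue_integral_def)
qed

text \<open>Since ln (n + 1) / ln n tends to 1, the asymptotics at ln n extend to all of
  \<open>piece n\<close>. Half of \<open>e\<close> pays for the asymptotics and half for moving
  inside the piece; the finitely many exceptional n go into the constant.\<close>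

lemma partial_sums_compare:
  fixes V :: "nat \<Rightarrow> real"
  assumes V: "V \<sim>[at_top] (\<lambda>n. C * ln (real n) powr b)" and C: "C > 0" and b: "b > 0" and e: "e > 0"
  shows "\<exists>A\<ge>0. \<forall>n\<ge>1. \<forall>t\<in>piece n. \<bar>V n - C * t powr b\<bar> \<le> A + e * t powr b"
proof -
  have "(\<lambda>n. V n - C * ln (real n) powr b) \<in> o[at_top](\<lambda>n. C * ln (real n) powr b)"
    using V by (simp add: asymp_equiv_altdef)
  hence ev1: "\<forall>\<^sub>F n in at_top. norm (V n - C * ln (real n) powr b) \<le> (e / (2*C)) * norm (C * ln (real n) powr b)"
    using e C by (intro landau_o.smallD) auto
  have "((\<lambda>n. ln (real (Suc n)) powr b / ln (real n) powr b) \<longlongrightarrow> 1) at_top"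
    using b by real_asymp
  hence ev2: "\<forall>\<^sub>F n in at_top. ln (real (Suc n)) powr b / ln (real n) powr b < 1 + e/(2*C)"
    using e C by (intro order_tendstoD) auto
  from eventually_conj[OF ev1 ev2] obtain n0 where n0: "\<And>n. n \<ge> n0 \<Longrightarrow>
      norm (V n - C * ln (real n) powr b) \<le> (e / (2*C)) * norm (C * ln (real n) powr b) \<and>
      ln (real (Suc n)) powr b / ln (real n) powr b < 1 + e/(2*C)"
    by (auto simp: eventually_at_top_linorder)
  \<comment> \<open>Reaching up to n0 + 2 guarantees ln n > 0 for the remaining n.\<close>
  define A where "A = (\<Sum>n\<le>n0+2. \<bar>V n\<bar> + C * ln (real (Suc n)) powr b)"
  have A0: "A \<ge> 0" unfolding A_def using C by (intro sum_nonneg) auto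
  have "\<bar>V n - C * t powr b\<bar> \<le> A + e * t powr b" if n: "n \<ge> 1" and t: "t \<in> piece n" for n t
  proof -
    have tt: "ln (real n) powr b \<le> t powr b" "t powr b \<le> ln (real (Suc n)) powr b"
      using pieceD[OF n t] t b by (auto simp: piece_def intro!: powr_mono2)
    show ?thesis
    proof (cases "n \<le> n0 + 2")
      case True
      have "\<bar>V n\<bar> + C * ln (real (Suc n)) powr b \<le> A"
        unfolding A_def using True C by (intro member_le_sum) auto
      moreover have "C * t powr b \<le> C * ln (real (Suc n)) powr b" using tt C by auto
      moreover have "0 \<le> C * t powr b" "0 \<le> e * t powr b" using C e by auto
      ultimately show ?thesis by linarith
    next
      case False
      hence pos: "ln (real n) powr b > 0" by simp
      have 1: "\<bar>V n - C * ln (real n) powr b\<bar> \<le> e/2 * ln (real n) powr b"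
        using n0[of n] False C by (simp add: abs_mult field_simps)
      have "ln (real (Suc n)) powr b \<le> (1 + e/(2*C)) * ln (real n) powr b"
        using n0[of n] False pos by (auto simp: pos_divide_less_eq simp del: of_nat_Suc)
      hence "C * t powr b \<le> C * ((1 + e/(2*C)) * ln (real n) powr b)" using tt C by auto
      also have "\<dots> = C * ln (real n) powr b + e/2 * ln (real n) powr b" using C by (simp add: field_simps)
      finally have 2: "\<bar>C * t powr b - C * ln (real n) powr b\<bar> \<le> e/2 * ln (real n) powr b"
        using tt C by auto
      have "e * ln (real n) powr b \<le> e * t powr b" using tt e by auto
      thus ?thesis using 1 2 A0 by linarith
    qed
  qed
  thus ?thesis using A0 by blast
qed

text \<open>The additive constant of \<open>abel_compare\<close> is absorbed because s^(-b) is
  unbounded near 0, and \<open>e\<close> in \<open>partial_sums_compare\<close> is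
  arbitrary.\<close>

lemma abelian_asymp:
  fixes z :: "nat \<Rightarrow> real"
  assumes V: "(\<lambda>n. \<Sum>k=1..n. z k) \<sim>[at_top] (\<lambda>n. C * ln (real n) powr b)" and C: "C > 0" and b: "b > 0"
  shows "dsum z \<sim>[at_right 0] (\<lambda>s. C * Gamma (1 + b) * s powr (-b))"
    and "s > 0 \<Longrightarrow> summable (\<lambda>k. z (Suc k) * real (Suc k) powr (-s))"
proof -
  have G: "Gamma (1 + b) > 0" using b by (intro Gamma_real_pos) auto
  {
    fix e :: real assume e: "e > 0"
    from partial_sums_compare[OF V C b e] obtain A where A: "A \<ge> 0"
      "\<And>n t. n \<ge> 1 \<Longrightarrow> t \<in> piece n \<Longrightarrow> \<bar>(\<Sum>k=1..n. z k) - C * t powr b\<bar> \<le> A + e * t powr b" by blast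
    note c = abel_compare[OF _ b A(2)]
    have "\<forall>\<^sub>F s in at_right 0. A \<le> e * Gamma (1+b) * s powr (-b)"
      using b e G by real_asymp
    moreover have "\<forall>\<^sub>F s in at_right (0::real). s > 0" by (simp add: eventually_at_filter)
    ultimately have "\<forall>\<^sub>F s in at_right 0. \<bar>dsum z s - C * Gamma (1 + b) * s powr (-b)\<bar> \<le> 2 * e * Gamma (1+b) * s powr (-b)"
      by eventually_elim (use c(3) in fastforce)
    note this c(1)
  } note * = this
  show "s > 0 \<Longrightarrow> summable (\<lambda>k. z (Suc k) * real (Suc k) powr (-s))"
    using *(2)[of 1] by auto
  have "(\<lambda>s. dsum z s - C * Gamma (1 + b) * s powr (-b)) \<in> o[at_right 0](\<lambda>s. C * Gamma (1 + b) * s powr (-b))"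
  proof (rule landau_o.smallI)
    fix c :: real assume c: "c > 0"
    show "\<forall>\<^sub>F s in at_right 0. norm (dsum z s - C * Gamma (1 + b) * s powr (-b)) \<le> c * norm (C * Gamma (1 + b) * s powr (-b))"
      using *(1)[of "c * C / 2"] c C G by (auto simp: abs_mult mult.assoc)
  qed
  thus "dsum z \<sim>[at_right 0] (\<lambda>s. C * Gamma (1 + b) * s powr (-b))"
    by (simp add: asymp_equiv_altdef)
qed

section \<open>Paths of Dirichlet series\<close>

definition llog :: "real \<Rightarrow> real" where "llog s = ln (ln (1 / s))"
text \<open>For a variance asymptotic to D s^(-b) the normalizer of the iterated logarithm is
  asymptotic to sqrt (2 D) times this function: the iterated logarithm of s^(-b) is asymptotic to
  that of 1/s.\<close>

definition lil_scale :: "real \<Rightarrow> real \<Rightarrow> real" where "lil_scale b s = s powr (-b/2) * sqrt (llog s)"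

text \<open>At s = exp (- exp 1) the value of \<open>llog\<close> is exactly 1. Below this threshold
  all iterated logarithms are safely positive.\<close>

lemma iterated_ln_small:
  assumes "0 < s" "s < exp (- exp 1)"
  shows "ln (1/s) > exp 1" "llog s > 1" "lil_scale b s > 0"
proof -
  have "ln s < - exp 1" using assms by (metis ln_exp ln_less_cancel_iff exp_gt_zero)
  thus 1: "ln (1/s) > exp 1" using assms by (simp add: ln_div)
  thus 2: "llog s > 1" unfolding llog_def by (metis exp_gt_zero less_trans ln_exp ln_less_cancel_iff)
  thus "lil_scale b s > 0" using assms by (simp add: lil_scale_def)
qed

text \<open>The partial sums will be bounded by \<open>lil_scale\<close> at 1 / ln n, which is not a
  power of ln n, while the Abel integrals need powers. For s t \<le> 1 monotonicity is enough. For x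
  = s t > 1 one has ln t \<le> ln (1/s) (1 + ln x), so the iterated logarithm grows at most by the
  factor x; one additional power of s t pays for this.\<close>

lemma lil_scale_compare:
  assumes s: "0 < s" "s < exp (- exp 1)" and t: "t \<ge> exp 1" and b: "b > 0"
  shows "lil_scale b (1/t) \<le> lil_scale b s * (1 + s powr (b/2+1) * t powr (b/2+1))"
proof -
  note ss = iterated_ln_small[OF s]
  have "exp 1 > (1::real)" by simp
  hence t0: "t > 0" "t > 1" "ln t \<ge> 1" using t less_le_trans[OF exp_gt_zero t] less_le_trans[OF _ t, of 1] by (auto simp: ln_ge_iff)
  have ph: "lil_scale b (1/t) = t powr (b/2) * sqrt (ln (ln t))"
    using t0 by (simp add: lil_scale_def llog_def powr_minus powr_divide)
  show ?thesis
  proof (cases "s * t \<le> 1")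
    case True
    hence ts: "t \<le> 1/s" using s by (simp add: field_simps)
    have "ln t \<le> ln (1/s)" using ts t0 s by (subst ln_le_cancel_iff) auto
    hence "ln (ln t) \<le> llog s" unfolding llog_def using t0 by (subst ln_le_cancel_iff) auto
    moreover have "t powr (b/2) \<le> (1/s) powr (b/2)" using ts t0 b by (intro powr_mono2) auto
    ultimately have "lil_scale b (1/t) \<le> (1/s) powr (b/2) * sqrt (llog s)"
      unfolding ph using t0 by (intro mult_mono) auto
    also have "\<dots> = lil_scale b s" using s by (simp add: lil_scale_def powr_minus_divide powr_divide)
    also have "lil_scale b s \<le> lil_scale b s * (1 + s powr (b/2+1) * t powr (b/2+1))"
      using ss(3)[of b] by auto
    finally show ?thesis .
  next
    case False
    define x where "x = s * t"
    have x: "x > 1" using False by (simp add: x_def)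
    have tx: "t = x / s" using s by (simp add: x_def)
    have l1: "1 \<le> ln (1/s)" using ss(1) one_le_exp_iff[of 1] by linarith
    have lx: "0 \<le> ln x" "ln x \<le> x - 1" using x ln_le_minus_one[of x] by auto
    have "ln t = ln (1/s) + ln x" unfolding tx using x s by (simp add: ln_div)
    also have "\<dots> \<le> ln (1/s) + ln (1/s) * ln x" using l1 lx mult_right_mono[OF l1, of "ln x"] by simp
    also have "\<dots> = ln (1/s) * (1 + ln x)" by (simp add: algebra_simps)
    finally have "ln (ln t) \<le> ln (ln (1/s) * (1 + ln x))" using t0 l1 lx by (subst ln_le_cancel_iff) auto
    also have "\<dots> = llog s + ln (1 + ln x)" using l1 lx by (subst ln_mult) (auto simp: llog_def)
    also have "ln (1 + ln x) \<le> ln x" using lx ln_add_one_self_le_self[of "ln x"] by simp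
    also have "llog s + ln x \<le> llog s * x"
    proof -
      have "ln x \<le> llog s * (x - 1)" using lx ss(2) x mult_mono[of 1 "llog s" "ln x" "x - 1"] by auto
      thus ?thesis by (simp add: algebra_simps)
    qed
    finally have "sqrt (ln (ln t)) \<le> sqrt (llog s * x)" by simp
    also have "\<dots> = sqrt (llog s) * sqrt x" by (simp add: real_sqrt_mult)
    also have "\<dots> \<le> sqrt (llog s) * x" using x ss(2) real_sqrt_le_mono[of x "x^2"]
      by (intro mult_left_mono) (auto simp: power2_eq_square)
    finally have 1: "sqrt (ln (ln t)) \<le> sqrt (llog s) * x" .
    have 2: "t powr (b/2) = s powr (-b/2) * x powr (b/2)"
      unfolding tx using x s by (simp add: powr_divide powr_minus_divide)
    have "lil_scale b (1/t) \<le> t powr (b/2) * (sqrt (llog s) * x)"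
      unfolding ph using 1 by (intro mult_left_mono) auto
    also have "\<dots> = lil_scale b s * x powr (b/2+1)"
      unfolding 2 using x by (simp add: lil_scale_def powr_add)
    also have "x powr (b/2+1) = s powr (b/2+1) * t powr (b/2+1)"
      unfolding x_def using s t0 by (simp add: powr_mult)
    finally show ?thesis using ss(3)[of b] by (simp add: algebra_simps)
  qed
qed

lemma abel_continuous:
  fixes z :: "nat \<Rightarrow> real" and A B g :: real
  assumes g: "g > 0" and A: "A \<ge> 0" and B: "B \<ge> 0"
    and bd: "\<And>n. n \<ge> 1 \<Longrightarrow> \<bar>\<Sum>k=1..n. z k\<bar> \<le> A + B * ln (real n) powr g"
  shows "continuous_on {0<..} (dsum z)"
proof -
  have G: "Gamma (1 + g) > 0" "Gamma (2+g) > 0" using g by (auto intro!: Gamma_real_pos)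
  have "isCont (dsum z) x" if x: "x > 0" for x
  proof -
    define r where "r = x/2"
    have r: "0 < r" "r < x" using x by (auto simp: r_def)
    define Mc where "Mc = (2 * A + B * (Gamma (1 + g) + Gamma (2 + g)) * r powr (-g)) / r"
    have Mc0: "Mc \<ge> 0" unfolding Mc_def using A B G r by (intro divide_nonneg_pos add_nonneg_nonneg mult_nonneg_nonneg) auto
    have *: "\<bar>dsum z v - dsum z u\<bar> \<le> Mc * (v - u)" if "r \<le> u" "u \<le> v" for u v
    proof -
      have u: "u > 0" using r that by simp
      have "\<bar>dsum z v - dsum z u\<bar> \<le> (v - u) / u * (2 * A + B * (Gamma (1 + g) + Gamma (2 + g)) * u powr (-g))"
        by (rule abel_lipschitz[OF u that(2) g B bd])
      also have "\<dots> \<le> (v - u) / r * (2 * A + B * (Gamma (1 + g) + Gamma (2 + g)) * r powr (-g))"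
        using that r u A B G g
        by (intro mult_mono divide_left_mono add_mono mult_left_mono powr_mono2' add_nonneg_nonneg mult_nonneg_nonneg) auto
      finally show ?thesis by (simp add: Mc_def mult.commute)
    qed
    have "Mc-lipschitz_on {r..} (dsum z)"
    proof (rule lipschitz_onI[OF _ Mc0])
      fix u v assume "u \<in> {r..}" "v \<in> {r..}"
      thus "dist (dsum z u) (dsum z v) \<le> Mc * dist u v"
        using *[of u v] *[of v u] by (cases "u \<le> v") (auto simp: dist_real_def abs_minus_commute)
    qed
    hence "continuous_on {r..} (dsum z)" by (rule lipschitz_on_continuous_on)
    thus ?thesis using r by (intro continuous_on_interior[of "{r..}"]) auto
  qed
  thus ?thesis by (auto intro!: continuous_at_imp_continuous_on)
qed

text \<open>At a given s, \<open>lil_scale_compare\<close> bounds the partial sums by a constant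
  plus \<open>lil_scale b s * s powr g\<close> times a power g of ln n. In
  \<open>abel_lipschitz\<close> the factor s^g cancels against s^(-g), so the modulus at s is of the
  order of \<open>lil_scale b s\<close> itself.\<close>

lemma path_bounds:
  fixes z :: "nat \<Rightarrow> real" and K b :: real and n0 :: nat
  assumes b: "b > 0" and K: "K \<ge> 0"
    and bd: "\<And>n. n \<ge> n0 \<Longrightarrow> \<bar>\<Sum>k=1..n. z k\<bar> \<le> K * lil_scale b (1 / ln (real n))"
  defines "g \<equiv> b/2 + 1"
  shows "s > 0 \<Longrightarrow> summable (\<lambda>k. z (Suc k) * real (Suc k) powr (-s))"
    and "continuous_on {0<..} (dsum z)"
    and "\<exists>A\<ge>0. \<forall>s s'. 0 < s \<longrightarrow> s < exp (- exp 1) \<longrightarrow> s \<le> s' \<longrightarrow>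
            \<bar>dsum z s' - dsum z s\<bar> \<le> (s' - s) / s * (A + K * (2 + Gamma (1+g) + Gamma (2+g)) * lil_scale b s)"
proof -
  have g: "g > 0" using b by (simp add: g_def)
  define n1 where "n1 = max (max n0 1) (nat \<lceil>exp (exp (1::real))\<rceil>)"
  define A where "A = (\<Sum>n\<le>n1. \<bar>\<Sum>k=1..n. z k\<bar>)"
  have A: "A \<ge> 0" unfolding A_def by (intro sum_nonneg) auto
  have key: "\<bar>\<Sum>k=1..n. z k\<bar> \<le> (A + K * lil_scale b s) + (K * lil_scale b s * s powr g) * ln (real n) powr g"
    if s: "0 < s" "s < exp (- exp 1)" for s n
  proof (cases "n \<le> n1")
    case True
    have "\<bar>\<Sum>k=1..n. z k\<bar> \<le> A" unfolding A_def using True by (intro member_le_sum) auto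
    moreover have "0 \<le> K * lil_scale b s" "0 \<le> (K * lil_scale b s * s powr g) * ln (real n) powr g"
      using K iterated_ln_small(3)[OF s, of b] by auto
    ultimately show ?thesis by linarith
  next
    case False
    moreover have "nat \<lceil>exp (exp (1::real))\<rceil> \<le> n1" "n0 \<le> n1" unfolding n1_def by (rule max.cobounded2, simp)
    ultimately have nn: "n \<ge> n0" "nat \<lceil>exp (exp (1::real))\<rceil> \<le> n" by linarith+
    have n: "n \<ge> n0" "real n \<ge> exp (exp 1)"
      using nn(1) order_trans[OF real_nat_ceiling_ge of_nat_mono[OF nn(2)]] by auto
    have "ln (real n) \<ge> exp 1" using n(2) ln_mono[of "exp (exp 1)" "real n"] less_le_trans[OF exp_gt_zero n(2)] by simp
    from lil_scale_compare[OF s this b]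
    have "\<bar>\<Sum>k=1..n. z k\<bar> \<le> K * (lil_scale b s * (1 + s powr g * ln (real n) powr g))"
      unfolding g_def using K by (intro order_trans[OF bd[OF n(1)]] mult_left_mono) auto
    also have "\<dots> = K * lil_scale b s + (K * lil_scale b s * s powr g) * ln (real n) powr g" by (simp add: algebra_simps)
    finally show ?thesis using A by linarith
  qed
  \<comment> \<open>Summability and continuity at arbitrary arguments only need some polylogarithmic
    bound, so \<open>key\<close> at one reference point is enough for them.\<close>
  define s1 :: real where "s1 = exp (- exp 1) / 2"
  have s1: "0 < s1" "s1 < exp (- exp 1)" by (auto simp: s1_def)
  have B: "K * lil_scale b s * s powr g \<ge> 0" if "0 < s" "s < exp (- exp 1)" for s
    using K iterated_ln_small(3)[OF that, of b] by auto
  show "summable (\<lambda>k. z (Suc k) * real (Suc k) powr (-s))" if "s > 0"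
    by (rule abel_bound(1)[OF that g B[OF s1] key[OF s1]])
  show "continuous_on {0<..} (dsum z)"
  proof (rule abel_continuous[OF g _ B[OF s1] key[OF s1]])
    show "0 \<le> A + K * lil_scale b s1" using A K iterated_ln_small(3)[OF s1, of b] by simp
  qed
  have "\<bar>dsum z s' - dsum z s\<bar> \<le> (s' - s) / s * (2 * A + K * (2 + Gamma (1+g) + Gamma (2+g)) * lil_scale b s)"
    if s: "0 < s" "s < exp (- exp 1)" "s \<le> s'" for s s'
  proof -
    have "\<bar>dsum z s' - dsum z s\<bar> \<le> (s' - s) / s * (2 * (A + K * lil_scale b s) + (K * lil_scale b s * s powr g) * (Gamma (1 + g) + Gamma (2 + g)) * s powr (-g))"
      by (rule abel_lipschitz[OF s(1,3) g B[OF s(1,2)] key[OF s(1,2)]])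
    also have "2 * (A + K * lil_scale b s) + (K * lil_scale b s * s powr g) * (Gamma (1 + g) + Gamma (2 + g)) * s powr (-g)
       = 2 * A + K * (2 + Gamma (1+g) + Gamma (2+g)) * lil_scale b s"
      using s(1) by (simp add: powr_minus field_simps)
    finally show ?thesis .
  qed
  thus "\<exists>A\<ge>0. \<forall>s s'. 0 < s \<longrightarrow> s < exp (- exp 1) \<longrightarrow> s \<le> s' \<longrightarrow>
            \<bar>dsum z s' - dsum z s\<bar> \<le> (s' - s) / s * (A + K * (2 + Gamma (1+g) + Gamma (2+g)) * lil_scale b s)"
    using A by (intro exI[of _ "2*A"]) auto
qed

section \<open>Exponential inequalities\<close>

text \<open>Taylor's formula of order three: the remainder is at most exp 1 / 6 \<le> 1/2 times d
  y^2, hence a relative change d of the quadratic term.\<close>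

lemma exp_quadratic_bounds:
  fixes y d :: real
  assumes y: "\<bar>y\<bar> \<le> d" and d: "d \<le> 1"
  shows "exp y \<le> 1 + y + (1+d)/2 * y\<^sup>2" "1 + y + (1-d)/2 * y\<^sup>2 \<le> exp y"
proof -
  obtain t where t: "\<bar>t\<bar> \<le> \<bar>y\<bar>" "exp y = (\<Sum>m<3. y^m / fact m) + exp t / fact 3 * y^3"
    using Maclaurin_exp_le[of y 3] by blast
  have "exp t \<le> exp 1" using t(1) y d by simp
  also have "exp 1 \<le> (3::real)" by (rule exp_le)
  finally have et: "exp t \<le> 3" .
  have e: "exp y = 1 + y + y\<^sup>2/2 + exp t / 6 * y^3"
    using t(2) by (simp add: eval_nat_numeral)
  have "\<bar>exp t / 6 * y^3\<bar> = exp t / 6 * \<bar>y\<bar> * y\<^sup>2"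
    by (simp add: abs_mult power3_eq_cube power2_eq_square)
  also have "\<dots> \<le> 3/6 * d * y\<^sup>2" using et y by (intro mult_right_mono mult_mono) auto
  finally have "\<bar>exp t / 6 * y^3\<bar> \<le> d/2 * y\<^sup>2" by simp
  thus "exp y \<le> 1 + y + (1+d)/2 * y\<^sup>2" "1 + y + (1-d)/2 * y\<^sup>2 \<le> exp y"
    unfolding e by (auto simp: field_simps)
qed

section \<open>Moment generating functions, tails and a maximal inequality\<close>

context prob_space
begin

lemma integrable_bounded:
  fixes X :: "'a \<Rightarrow> real"
  assumes "X \<in> borel_measurable M" "\<And>\<omega>. \<omega> \<in> space M \<Longrightarrow> \<bar>X \<omega>\<bar> \<le> B"
  shows "integrable M X"
  using assms by (intro integrable_const_bound[of _ B]) auto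

text \<open>Centering removes the linear term of the expansion. For the lower bound 1 + z \<ge> exp
  (z - z^2) is used with z = (1 - d)/2 times the second moment; since z \<le> d/2, the loss z^2
  costs at most a further d, whence 1 - 2 d.\<close>

lemma mgf_bounds:
  fixes X :: "'a \<Rightarrow> real"
  assumes X[measurable]: "X \<in> borel_measurable M" and bd: "\<And>\<omega>. \<omega> \<in> space M \<Longrightarrow> \<bar>X \<omega>\<bar> \<le> d"
    and d: "0 \<le> d" "d \<le> 1" and mean: "expectation X = 0"
  shows "integrable M (\<lambda>\<omega>. exp (X \<omega>))"
    and "expectation (\<lambda>\<omega>. exp (X \<omega>)) \<le> exp ((1+d)/2 * expectation (\<lambda>\<omega>. (X \<omega>)\<^sup>2))"
    and "exp ((1-2*d)/2 * expectation (\<lambda>\<omega>. (X \<omega>)\<^sup>2)) \<le> expectation (\<lambda>\<omega>. exp (X \<omega>))"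
proof -
  let ?v = "expectation (\<lambda>\<omega>. (X \<omega>)\<^sup>2)"
  have i1: "integrable M X" using bd by (rule integrable_bounded[OF X])
  have sq: "(X \<omega>)\<^sup>2 \<le> d\<^sup>2" if "\<omega> \<in> space M" for \<omega> using bd[OF that] d by (simp add: abs_le_square_iff[symmetric])
  have i2: "integrable M (\<lambda>\<omega>. (X \<omega>)\<^sup>2)" using sq by (intro integrable_bounded[of _ "d\<^sup>2"]) auto
  have i3: "integrable M (\<lambda>\<omega>. exp (X \<omega>))"
  proof (rule integrable_bounded[of _ "exp d"])
    show "\<bar>exp (X \<omega>)\<bar> \<le> exp d" if "\<omega> \<in> space M" for \<omega> using bd[OF that] by auto
  qed auto
  show "integrable M (\<lambda>\<omega>. exp (X \<omega>))" by (rule i3)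
  have "expectation (\<lambda>\<omega>. exp (X \<omega>)) \<le> expectation (\<lambda>\<omega>. 1 + X \<omega> + (1+d)/2 * (X \<omega>)\<^sup>2)"
    using i1 i2 i3 exp_quadratic_bounds(1)[OF bd d(2)] by (intro integral_mono) auto
  also have "\<dots> = 1 + (1+d)/2 * ?v" using i1 i2 mean by (simp add: prob_space)
  also have "\<dots> \<le> exp ((1+d)/2 * ?v)" by (rule exp_ge_add_one_self)
  finally show "expectation (\<lambda>\<omega>. exp (X \<omega>)) \<le> exp ((1+d)/2 * ?v)" .
  have v: "0 \<le> ?v" "?v \<le> d\<^sup>2"
    using integral_mono[OF i2 _ sq] by (auto simp: prob_space)
  define z where "z = (1-d)/2 * ?v"
  have "?v \<le> d" using v d power2_le_imp_le[of d 1] by (simp add: power2_eq_square mult_left_le order_trans)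
  hence z: "0 \<le> z" "z \<le> d/2" "z \<le> 1" unfolding z_def using v d mult_mono[of "(1-d)/2" "1/2" ?v d] by auto
  have "(1-2*d)/2 * ?v \<le> z - z\<^sup>2"
  proof -
    have "z * z \<le> z * (d/2)" using z by (intro mult_left_mono) auto
    moreover have "z * (1 - d/2) - (1-2*d)/2 * ?v = ?v * (d/4 + d*d/4)" unfolding z_def by (simp add: field_simps)
    moreover have "?v * (d/4 + d*d/4) \<ge> 0" using v d by auto
    ultimately show ?thesis by (simp add: power2_eq_square algebra_simps)
  qed
  also have "\<dots> \<le> ln (1 + z)" using z by (intro ln_one_plus_pos_lower_bound) auto
  finally have "exp ((1-2*d)/2 * ?v) \<le> exp (ln (1+z))" by simp
  also have "\<dots> = 1 + z" using z by simp
  also have "\<dots> = expectation (\<lambda>\<omega>. 1 + X \<omega> + (1-d)/2 * (X \<omega>)\<^sup>2)" using i1 i2 mean by (simp add: prob_space z_def)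
  also have "\<dots> \<le> expectation (\<lambda>\<omega>. exp (X \<omega>))"
    using i1 i2 i3 exp_quadratic_bounds(2)[OF bd d(2)] by (intro integral_mono) auto
  finally show "exp ((1-2*d)/2 * ?v) \<le> expectation (\<lambda>\<omega>. exp (X \<omega>))" .
qed

lemma mgf_sum_bounds:
  fixes X :: "'i \<Rightarrow> 'a \<Rightarrow> real"
  assumes F: "finite F" and ind: "indep_vars (\<lambda>_. borel) X F"
    and bd: "\<And>k \<omega>. k \<in> F \<Longrightarrow> \<omega> \<in> space M \<Longrightarrow> \<bar>X k \<omega>\<bar> \<le> d"
    and d: "0 \<le> d" "d \<le> 1" and mean: "\<And>k. k \<in> F \<Longrightarrow> expectation (X k) = 0"
  shows "integrable M (\<lambda>\<omega>. exp (\<Sum>k\<in>F. X k \<omega>))"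
    and "expectation (\<lambda>\<omega>. exp (\<Sum>k\<in>F. X k \<omega>)) \<le> exp ((1+d)/2 * (\<Sum>k\<in>F. expectation (\<lambda>\<omega>. (X k \<omega>)\<^sup>2)))"
    and "exp ((1-2*d)/2 * (\<Sum>k\<in>F. expectation (\<lambda>\<omega>. (X k \<omega>)\<^sup>2))) \<le> expectation (\<lambda>\<omega>. exp (\<Sum>k\<in>F. X k \<omega>))"
proof -
  have rv: "X k \<in> borel_measurable M" if "k \<in> F" for k using ind that by (auto simp: indep_vars_def)
  note m = mgf_bounds[OF rv bd d mean]
  have ind': "indep_vars (\<lambda>_. borel) (\<lambda>k \<omega>. exp (X k \<omega>)) F"
    using indep_vars_compose2[OF ind, of "\<lambda>_. exp" "\<lambda>_. borel"] by simp
  have e: "exp (\<Sum>k\<in>F. X k \<omega>) = (\<Prod>k\<in>F. exp (X k \<omega>))" for \<omega> using F by (simp add: exp_sum)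
  have E: "expectation (\<lambda>\<omega>. exp (\<Sum>k\<in>F. X k \<omega>)) = (\<Prod>k\<in>F. expectation (\<lambda>\<omega>. exp (X k \<omega>)))"
    unfolding e by (rule indep_vars_lebesgue_integral[OF F ind']) (rule m(1))
  show "integrable M (\<lambda>\<omega>. exp (\<Sum>k\<in>F. X k \<omega>))"
    unfolding e by (rule indep_vars_integrable[OF F ind']) (rule m(1))
  show "expectation (\<lambda>\<omega>. exp (\<Sum>k\<in>F. X k \<omega>)) \<le> exp ((1+d)/2 * (\<Sum>k\<in>F. expectation (\<lambda>\<omega>. (X k \<omega>)\<^sup>2)))"
    unfolding E sum_distrib_left by (simp add: exp_sum F del: times_divide_eq_left) (intro prod_mono conjI m(2) integral_nonneg_AE, auto)
  show "exp ((1-2*d)/2 * (\<Sum>k\<in>F. expectation (\<lambda>\<omega>. (X k \<omega>)\<^sup>2))) \<le> expectation (\<lambda>\<omega>. exp (\<Sum>k\<in>F. X k \<omega>))"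
    unfolding E sum_distrib_left by (simp add: exp_sum F del: times_divide_eq_left) (intro prod_mono conjI m(3), auto)
qed

lemma chernoff:
  fixes W :: "'a \<Rightarrow> real"
  assumes [measurable]: "W \<in> borel_measurable M" and l: "l \<ge> 0" and i: "integrable M (\<lambda>\<omega>. exp (l * W \<omega>))"
  shows "prob {\<omega>\<in>space M. W \<omega> \<ge> x} \<le> exp (- l * x) * expectation (\<lambda>\<omega>. exp (l * W \<omega>))"
proof -
  have "prob {\<omega>\<in>space M. W \<omega> \<ge> x} \<le> prob {\<omega>\<in>space M. exp (l * W \<omega>) \<ge> exp (l * x)}"
    using l by (intro finite_measure_mono) (auto intro!: mult_left_mono)
  also have "\<dots> \<le> expectation (\<lambda>\<omega>. exp (l * W \<omega>)) / exp (l * x)"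
    by (rule integral_Markov_inequality_measure[OF i, where A = "space M", simplified]) auto
  also have "\<dots> = exp (- l * x) * expectation (\<lambda>\<omega>. exp (l * W \<omega>))" by (simp add: exp_minus field_simps)
  finally show ?thesis .
qed

text \<open>Cramer's tilting argument: under the exponential change of measure the variable concentrates
  around \<^term>\<open>l * v\<close>, and both tails of the tilted law are controlled by the moment generating
  function at \<^term>\<open>l * (1 + e)\<close> and \<^term>\<open>l * (1 - e)\<close>.\<close>
lemma lower_tail:
  fixes U :: "'a \<Rightarrow> real"
  assumes [measurable]: "U \<in> borel_measurable M" and l: "l > 0" and v: "v \<ge> 0" and e: "0 < e" "e < 1"
    and d: "0 \<le> d" "d \<le> e\<^sup>2 / 16"
    and int: "\<And>m. 0 \<le> m \<Longrightarrow> m \<le> 2 * l \<Longrightarrow> integrable M (\<lambda>\<omega>. exp (m * U \<omega>))"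
    and up: "\<And>m. 0 \<le> m \<Longrightarrow> m \<le> 2 * l \<Longrightarrow> expectation (\<lambda>\<omega>. exp (m * U \<omega>)) \<le> exp ((1+d)/2 * (m\<^sup>2 * v))"
    and low: "exp ((1-2*d)/2 * (l\<^sup>2 * v)) \<le> expectation (\<lambda>\<omega>. exp (l * U \<omega>))"
    and large: "exp (- (5 * e\<^sup>2 / 16) * (l\<^sup>2 * v)) \<le> 1/4"
  shows "prob {\<omega>\<in>space M. U \<omega> \<ge> l * v * (1 - e)} \<ge> exp (- (1/2 + 2 * e) * (l\<^sup>2 * v)) / 2"
proof -
  define q where "q = l\<^sup>2 * v"
  have q: "q \<ge> 0" using v by (simp add: q_def)
  let ?P = "prob {\<omega>\<in>space M. U \<omega> \<ge> l * v * (1 - e)}"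
  let ?R = "exp (- e * (1+e) * q)" and ?L = "exp (e * (1-e) * q)" and ?C = "exp (l * (l * v * (1 + e)))"
  \<comment> \<open>Three regions of u: above l v (1 + e) the tilt l (1 + e) dominates, below l v (1
    - e) the tilt l (1 - e) does, and in the middle the exponential is at most its value at the
    right end.\<close>
  have pw: "exp (l * u) \<le> ?R * exp (l*(1+e) * u) + ?L * exp (l*(1-e) * u) + ?C * indicator {u. u \<ge> l * v * (1 - e)} u" for u :: real
  proof -
    consider "u \<ge> l * v * (1+e)" | "u < l * v * (1 - e)" | "l * v * (1-e) \<le> u" "u \<le> l * v * (1+e)" by linarith
    then show ?thesis
    proof cases
      case 1
      have "e * l * (l * v * (1+e)) \<le> e * l * u" using 1 e l by (intro mult_left_mono) auto
      hence "l * u \<le> - e * (1+e) * q + l*(1+e) * u" unfolding q_def by (simp add: power2_eq_square algebra_simps)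
      hence "exp (l * u) \<le> ?R * exp (l*(1+e) * u)" by (simp add: exp_add[symmetric])
      thus ?thesis by (rule order_trans[of _ "?R * exp (l*(1+e) * u)"]) (auto intro!: add_nonneg_nonneg)
    next
      case 2
      have "e * l * u \<le> e * l * (l * v * (1-e))" using 2 e l by (intro mult_left_mono) auto
      hence "l * u \<le> e * (1-e) * q + l*(1-e) * u" unfolding q_def by (simp add: power2_eq_square algebra_simps)
      hence "exp (l * u) \<le> ?L * exp (l*(1-e) * u)" by (simp add: exp_add[symmetric])
      thus ?thesis by (rule order_trans[of _ "?L * exp (l*(1-e) * u)"]) (auto intro!: add_nonneg_nonneg)
    next
      case 3
      have "l * u \<le> l * (l * v * (1 + e))" using 3 l by (intro mult_left_mono) auto
      hence "exp (l * u) \<le> ?C" by simp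
      thus ?thesis by (rule order_trans[of _ "?C"]) (use 3 in \<open>auto intro!: add_nonneg_nonneg\<close>)
    qed
  qed
  have i1: "integrable M (\<lambda>\<omega>. exp (l*(1+e) * U \<omega>))" and i2: "integrable M (\<lambda>\<omega>. exp (l*(1-e) * U \<omega>))"
    and i3: "integrable M (\<lambda>\<omega>. exp (l * U \<omega>))" using e l by (auto intro!: int mult_left_mono)
  have i4: "integrable M (\<lambda>\<omega>. indicator {u. u \<ge> l * v * (1 - e)} (U \<omega>) :: real)"
    by (intro integrable_bounded[of _ 1]) (auto simp: indicator_def)
  have I4: "expectation (\<lambda>\<omega>. indicator {u. u \<ge> l * v * (1 - e)} (U \<omega>)) = ?P"
  proof -
    have "expectation (\<lambda>\<omega>. indicator {u. u \<ge> l * v * (1 - e)} (U \<omega>)) = expectation (indicator {\<omega>\<in>space M. U \<omega> \<ge> l * v * (1 - e)})"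
      by (intro Bochner_Integration.integral_cong) (auto simp: indicator_def)
    also have "\<dots> = ?P" by simp
    finally show ?thesis .
  qed
  have "exp ((1/2 - d) * q) \<le> expectation (\<lambda>\<omega>. exp (l * U \<omega>))"
    using low by (simp add: q_def field_simps)
  also have "\<dots> \<le> expectation (\<lambda>\<omega>. ?R * exp (l*(1+e) * U \<omega>) + ?L * exp (l*(1-e) * U \<omega>) + ?C * indicator {u. u \<ge> l * v * (1 - e)} (U \<omega>))"
    using i1 i2 i3 i4 pw by (intro integral_mono) auto
  also have "\<dots> = ?R * expectation (\<lambda>\<omega>. exp (l*(1+e) * U \<omega>)) + ?L * expectation (\<lambda>\<omega>. exp (l*(1-e) * U \<omega>)) + ?C * ?P"
    using i1 i2 i4 I4 by simp
  also have "\<dots> \<le> ?R * exp ((1+d)/2 * ((l*(1+e))\<^sup>2 * v)) + ?L * exp ((1+d)/2 * ((l*(1-e))\<^sup>2 * v)) + ?C * ?P"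
    using e l by (intro add_mono mult_left_mono up) (auto intro!: mult_left_mono)
  \<comment> \<open>Without d the exponent is (1 - e^2)/2 in both tails. The budget d \<le> e^2/16
    and (1 + e)^2 \<le> 4 give back at most e^2/8, leaving 1/2 - 3 e^2/8.\<close>
  also have "?R * exp ((1+d)/2 * ((l*(1+e))\<^sup>2 * v)) \<le> exp ((1/2 - 3*e\<^sup>2/8) * q)"
  proof -
    have "d * (1+e)\<^sup>2 \<le> e\<^sup>2/16 * 2\<^sup>2" using d e by (intro mult_mono power_mono) auto
    hence "- e * (1+e) + (1+d)/2 * (1+e)\<^sup>2 \<le> 1/2 - 3*e\<^sup>2/8" by (simp add: power2_eq_square field_simps)
    hence *: "(- e * (1+e) + (1+d)/2 * (1+e)\<^sup>2) * q \<le> (1/2 - 3*e\<^sup>2/8) * q" using q by (rule mult_right_mono)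
    have "(1+d)/2 * ((l*(1+e))\<^sup>2 * v) = (1+d)/2 * (1+e)\<^sup>2 * q" by (simp add: q_def power_mult_distrib)
    with * have "- e * (1+e) * q + (1+d)/2 * ((l*(1+e))\<^sup>2 * v) \<le> (1/2 - 3*e\<^sup>2/8) * q" by (simp only: distrib_right)
    thus ?thesis by (simp only: exp_add[symmetric] exp_le_cancel_iff)
  qed
  also have "?L * exp ((1+d)/2 * ((l*(1-e))\<^sup>2 * v)) \<le> exp ((1/2 - 3*e\<^sup>2/8) * q)"
  proof -
    have "d * (1-e)\<^sup>2 \<le> e\<^sup>2/16 * 2\<^sup>2" using d e by (intro mult_mono power_mono) auto
    hence "e * (1-e) + (1+d)/2 * (1-e)\<^sup>2 \<le> 1/2 - 3*e\<^sup>2/8" by (simp add: power2_eq_square field_simps)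
    hence *: "(e * (1-e) + (1+d)/2 * (1-e)\<^sup>2) * q \<le> (1/2 - 3*e\<^sup>2/8) * q" using q by (rule mult_right_mono)
    have "(1+d)/2 * ((l*(1-e))\<^sup>2 * v) = (1+d)/2 * (1-e)\<^sup>2 * q" by (simp add: q_def power_mult_distrib)
    with * have "e * (1-e) * q + (1+d)/2 * ((l*(1-e))\<^sup>2 * v) \<le> (1/2 - 3*e\<^sup>2/8) * q" by (simp only: distrib_right)
    thus ?thesis by (simp only: exp_add[symmetric] exp_le_cancel_iff)
  qed
  finally have 1: "exp ((1/2 - d) * q) \<le> 2 * exp ((1/2 - 3*e\<^sup>2/8) * q) + ?C * ?P" by simp
  have "(1/2 - e\<^sup>2/16) * q \<le> (1/2 - d) * q" using d q by (intro mult_right_mono) auto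
  hence 2: "exp ((1/2 - e\<^sup>2/16) * q) \<le> exp ((1/2 - d) * q)" by simp
  \<comment> \<open>The gap between the exponents is 5 e^2/16, the constant in \<open>large\<close>.
    So each tail takes at most a quarter of the tilted mass and half of it remains for the middle
    region.\<close>
  have "exp ((1/2 - 3*e\<^sup>2/8) * q) = exp ((1/2 - e\<^sup>2/16) * q) * exp (- (5 * e\<^sup>2 / 16) * q)"
    by (simp add: exp_add[symmetric] field_simps)
  also have "\<dots> \<le> exp ((1/2 - e\<^sup>2/16) * q) * (1/4)" using large by (intro mult_left_mono) (auto simp: q_def)
  finally have 3: "exp ((1/2 - e\<^sup>2/16) * q) / 2 \<le> ?C * ?P" using 1 2 by linarith
  have C: "?C = exp ((1+e) * q)" by (simp add: q_def power2_eq_square algebra_simps)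
  have "exp (- (1/2 + 2 * e) * q) \<le> exp ((1/2 - e\<^sup>2/16) * q - (1+e) * q)"
  proof -
    have "e * e \<le> e * 1" using e by (intro mult_left_mono) auto
    hence "- (1/2 + 2 * e) \<le> (1/2 - e\<^sup>2/16) - (1+e)" using e unfolding power2_eq_square by linarith
    from mult_right_mono[OF this q] show ?thesis by (simp add: algebra_simps)
  qed
  also have "\<dots> = exp ((1/2 - e\<^sup>2/16) * q) / ?C" by (simp add: C exp_diff)
  also have "\<dots> \<le> 2 * ?P" using 3 by (simp add: field_simps)
  finally show ?thesis by (simp add: q_def)
qed

text \<open>Independence and 1 - p \<le> exp (-p) bound the probability of no success after n by exp
  of minus the sum of the p's. If that probability were positive, its logarithm would bound the
  partial sums.\<close>

lemma borel_cantelli_2: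
  fixes U :: "nat \<Rightarrow> 'a \<Rightarrow> real"
  assumes ind: "indep_vars (\<lambda>_. borel) U UNIV" and ns: "\<not> summable (\<lambda>j. prob {\<omega>\<in>space M. U j \<omega> \<ge> x j})"
  shows "AE \<omega> in M. \<exists>\<^sub>F j in sequentially. U j \<omega> \<ge> x j"
proof -
  have rv[measurable]: "U j \<in> borel_measurable M" for j using ind by (auto simp: indep_vars_def)
  define p where "p j = prob {\<omega>\<in>space M. U j \<omega> \<ge> x j}" for j
  have p: "0 \<le> p j" for j by (simp add: p_def)
  have "AE \<omega> in M. \<exists>j\<ge>n. U j \<omega> \<ge> x j" for n
  proof -
    let ?N = "{\<omega>\<in>space M. \<forall>j\<ge>n. U j \<omega> < x j}"
    have le: "prob ?N \<le> exp (- (\<Sum>j=n..<n+m. p j))" if m: "m > 0" for m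
    proof -
      have "prob ?N \<le> prob (\<Inter>j\<in>{n..<n+m}. U j -` {..<x j} \<inter> space M)"
        using m by (intro finite_measure_mono) auto
      also have "\<dots> = (\<Prod>j\<in>{n..<n+m}. prob (U j -` {..<x j} \<inter> space M))"
        using m by (intro indep_varsD[OF ind]) auto
      also have "\<dots> \<le> (\<Prod>j\<in>{n..<n+m}. exp (- p j))"
      proof (intro prod_mono conjI)
        fix j
        have "U j -` {..<x j} \<inter> space M = space M - {\<omega>\<in>space M. U j \<omega> \<ge> x j}" by auto
        hence "prob (U j -` {..<x j} \<inter> space M) = 1 - p j" by (simp add: prob_compl p_def)
        also have "\<dots> \<le> exp (- p j)" using exp_ge_add_one_self[of "- p j"] by simp
        finally show "prob (U j -` {..<x j} \<inter> space M) \<le> exp (- p j)" .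
      qed auto
      also have "\<dots> = exp (- (\<Sum>j=n..<n+m. p j))" by (simp add: exp_sum[symmetric] sum_negf)
      finally show ?thesis .
    qed
    have "prob ?N \<le> 0"
    proof (rule ccontr)
      assume "\<not> prob ?N \<le> 0"
      hence pos: "prob ?N > 0" by simp
      have "(\<Sum>j<m. p (j+n)) \<le> max 0 (- ln (prob ?N))" for m
      proof (cases "m = 0")
        case False
        have "ln (prob ?N) \<le> - (\<Sum>j=n..<n+m. p j)"
          using le[of m] False pos ln_mono[of "prob ?N" "exp (- (\<Sum>j=n..<n+m. p j))"] by simp
        moreover have "(\<Sum>j=n..<n+m. p j) = (\<Sum>j<m. p (j+n))"
          using sum.shift_bounds_nat_ivl[of p 0 n m] by (simp add: lessThan_atLeast0 add.commute)
        ultimately show ?thesis by linarith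
      qed simp
      hence "summable (\<lambda>j. p (j+n))" using p by (intro summableI_nonneg_bounded)
      hence "summable p" by (simp only: summable_iff_shift)
      thus False using ns by (simp add: p_def[abs_def])
    qed
    hence "prob ?N = 0" by (simp add: measure_le_0_iff)
    hence "AE \<omega> in M. \<not> (\<forall>j\<ge>n. U j \<omega> < x j)"
      by (subst (asm) prob_eq_0) auto
    thus ?thesis by eventually_elim (auto simp: not_less)
  qed
  hence "AE \<omega> in M. \<forall>n. \<exists>j\<ge>n. U j \<omega> \<ge> x j" by (simp add: AE_all_countable)
  thus ?thesis by (simp add: frequently_sequentially)
qed

text \<open>The exponential submartingale \<open>exp (l S\<^sub>n)\<close> restricted to the event that the level has been
  reached only grows in expectation, since each factor \<open>exp (l Y\<^sub>n)\<close> is independent of the past and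
  has expectation at least one.\<close>
lemma maximal_exp_inequality:
  fixes Y :: "nat \<Rightarrow> 'a \<Rightarrow> real"
  assumes ind: "indep_vars (\<lambda>_. borel) Y {1..}" and l: "l \<ge> 0"
    and bd: "\<And>k. k \<ge> 1 \<Longrightarrow> \<exists>B. \<forall>\<omega>\<in>space M. \<bar>Y k \<omega>\<bar> \<le> B" and mean: "\<And>k. k \<ge> 1 \<Longrightarrow> expectation (Y k) = 0"
  shows "prob {\<omega>\<in>space M. \<exists>m\<in>{1..n}. (\<Sum>k=1..m. Y k \<omega>) \<ge> x}
           \<le> exp (- l * x) * expectation (\<lambda>\<omega>. exp (l * (\<Sum>k=1..n. Y k \<omega>)))"
proof -
  have rv[measurable]: "Y k \<in> borel_measurable M" if "k \<ge> 1" for k using ind that by (auto simp: indep_vars_def)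
  define S where "S n \<omega> = (\<Sum>k=1..n. Y k \<omega>)" for n \<omega>
  have Sm[measurable]: "S n \<in> borel_measurable M" for n unfolding S_def by (intro borel_measurable_sum rv) auto
  define Dn where "Dn n \<omega> \<longleftrightarrow> (\<exists>m\<in>{1..n}. S m \<omega> \<ge> x)" for n \<omega>
  have Dm[measurable]: "Measurable.pred M (Dn n)" for n unfolding Dn_def by measurable
  obtain B where B: "\<And>k \<omega>. k \<ge> 1 \<Longrightarrow> \<omega> \<in> space M \<Longrightarrow> \<bar>Y k \<omega>\<bar> \<le> B k" using bd by metis
  have Sb: "\<bar>S n \<omega>\<bar> \<le> (\<Sum>k=1..n. B k)" if "\<omega> \<in> space M" for n \<omega>
    unfolding S_def using B that by (intro order_trans[OF sum_abs] sum_mono) auto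
  have iS: "integrable M (\<lambda>\<omega>. exp (l * S n \<omega>))" for n
  proof (rule integrable_bounded[of _ "exp (l * (\<Sum>k=1..n. B k))"])
    show "\<bar>exp (l * S n \<omega>)\<bar> \<le> exp (l * (\<Sum>k=1..n. B k))" if "\<omega> \<in> space M" for \<omega>
      using Sb[OF that, of n] l by (auto intro!: mult_left_mono)
  qed auto
  have iD: "integrable M (\<lambda>\<omega>. exp (l * S n \<omega>) * of_bool (Dn m \<omega>))" for n m
    by (rule Bochner_Integration.integrable_bound[OF iS[of n]]) auto
  have iP: "integrable M (\<lambda>\<omega>. of_bool (Dn n \<omega>) :: real)" for n
    by (rule integrable_bounded[of _ 1]) auto
  have step: "exp (l * x) * expectation (\<lambda>\<omega>. of_bool (Dn n \<omega>)) \<le> expectation (\<lambda>\<omega>. exp (l * S n \<omega>) * of_bool (Dn n \<omega>))" for n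
  proof (induction n)
    case 0
    then show ?case by (simp add: Dn_def)
  next
    case (Suc n)
    have iY: "integrable M (\<lambda>\<omega>. exp (l * Y (Suc n) \<omega>))"
    proof (rule integrable_bounded[of _ "exp (l * B (Suc n))"])
      show "\<bar>exp (l * Y (Suc n) \<omega>)\<bar> \<le> exp (l * B (Suc n))" if "\<omega> \<in> space M" for \<omega>
        using B[of "Suc n" \<omega>] that l by (auto intro!: mult_left_mono)
    qed auto
    have iY': "integrable M (Y (Suc n))" using B by (intro integrable_bounded[of _ "B (Suc n)"]) auto
    have "expectation (\<lambda>\<omega>. 1 + l * Y (Suc n) \<omega>) \<le> expectation (\<lambda>\<omega>. exp (l * Y (Suc n) \<omega>))"
      using iY iY' by (intro integral_mono) (auto intro: exp_ge_add_one_self)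
    hence EY: "1 \<le> expectation (\<lambda>\<omega>. exp (l * Y (Suc n) \<omega>))"
      using iY' mean[of "Suc n"] by (simp add: prob_space)
    \<comment> \<open>The restricted exponential written as a function of the first n coordinates,
      which is the form needed for independence from the next variable.\<close>
    define G :: "(nat \<Rightarrow> real) \<Rightarrow> real" where "G = (\<lambda>f. exp (l * (\<Sum>k=1..n. f k)) * of_bool (\<exists>m\<in>{1..n}. (\<Sum>k=1..m. f k) \<ge> x))"
    have Gm: "G \<in> borel_measurable (PiM {1..n} (\<lambda>_. borel))"
    proof -
      have s: "(\<lambda>f. \<Sum>k=1..m. f k) \<in> borel_measurable (PiM {1..n} (\<lambda>_. borel :: real measure))" if "m \<le> n" for m
        using that by (intro borel_measurable_sum measurable_component_singleton) auto
      have "Measurable.pred (PiM {1..n} (\<lambda>_. borel :: real measure)) (\<lambda>f. \<exists>m\<in>{1..n}. (\<Sum>k=1..m. f k) \<ge> x)"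
        using s by (intro pred_intros_finite borel_measurable_pred_less) (auto intro!: borel_measurable_le)
      thus ?thesis unfolding G_def using s[of n] by measurable
    qed
    have "indep_var borel ((\<lambda>f. exp (l * f (Suc n))) \<circ> (\<lambda>\<omega>. restrict (\<lambda>i. Y i \<omega>) {Suc n}))
                    borel (G \<circ> (\<lambda>\<omega>. restrict (\<lambda>i. Y i \<omega>) {1..n}))"
      by (intro indep_var_compose[OF indep_var_restrict[OF ind]] Gm) auto
    also have "(\<lambda>f. exp (l * f (Suc n))) \<circ> (\<lambda>\<omega>. restrict (\<lambda>i. Y i \<omega>) {Suc n}) = (\<lambda>\<omega>. exp (l * Y (Suc n) \<omega>))" by auto
    also have "G \<circ> (\<lambda>\<omega>. restrict (\<lambda>i. Y i \<omega>) {1..n}) = (\<lambda>\<omega>. exp (l * S n \<omega>) * of_bool (Dn n \<omega>))"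
      by (auto simp: G_def Dn_def S_def fun_eq_iff intro!: arg_cong2[where f="(*)"] arg_cong[where f=exp] arg_cong[where f=of_bool] bex_cong)
    finally have iv: "indep_var borel (\<lambda>\<omega>. exp (l * Y (Suc n) \<omega>)) borel (\<lambda>\<omega>. exp (l * S n \<omega>) * of_bool (Dn n \<omega>))" .
    have "expectation (\<lambda>\<omega>. exp (l * S n \<omega>) * of_bool (Dn n \<omega>)) * 1
        \<le> expectation (\<lambda>\<omega>. exp (l * S n \<omega>) * of_bool (Dn n \<omega>)) * expectation (\<lambda>\<omega>. exp (l * Y (Suc n) \<omega>))"
      by (intro mult_left_mono EY integral_nonneg_AE) auto
    also have "\<dots> = expectation (\<lambda>\<omega>. exp (l * Y (Suc n) \<omega>) * (exp (l * S n \<omega>) * of_bool (Dn n \<omega>)))"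
      using indep_var_lebesgue_integral[OF iv iY iD] by simp
    also have "\<dots> = expectation (\<lambda>\<omega>. exp (l * S (Suc n) \<omega>) * of_bool (Dn n \<omega>))"
      by (intro Bochner_Integration.integral_cong) (auto simp: S_def exp_add algebra_simps)
    finally have 1: "exp (l * x) * expectation (\<lambda>\<omega>. of_bool (Dn n \<omega>)) \<le> expectation (\<lambda>\<omega>. exp (l * S (Suc n) \<omega>) * of_bool (Dn n \<omega>))"
      using Suc by simp
    \<comment> \<open>The level is reached for the first time at Suc n. This event is disjoint from
      \<open>Dn n\<close>, and on it the exponential is at least exp (l x).\<close>
    define Nw where "Nw \<omega> \<longleftrightarrow> \<not> Dn n \<omega> \<and> S (Suc n) \<omega> \<ge> x" for \<omega>
    have Nm[measurable]: "Measurable.pred M Nw" unfolding Nw_def by measurable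
    have split: "of_bool (Dn (Suc n) \<omega>) = (of_bool (Dn n \<omega>) + of_bool (Nw \<omega>) :: real)" for \<omega>
      by (auto simp: Dn_def Nw_def atLeastAtMostSuc_conv)
    have iN: "integrable M (\<lambda>\<omega>. of_bool (Nw \<omega>) :: real)" by (rule integrable_bounded[of _ 1]) auto
    have iN': "integrable M (\<lambda>\<omega>. exp (l * S (Suc n) \<omega>) * of_bool (Nw \<omega>))"
      by (rule Bochner_Integration.integrable_bound[OF iS[of "Suc n"]]) auto
    have "expectation (\<lambda>\<omega>. exp (l * x) * of_bool (Nw \<omega>)) \<le> expectation (\<lambda>\<omega>. exp (l * S (Suc n) \<omega>) * of_bool (Nw \<omega>))"
      using iN iN' l by (intro integral_mono) (auto simp: Nw_def intro!: mult_left_mono)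
    hence "exp (l * x) * expectation (\<lambda>\<omega>. of_bool (Nw \<omega>)) \<le> expectation (\<lambda>\<omega>. exp (l * S (Suc n) \<omega>) * of_bool (Nw \<omega>))"
      using iN by simp
    thus ?case using 1 iN iN' iP iD unfolding split by (simp add: distrib_left)
  qed
  have "expectation (\<lambda>\<omega>. of_bool (Dn n \<omega>)) = expectation (indicator {\<omega>\<in>space M. Dn n \<omega>})"
    by (intro Bochner_Integration.integral_cong) (auto simp: indicator_def)
  also have "\<dots> = prob {\<omega>\<in>space M. Dn n \<omega>}" by simp
  finally have "expectation (\<lambda>\<omega>. of_bool (Dn n \<omega>)) = prob {\<omega>\<in>space M. Dn n \<omega>}" .
  moreover have "expectation (\<lambda>\<omega>. exp (l * S n \<omega>) * of_bool (Dn n \<omega>)) \<le> expectation (\<lambda>\<omega>. exp (l * S n \<omega>))"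
    using iD iS by (intro integral_mono) auto
  ultimately have "exp (l * x) * prob {\<omega>\<in>space M. Dn n \<omega>} \<le> expectation (\<lambda>\<omega>. exp (l * S n \<omega>))"
    using step[of n] by simp
  hence "prob {\<omega>\<in>space M. Dn n \<omega>} \<le> exp (- l * x) * expectation (\<lambda>\<omega>. exp (l * S n \<omega>))"
    by (simp add: exp_minus field_simps)
  thus ?thesis by (simp add: Dn_def S_def)
qed

end

section \<open>The iterated logarithm for bounded terms\<close>

lemma lil_scale_antimono:
  assumes "0 < s" "s \<le> s'" "s' < exp (- exp 1)" "b > 0"
  shows "lil_scale b s' \<le> lil_scale b s"
proof -
  have s: "s < exp (- exp 1)" "0 < s'" using assms by auto
  note a = iterated_ln_small[OF assms(1) s(1)] and a' = iterated_ln_small[OF s(2) assms(3)]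
  have "ln (1/s') \<le> ln (1/s)" using assms by (subst ln_le_cancel_iff) (auto simp: field_simps)
  moreover have "ln (1/s') > 0" using a'(1) by (rule less_trans[OF exp_gt_zero])
  ultimately have "llog s' \<le> llog s" unfolding llog_def by (subst ln_le_cancel_iff) auto
  moreover have "s' powr (-b/2) \<le> s powr (-b/2)" using assms by (intro powr_mono2') auto
  ultimately show ?thesis unfolding lil_scale_def using a'(2) by (intro mult_mono) auto
qed

lemma lil_scale_half:
  assumes "0 < s" "s < exp (- exp 1)" "b > 0"
  shows "lil_scale b (s/2) \<le> 2 powr (b/2) * 2 * lil_scale b s"
proof -
  note a = iterated_ln_small[OF assms(1,2)]
  have l: "ln (1/s) \<ge> 1" using a(1) one_le_exp_iff[of 1] by linarith
  have e: "ln (1/(s/2)) = ln 2 + ln (1/s)" using assms by (simp add: ln_div)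
  have l2: "0 < ln (2::real)" by simp
  have "ln (1/(s/2)) \<le> 2 * ln (1/s)" using l ln_2_less_1 unfolding e by linarith
  moreover have "0 < ln (1/(s/2))" using l l2 unfolding e by linarith
  ultimately have "llog (s/2) \<le> ln (2 * ln (1/s))"
    unfolding llog_def using l by (subst ln_le_cancel_iff) auto
  also have "\<dots> = ln 2 + llog s" using l by (subst ln_mult) (auto simp: llog_def)
  also have "\<dots> \<le> 4 * llog s" using a(2) ln_2_less_1 by linarith
  finally have "sqrt (llog (s/2)) \<le> sqrt (4 * llog s)" by simp
  hence 1: "sqrt (llog (s/2)) \<le> 2 * sqrt (llog s)" by (simp add: real_sqrt_mult)
  have 2: "(s/2) powr (-b/2) = 2 powr (b/2) * s powr (-b/2)"
    using assms by (simp add: powr_divide powr_minus_divide)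
  have "lil_scale b (s/2) \<le> (2 powr (b/2) * s powr (-b/2)) * (2 * sqrt (llog s))"
    unfolding lil_scale_def 2 using 1 by (intro mult_left_mono) auto
  thus ?thesis by (simp add: lil_scale_def)
qed

text \<open>
  The bound on the terms is required at all scales \<open>s\<close> simultaneously: for \<open>s = 1 / ln N\<close> the
  weights \<open>k\<^bsup>-s\<^esup>\<close>, \<open>k \<le> N\<close>, are bounded below, so that the same assumptions also control the
  partial sums.
\<close>
locale dirichlet_core = prob_space M for M :: "'a measure" +
  fixes Y :: "nat \<Rightarrow> 'a \<Rightarrow> real" and b D C0 s0 :: real
  assumes b: "b > 0" and D: "D > 0" and C0: "C0 > 0" and s0: "s0 > 0"
    and ind: "indep_vars (\<lambda>_. borel) Y {1..}"
    and mean: "\<And>k. k \<ge> 1 \<Longrightarrow> expectation (Y k) = 0"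
    and bdd: "\<And>k s \<omega>. k \<ge> 1 \<Longrightarrow> 0 < s \<Longrightarrow> s < s0 \<Longrightarrow> \<omega> \<in> space M \<Longrightarrow>
        \<bar>Y k \<omega>\<bar> * real k powr (-s) \<le> C0 * s powr (-b/2) / ln (1/s)"
    and var: "(\<lambda>s. dsum (\<lambda>k. expectation (\<lambda>\<omega>. (Y k \<omega>)\<^sup>2)) (2 * s)) \<sim>[at_right 0] (\<lambda>s. D * s powr (-b))"
    and var_summable: "\<And>s. s > 0 \<Longrightarrow> summable (\<lambda>k. expectation (\<lambda>\<omega>. (Y (Suc k) \<omega>)\<^sup>2) * real (Suc k) powr (-s))"
begin

definition moment2 :: "nat \<Rightarrow> real" where "moment2 k = expectation (\<lambda>\<omega>. (Y k \<omega>)\<^sup>2)"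

lemma moment2_nonneg: "moment2 k \<ge> 0" unfolding moment2_def by simp

lemma rv[measurable]: "k \<ge> 1 \<Longrightarrow> Y k \<in> borel_measurable M"
  using ind by (auto simp: indep_vars_def)

lemma Y_bounded: "k \<ge> 1 \<Longrightarrow> \<exists>B. \<forall>\<omega>\<in>space M. \<bar>Y k \<omega>\<bar> \<le> B"
proof -
  assume k: "k \<ge> 1"
  have "\<bar>Y k \<omega>\<bar> \<le> C0 * (s0/2) powr (-b/2) / ln (1/(s0/2)) * real k powr (s0/2)" if "\<omega> \<in> space M" for \<omega>
    using bdd[OF k, of "s0/2" \<omega>] s0 that k by (simp add: powr_minus field_simps)
  thus ?thesis by blast
qed

text \<open>Squaring turns weights k^(-s) into k^(-2s), hence variances at scale s are Dirichlet
  series at 2 s.\<close>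

lemma moment2_sum_le:
  assumes F: "finite F" "F \<subseteq> {1..}" and s: "s > 0" and w: "\<And>k. k \<in> F \<Longrightarrow> \<bar>w k\<bar> \<le> c * real k powr (-s)"
  shows "(\<Sum>k\<in>F. (w k)\<^sup>2 * moment2 k) \<le> c\<^sup>2 * dsum moment2 (2 * s)"
proof -
  have "(\<Sum>k\<in>F. (w k)\<^sup>2 * moment2 k) \<le> (\<Sum>k\<in>F. c\<^sup>2 * (moment2 k * real k powr (-(2 * s))))"
  proof (intro sum_mono)
    fix k assume k: "k \<in> F"
    have "(w k)\<^sup>2 \<le> (c * real k powr (-s))\<^sup>2" using power_mono[OF w[OF k], of 2] by simp
    also have "\<dots> = c\<^sup>2 * real k powr (-(2 * s))" by (simp add: power2_eq_square powr_add[symmetric])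
    finally have "(w k)\<^sup>2 * moment2 k \<le> (c\<^sup>2 * real k powr (-(2 * s))) * moment2 k" by (intro mult_right_mono moment2_nonneg)
    thus "(w k)\<^sup>2 * moment2 k \<le> c\<^sup>2 * (moment2 k * real k powr (-(2 * s)))" by (simp add: ac_simps)
  qed
  also have "\<dots> = c\<^sup>2 * (\<Sum>k\<in>F. moment2 k * real k powr (-(2 * s)))" by (simp add: sum_distrib_left)
  also have "(\<Sum>k\<in>F. moment2 k * real k powr (-(2 * s))) \<le> dsum moment2 (2 * s)"
  proof -
    define G where "G = (\<lambda>k. k - 1) ` F"
    have inj: "inj_on Suc G" by simp
    have FG: "F = Suc ` G" using F(2) by (force simp: G_def image_image)
    have "(\<Sum>k\<in>F. moment2 k * real k powr (-(2 * s))) = (\<Sum>k\<in>G. moment2 (Suc k) * real (Suc k) powr (-(2 * s)))"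
      unfolding FG by (subst sum.reindex) auto
    also have "\<dots> \<le> (\<Sum>k. moment2 (Suc k) * real (Suc k) powr (-(2 * s)))"
      using F s var_summable[of "2 * s"] moment2_nonneg by (intro sum_le_suminf) (auto simp: G_def moment2_def)
    finally show ?thesis by (simp add: dsum_def)
  qed
  finally show ?thesis by (simp add: mult_left_mono)
qed

text \<open>A bound for l times a single weighted term at scale s; it plays the part of
  \<open>d\<close> in the bounds for moment generating functions.\<close>

definition err :: "real \<Rightarrow> real \<Rightarrow> real" where "err l s = l * (C0 * s powr (-b/2) / ln (1/s))"

lemma mgf_core:
  assumes F: "finite F" "F \<subseteq> {1..}" and s: "0 < s" "s < s0" and w: "\<And>k. k \<in> F \<Longrightarrow> \<bar>w k\<bar> \<le> real k powr (-s)"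
    and l: "l \<ge> 0" and d: "err l s \<le> d" "0 \<le> d" "d \<le> 1"
  shows "integrable M (\<lambda>\<omega>. exp (l * (\<Sum>k\<in>F. w k * Y k \<omega>)))"
    and "expectation (\<lambda>\<omega>. exp (l * (\<Sum>k\<in>F. w k * Y k \<omega>))) \<le> exp ((1+d)/2 * (l\<^sup>2 * (\<Sum>k\<in>F. (w k)\<^sup>2 * moment2 k)))"
    and "exp ((1-2*d)/2 * (l\<^sup>2 * (\<Sum>k\<in>F. (w k)\<^sup>2 * moment2 k))) \<le> expectation (\<lambda>\<omega>. exp (l * (\<Sum>k\<in>F. w k * Y k \<omega>)))"
proof -
  define X where "X k \<omega> = l * w k * Y k \<omega>" for k \<omega>
  have ind': "indep_vars (\<lambda>_. borel) X F"
    using indep_vars_compose2[OF indep_vars_subset[OF ind F(2)], of "\<lambda>k y. l * w k * y" "\<lambda>_. borel"]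
    unfolding X_def by simp
  have bd: "\<bar>X k \<omega>\<bar> \<le> d" if "k \<in> F" "\<omega> \<in> space M" for k \<omega>
  proof -
    have k: "k \<ge> 1" using that F by auto
    have "\<bar>X k \<omega>\<bar> = l * (\<bar>w k\<bar> * \<bar>Y k \<omega>\<bar>)" using l by (simp add: X_def abs_mult)
    also have "\<dots> \<le> l * (real k powr (-s) * \<bar>Y k \<omega>\<bar>)" using w[OF that(1)] l by (intro mult_left_mono mult_right_mono) auto
    also have "\<dots> \<le> err l s" unfolding err_def using bdd[OF k s that(2)] l by (intro mult_left_mono) (auto simp: mult.commute)
    finally show ?thesis using d by simp
  qed
  have mn: "expectation (X k) = 0" if "k \<in> F" for k
    using mean[of k] that F by (auto simp: X_def[abs_def])
  have e1: "(\<Sum>k\<in>F. X k \<omega>) = l * (\<Sum>k\<in>F. w k * Y k \<omega>)" for \<omega> by (simp add: X_def sum_distrib_left mult.assoc)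
  have e2: "(\<Sum>k\<in>F. expectation (\<lambda>\<omega>. (X k \<omega>)\<^sup>2)) = l\<^sup>2 * (\<Sum>k\<in>F. (w k)\<^sup>2 * moment2 k)"
    by (simp add: X_def power_mult_distrib moment2_def sum_distrib_left mult.assoc)
  from mgf_sum_bounds[OF F(1) ind' bd d(2,3) mn]
  show "integrable M (\<lambda>\<omega>. exp (l * (\<Sum>k\<in>F. w k * Y k \<omega>)))"
    and "expectation (\<lambda>\<omega>. exp (l * (\<Sum>k\<in>F. w k * Y k \<omega>))) \<le> exp ((1+d)/2 * (l\<^sup>2 * (\<Sum>k\<in>F. (w k)\<^sup>2 * moment2 k)))"
    and "exp ((1-2*d)/2 * (l\<^sup>2 * (\<Sum>k\<in>F. (w k)\<^sup>2 * moment2 k))) \<le> expectation (\<lambda>\<omega>. exp (l * (\<Sum>k\<in>F. w k * Y k \<omega>)))"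
    unfolding e1 e2 by auto
qed

text \<open>For parameters of this order the powers of s cancel and sqrt (llog s) / ln (1/s)
  remains. The logarithm in the denominator of \<open>bdd\<close> is what makes this tend to
  0.\<close>

lemma err_small:
  assumes d: "d > 0"
  shows "\<forall>\<^sub>F s in at_right 0. err (c * s powr (b/2) * sqrt (llog s)) s \<le> d"
proof -
  have "((\<lambda>s. c * C0 * sqrt (ln (ln (1/s))) / ln (1/s)) \<longlongrightarrow> 0) (at_right 0)" by real_asymp
  hence "\<forall>\<^sub>F s in at_right 0. c * C0 * sqrt (ln (ln (1/s))) / ln (1/s) < d"
    using d by (rule order_tendstoD)
  moreover have "\<forall>\<^sub>F s in at_right (0::real). s > 0" by (simp add: eventually_at_filter)
  ultimately show ?thesis
  proof eventually_elim
    case (elim s)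
    have "s powr (b/2) * s powr (-b/2) = 1" using elim by (simp add: powr_add[symmetric])
    hence "err (c * s powr (b/2) * sqrt (llog s)) s = c * C0 * sqrt (ln (ln (1/s))) / ln (1/s)"
      unfolding err_def llog_def by (simp add: field_simps)
    thus ?case using elim by simp
  qed
qed

lemma variance_eventually:
  assumes e: "e > 0"
  shows "\<forall>\<^sub>F s in at_right 0. dsum moment2 (2 * s) \<le> (1+e) * D * s powr (-b)"
    and "\<forall>\<^sub>F s in at_right 0. (1-e) * D * s powr (-b) \<le> dsum moment2 (2 * s)"
proof -
  have "(\<lambda>s. dsum moment2 (2 * s) - D * s powr (-b)) \<in> o[at_right 0](\<lambda>s. D * s powr (-b))"
    using var by (simp add: asymp_equiv_altdef moment2_def[abs_def])
  hence ev: "\<forall>\<^sub>F s in at_right 0. norm (dsum moment2 (2 * s) - D * s powr (-b)) \<le> e * norm (D * s powr (-b))"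
    using e by (rule landau_o.smallD)
  show "\<forall>\<^sub>F s in at_right 0. dsum moment2 (2 * s) \<le> (1+e) * D * s powr (-b)"
    using ev by eventually_elim (use D in \<open>auto simp: abs_mult algebra_simps\<close>)
  show "\<forall>\<^sub>F s in at_right 0. (1-e) * D * s powr (-b) \<le> dsum moment2 (2 * s)"
    using ev by eventually_elim (use D in \<open>auto simp: abs_mult algebra_simps\<close>)
qed

lemma small_eventually: "\<forall>\<^sub>F s in at_right (0::real). 0 < s \<and> s < exp (- exp 1) \<and> s < s0"
  using eventually_at_right_real[of 0 "exp (- exp 1)"] eventually_at_right_real[OF s0]
  by (auto elim: eventually_elim2)

text \<open>The factor exp 1 undoes the weights exp (-1) in \<open>maximal_block\<close>, and 2 + 2
  D turns the Chernoff exponent into -(2 + 2 D) + 2 D = -2.\<close>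

definition max_const :: real where "max_const = exp 1 * (2 + 2 * D)"

text \<open>For ln k \<le> 1/s one has k^(-s) \<ge> exp (-1), so the constant weights exp (-1) and -
  exp (-1) are admissible in \<open>mgf_core\<close> and unweighted partial sums inherit the
  estimates at scale s. The exponent -2 is beyond the border of summability on geometric
  grids.\<close>

lemma maximal_block:
  "\<forall>\<^sub>F s in at_right 0. \<forall>N. ln (real N) \<le> 1/s \<longrightarrow>
     prob {\<omega>\<in>space M. \<exists>n\<in>{1..N}. \<bar>\<Sum>k=1..n. Y k \<omega>\<bar> \<ge> max_const * lil_scale b s} \<le> 2 * exp (- 2 * llog s)"
proof -
  have "\<forall>\<^sub>F s in at_right 0. err (1 * s powr (b/2) * sqrt (llog s)) s \<le> 1" by (rule err_small) simp
  with variance_eventually(1)[of 1, simplified] small_eventually show ?thesis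
  proof eventually_elim
    case (elim s)
    \<comment> \<open>Normalized so that both \<open>l\<^sup>2 * s powr (-b)\<close> and
      \<open>l * lil_scale b s\<close> equal \<open>llog s\<close>.\<close>
    define l where "l = s powr (b/2) * sqrt (llog s)"
    have s: "0 < s" "s < exp (- exp 1)" "s < s0" using elim by auto
    have llog: "llog s > 1" using iterated_ln_small[OF s(1,2)] by simp
    have l: "l \<ge> 0" "err l s \<le> 1" using elim llog by (auto simp: l_def)
    have l2: "l\<^sup>2 * s powr (-b) = llog s"
    proof -
      have "l\<^sup>2 * s powr (-b) = (s powr (b/2) * s powr (b/2) * s powr (-b)) * (sqrt (llog s) * sqrt (llog s))"
        unfolding l_def power2_eq_square by (simp only: ac_simps)
      also have "s powr (b/2) * s powr (b/2) * s powr (-b) = 1" using s by (simp only: powr_add[symmetric]) simp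
      finally show ?thesis using llog by simp
    qed
    have lphi: "l * lil_scale b s = llog s"
    proof -
      have "l * lil_scale b s = (s powr (b/2) * s powr (-b/2)) * (sqrt (llog s) * sqrt (llog s))"
        unfolding l_def lil_scale_def by (simp only: ac_simps)
      also have "s powr (b/2) * s powr (-b/2) = 1" using s by (simp add: powr_add[symmetric])
      finally show ?thesis using llog by simp
    qed
    show ?case
    proof (intro allI impI)
      fix N assume N: "ln (real N) \<le> 1/s"
      have one: "prob {\<omega>\<in>space M. \<exists>n\<in>{1..N}. (\<Sum>k=1..n. w * Y k \<omega>) \<ge> (2 + 2 * D) * lil_scale b s} \<le> exp (- 2 * llog s)"
        if w: "\<bar>w\<bar> = exp (-1)" for w
      proof -
        have wk: "\<bar>w\<bar> \<le> real k powr (-s)" if "k \<in> {1..N}" for k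
        proof -
          have "ln (real k) \<le> ln (real N)" using that by (subst ln_le_cancel_iff) auto
          hence "ln (real k) * s \<le> (1/s) * s" using N s by (intro mult_right_mono) auto
          hence "ln (real k) * s \<le> 1" using s by simp
          thus ?thesis unfolding w using that by (simp add: powr_def mult.commute)
        qed
        have F: "finite {1..N}" "{1..N} \<subseteq> {1..}" by auto
        note m = mgf_core[OF F s(1,3), of "\<lambda>_. w", OF wk l(1,2)]
        have i: "indep_vars (\<lambda>_. borel) (\<lambda>k \<omega>. w * Y k \<omega>) {1..}"
          using indep_vars_compose2[OF ind, of "\<lambda>k y. w * y" "\<lambda>_. borel"] by simp
        have bdw: "\<exists>B. \<forall>\<omega>\<in>space M. \<bar>w * Y k \<omega>\<bar> \<le> B" if "k \<ge> 1" for k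
        proof -
          from Y_bounded[OF that] obtain B where "\<forall>\<omega>\<in>space M. \<bar>Y k \<omega>\<bar> \<le> B" by blast
          thus ?thesis by (intro exI[of _ "\<bar>w\<bar> * B"]) (auto simp: abs_mult intro: mult_left_mono)
        qed
        have "prob {\<omega>\<in>space M. \<exists>n\<in>{1..N}. (\<Sum>k=1..n. w * Y k \<omega>) \<ge> (2 + 2 * D) * lil_scale b s}
          \<le> exp (- l * ((2 + 2 * D) * lil_scale b s)) * expectation (\<lambda>\<omega>. exp (l * (\<Sum>k=1..N. w * Y k \<omega>)))"
          using mean by (intro maximal_exp_inequality[OF i l(1) bdw]) auto
        also have "\<dots> \<le> exp (- l * ((2 + 2 * D) * lil_scale b s)) * exp ((1+1)/2 * (l\<^sup>2 * (\<Sum>k=1..N. w\<^sup>2 * moment2 k)))"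
          by (intro mult_left_mono m(2)) auto
        also have "\<dots> \<le> exp (- l * ((2 + 2 * D) * lil_scale b s)) * exp (l\<^sup>2 * (2 * D * s powr (-b)))"
        proof -
          have "(\<Sum>k=1..N. w\<^sup>2 * moment2 k) \<le> 1\<^sup>2 * dsum moment2 (2 * s)"
            using wk by (intro moment2_sum_le[OF F s(1)]) auto
          also have "\<dots> \<le> 2 * D * s powr (-b)" using elim by simp
          finally have "l\<^sup>2 * (\<Sum>k=1..N. w\<^sup>2 * moment2 k) \<le> l\<^sup>2 * (2 * D * s powr (-b))" by (intro mult_left_mono) auto
          thus ?thesis by simp
        qed
        also have "\<dots> = exp (- (2 + 2*D) * (l * lil_scale b s) + 2 * D * (l\<^sup>2 * s powr (-b)))"
          by (simp only: exp_add[symmetric]) (simp add: algebra_simps)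
        also have "\<dots> = exp (- 2 * llog s)" unfolding l2 lphi by (simp add: algebra_simps)
        finally show ?thesis .
      qed
      have Sm[measurable]: "(\<lambda>\<omega>. \<Sum>k=1..n. w * Y k \<omega>) \<in> borel_measurable M" for n w
        by (intro borel_measurable_sum) auto
      let ?E = "\<lambda>w. {\<omega>\<in>space M. \<exists>n\<in>{1..N}. (\<Sum>k=1..n. w * Y k \<omega>) \<ge> (2 + 2 * D) * lil_scale b s}"
      have "{\<omega>\<in>space M. \<exists>n\<in>{1..N}. \<bar>\<Sum>k=1..n. Y k \<omega>\<bar> \<ge> max_const * lil_scale b s} \<subseteq> ?E (exp (-1)) \<union> ?E (- exp (-1))"
      proof safe
        fix \<omega> n assume \<omega>: "\<omega> \<in> space M" and n: "n \<in> {1..N}" and ge: "\<bar>\<Sum>k=1..n. Y k \<omega>\<bar> \<ge> max_const * lil_scale b s"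
          and no: "\<not> (\<exists>n\<in>{1..N}. (\<Sum>k=1..n. - exp (-1) * Y k \<omega>) \<ge> (2 + 2 * D) * lil_scale b s)"
        have "exp (-1) * (max_const * lil_scale b s) \<le> exp (-1) * \<bar>\<Sum>k=1..n. Y k \<omega>\<bar>" using ge by (intro mult_left_mono) auto
        also have "exp (-1) * (max_const * lil_scale b s) = (2 + 2 * D) * lil_scale b s"
          unfolding max_const_def by (simp add: exp_minus)
        finally have "(2 + 2 * D) * lil_scale b s \<le> exp (-1) * \<bar>\<Sum>k=1..n. Y k \<omega>\<bar>" .
        moreover have "(\<Sum>k=1..n. - exp (-1) * Y k \<omega>) < (2 + 2 * D) * lil_scale b s" using no n by force
        ultimately have "(2 + 2 * D) * lil_scale b s \<le> exp (-1) * (\<Sum>k=1..n. Y k \<omega>)"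
          by (cases "(\<Sum>k=1..n. Y k \<omega>) \<ge> 0") (auto simp: sum_distrib_left[symmetric] sum_negf)
        thus "\<exists>n\<in>{1..N}. (\<Sum>k=1..n. exp (-1) * Y k \<omega>) \<ge> (2 + 2 * D) * lil_scale b s"
          using n by (auto simp: sum_distrib_left)
      qed
      hence "prob {\<omega>\<in>space M. \<exists>n\<in>{1..N}. \<bar>\<Sum>k=1..n. Y k \<omega>\<bar> \<ge> max_const * lil_scale b s} \<le> prob (?E (exp (-1)) \<union> ?E (- exp (-1)))"
        by (intro finite_measure_mono) auto
      also have "\<dots> \<le> prob (?E (exp (-1))) + prob (?E (- exp (-1)))" by (intro measure_Un_le) auto
      also have "\<dots> \<le> exp (- 2 * llog s) + exp (- 2 * llog s)" by (intro add_mono one) auto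
      finally show "prob {\<omega>\<in>space M. \<exists>n\<in>{1..N}. \<bar>\<Sum>k=1..n. Y k \<omega>\<bar> \<ge> max_const * lil_scale b s} \<le> 2 * exp (- 2 * llog s)" by simp
    qed
  qed
qed

section \<open>Geometric grids and a crude iterated logarithm bound\<close>

lemma grid_tendsto:
  assumes "0 < r" "r < (1::real)" shows "filterlim (\<lambda>j. r ^ j) (at_right 0) sequentially"
proof -
  have "(\<lambda>j. r ^ j) \<longlonglongrightarrow> 0" using assms by (intro LIMSEQ_power_zero) auto
  thus ?thesis using assms by (auto simp: filterlim_at)
qed

lemma llog_grid:
  assumes "0 < r" "r < (1::real)" "j \<ge> 1" shows "llog (r ^ j) = ln (real j * ln (1/r))"
  using assms by (simp add: llog_def ln_div ln_realpow)

text \<open>At s = r^j, exp (- llog s) equals 1 / (j ln (1/r)), so the bound is a constant times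
  j^(-(1+e)).\<close>

lemma summable_grid:
  assumes r: "0 < r" "r < 1" and e: "e > 0" and P: "\<forall>\<^sub>F s in at_right 0. p s \<le> C * exp (- (1+e) * llog s)"
     and p0: "\<And>s. p s \<ge> (0::real)"
  shows "summable (\<lambda>j. p (r ^ j))"
proof (rule summable_comparison_test_ev)
  define c where "c = ln (1/r)"
  have c: "c > 0" using r by (simp add: c_def)
  show "summable (\<lambda>j. C * c powr (-(1+e)) * real j powr (-(1+e)))"
    using e by (intro summable_mult) (simp add: summable_real_powr_iff)
  have "\<forall>\<^sub>F j in sequentially. p (r ^ j) \<le> C * exp (- (1+e) * llog (r ^ j))"
    using P grid_tendsto[OF r] by (rule eventually_compose_filterlim)
  thus "\<forall>\<^sub>F j in sequentially. norm (p (r ^ j)) \<le> C * c powr (-(1+e)) * real j powr (-(1+e))"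
    using eventually_ge_at_top[of 1]
  proof eventually_elim
    case (elim j)
    have "exp (- (1+e) * llog (r ^ j)) = (real j * c) powr (-(1+e))"
      using elim r c unfolding llog_grid[OF r elim(2)] c_def[symmetric] by (simp add: powr_def)
    also have "\<dots> = c powr (-(1+e)) * real j powr (-(1+e))" using c elim by (simp add: powr_mult)
    finally show ?case using elim p0[of "r^j"] by (simp add: mult.assoc)
  qed
qed

definition crude_const :: real where "crude_const = max_const * (2 powr (b/2) * 2)"

text \<open>Borel-Cantelli for \<open>maximal_block\<close> at s = 2^(-j) covers all n with ln n
  \<le> 2^j. Given n, take j with ln n \<le> 2^j < 2 ln n. Then s and 1 / ln n differ by at most a
  factor 2, which \<open>crude_const\<close> pays for through \<open>lil_scale_half\<close>.\<close>

lemma crude_bound: "AE \<omega> in M. \<exists>n0. \<forall>n\<ge>n0. \<bar>\<Sum>k=1..n. Y k \<omega>\<bar> \<le> crude_const * lil_scale b (1 / ln (real n))"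
proof -
  define E where "E s = {\<omega>\<in>space M. \<exists>n\<in>{1..nat \<lfloor>exp (1 / s)\<rfloor>}. \<bar>\<Sum>k=1..n. Y k \<omega>\<bar> \<ge> max_const * lil_scale b s}" for s
  have Sm[measurable]: "(\<lambda>\<omega>. \<Sum>k=1..n. Y k \<omega>) \<in> borel_measurable M" for n
    by (intro borel_measurable_sum) auto
  have ln: "ln (real (nat \<lfloor>exp (1 / s)\<rfloor>)) \<le> 1/s" if "s > 0" for s :: real
  proof -
    have "real (nat \<lfloor>exp (1 / s)\<rfloor>) \<le> exp (1/s)" by simp
    moreover have "exp (1 / s) \<ge> 1" using that by simp
    hence "real (nat \<lfloor>exp (1 / s)\<rfloor>) > 0" by simp
    ultimately show ?thesis by (metis ln_exp ln_le_cancel_iff exp_gt_zero)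
  qed
  have "\<forall>\<^sub>F s in at_right 0. prob (E s) \<le> 2 * exp (- (1+1) * llog s)"
    using maximal_block small_eventually
  proof eventually_elim
    case (elim s)
    from elim(1)[rule_format, OF ln] elim(2) show ?case by (simp add: E_def)
  qed
  from summable_grid[OF _ _ _ this, of "1/2"] have "summable (\<lambda>j. prob (E ((1/2)^j)))" by simp
  hence "AE \<omega> in M. \<forall>\<^sub>F j in sequentially. \<omega> \<in> space M - E ((1/2)^j)"
    by (intro borel_cantelli_AE1) (auto simp: E_def emeasure_eq_measure)
  thus ?thesis
  proof eventually_elim
    case (elim \<omega>)
    \<comment> \<open>Half the usual threshold, because 1 / ln n may be almost twice the grid point
      and must still be below exp (- exp 1).\<close>
    have "\<forall>\<^sub>F j in sequentially. (1/2::real)^j < exp (- exp 1)/2"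
      using order_tendstoD(2)[OF LIMSEQ_power_zero[of "1/2::real"], of "exp (- exp 1)/2"] by simp
    from eventually_conj[OF elim this] obtain J where J: "\<And>j. j \<ge> J \<Longrightarrow> \<omega> \<in> space M \<and> \<omega> \<notin> E ((1/2)^j) \<and> (1/2::real)^j < exp (- exp 1)/2"
      by (auto simp: eventually_sequentially)
    define n0 where "n0 = nat \<lceil>exp (2 ^ (J+1) :: real)\<rceil>"
    have "\<bar>\<Sum>k=1..n. Y k \<omega>\<bar> \<le> crude_const * lil_scale b (1 / ln (real n))" if n: "n \<ge> n0" for n
    proof -
      have nn: "real n \<ge> exp (2 ^ (J+1))" using order_trans[OF real_nat_ceiling_ge of_nat_mono[OF n[unfolded n0_def]]] .
      define t where "t = ln (real n)"
      have t: "t \<ge> 2 ^ (J+1)" using nn ln_mono[of "exp (2^(J+1))" "real n"] less_le_trans[OF exp_gt_zero nn] by (simp add: t_def)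
      have t1: "t \<ge> 1" using t one_le_power[of "2::real" "J+1"] by linarith
      define j where "j = nat \<lceil>log 2 t\<rceil>"
      have lt: "log 2 t \<ge> 0" using t1 by simp
      have j1: "real j \<ge> log 2 t" "real j < log 2 t + 1" unfolding j_def using lt by linarith+
      have j2: "(2::real)^j \<ge> t" "(2::real)^j < 2 * t"
        using j1 t1 powr_mono[OF j1(1), of 2] powr_less_mono[OF j1(2), of 2] by (simp_all add: powr_realpow powr_add)
      have "(2::real)^j \<ge> 2^(J+1)" using j2 t by linarith
      hence "j \<ge> J" by (simp add: power_increasing_iff[of "2::real"] del: power_Suc)
      note JJ = J[OF this]
      define s where "s = (1/2::real)^j"
      have s: "s > 0" "1 / s = 2^j" by (auto simp: s_def power_divide)
      have "real n \<le> exp (1/s)" using j2 nn s by (simp add: t_def) (metis exp_gt_zero exp_le_cancel_iff exp_ln less_le_trans)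
      hence "n \<le> nat \<lfloor>exp (1/s)\<rfloor>" by (simp add: le_nat_floor)
      moreover have "n \<ge> 1" using nn less_le_trans[OF exp_gt_zero nn] by auto
      ultimately have "\<bar>\<Sum>k=1..n. Y k \<omega>\<bar> < max_const * lil_scale b s"
        using JJ unfolding s_def[symmetric] E_def by force
      also have "max_const * lil_scale b s \<le> max_const * lil_scale b ((1/t)/2)"
      proof -
        have "(1/t)/2 \<le> s" using j2 t1 s by (simp add: s_def power_divide field_simps)
        moreover have "s < exp (- exp 1)" using JJ s(1) unfolding s_def[symmetric] by linarith
        ultimately show ?thesis using t1 b D unfolding max_const_def by (intro mult_left_mono lil_scale_antimono) auto
      qed
      also have "\<dots> \<le> max_const * (2 powr (b/2) * 2 * lil_scale b (1/t))"
      proof -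
        have "2 ^ j > 2 * exp (exp (1::real))" using JJ by (simp add: power_divide exp_minus field_simps)
        hence "t > exp (exp 1)" using j2 by linarith
        hence "1/t < exp (- exp 1)" using t1 by (simp add: exp_minus field_simps)
        thus ?thesis using t1 b D unfolding max_const_def by (intro mult_left_mono lil_scale_half) auto
      qed
      finally show ?thesis by (simp add: crude_const_def t_def)
    qed
    thus ?case by blast
  qed
qed

end

text \<open>Moment generating functions are available for finite sums only. If the limit exceeds x
  strictly, then from some index on all V n are at least x, and continuity from below transfers the
  bound.\<close>

lemma (in prob_space) prob_limit_le:
  fixes V :: "nat \<Rightarrow> 'a \<Rightarrow> real"
  assumes [measurable]: "\<And>n. V n \<in> borel_measurable M" "W \<in> borel_measurable M"
    and lim: "AE \<omega> in M. (\<lambda>n. V n \<omega>) \<longlonglongrightarrow> W \<omega>" and p: "\<And>n. prob {\<omega>\<in>space M. V n \<omega> \<ge> x} \<le> p"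
  shows "prob {\<omega>\<in>space M. W \<omega> > x} \<le> p"
proof -
  define E where "E N = {\<omega>\<in>space M. \<forall>n\<ge>N. V n \<omega> \<ge> x}" for N
  have [measurable]: "E N \<in> events" for N unfolding E_def by measurable
  have "(\<lambda>N. prob (E N)) \<longlonglongrightarrow> prob (\<Union>N. E N)"
    by (intro finite_Lim_measure_incseq) (auto simp: incseq_def E_def)
  moreover have "prob (E N) \<le> p" for N
  proof -
    have "prob (E N) \<le> prob {\<omega>\<in>space M. V N \<omega> \<ge> x}" by (intro finite_measure_mono) (auto simp: E_def)
    thus ?thesis using p[of N] by simp
  qed
  ultimately have "prob (\<Union>N. E N) \<le> p" by (intro LIMSEQ_le_const2[of _ "prob (\<Union>N. E N)"]) auto
  moreover have "prob {\<omega>\<in>space M. W \<omega> > x} \<le> prob (\<Union>N. E N)"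
  proof (rule finite_measure_mono_AE)
    show "AE \<omega> in M. \<omega> \<in> {\<omega>\<in>space M. W \<omega> > x} \<longrightarrow> \<omega> \<in> (\<Union>N. E N)"
      using lim
    proof eventually_elim
      case (elim \<omega>)
      show ?case
      proof
        assume "\<omega> \<in> {\<omega>\<in>space M. W \<omega> > x}"
        hence "\<omega> \<in> space M" "\<forall>\<^sub>F n in sequentially. V n \<omega> > x" using order_tendstoD(1)[OF elim] by auto
        thus "\<omega> \<in> (\<Union>N. E N)" by (fastforce simp: eventually_sequentially E_def)
      qed
    qed
  qed auto
  ultimately show ?thesis by linarith
qed

lemma lil_scale_at_top:
  assumes "b > 0"
  shows "filterlim (lil_scale b) at_top (at_right 0)"
  unfolding lil_scale_def llog_def using assms by real_asymp

lemma lil_scale_mult_le: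
  assumes r: "0 < r" and e: "e > 0"
  shows "\<forall>\<^sub>F s in at_right 0. lil_scale b (r * s) \<le> (1+e) * r powr (-b/2) * lil_scale b s"
proof -
  have "((\<lambda>s. sqrt (ln (ln (1/(r * s)))) / sqrt (ln (ln (1/s)))) \<longlongrightarrow> 1) (at_right 0)"
    using r by real_asymp
  hence "\<forall>\<^sub>F s in at_right 0. sqrt (ln (ln (1/(r * s)))) / sqrt (ln (ln (1/s))) < 1 + e"
    using e by (intro order_tendstoD) auto
  moreover have "\<forall>\<^sub>F s in at_right (0::real). 0 < s \<and> s < exp (- exp 1)"
    using eventually_at_right_real[of 0 "exp (- exp 1)"] by (auto elim: eventually_mono)
  ultimately show ?thesis
  proof eventually_elim
    case (elim s)
    hence s: "0 < s" "s < exp (- exp 1)" by auto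
    have "sqrt (llog (r * s)) \<le> (1+e) * sqrt (llog s)"
      using elim(1) iterated_ln_small(2)[OF s] by (simp add: llog_def field_simps)
    hence "(r powr (-b/2) * s powr (-b/2)) * sqrt (llog (r * s)) \<le> (r powr (-b/2) * s powr (-b/2)) * ((1+e) * sqrt (llog s))"
      by (intro mult_left_mono) auto
    thus ?case unfolding lil_scale_def using r s by (simp add: powr_mult mult_ac)
  qed
qed

lemma grid_interval:
  fixes r s :: real
  assumes r: "0 < r" "r < 1" and s: "0 < s" "s \<le> r ^ J"
  shows "\<exists>j\<ge>J. r ^ Suc j < s \<and> s \<le> r ^ j"
proof -
  define i where "i = (LEAST i. r ^ i < s)"
  have ex: "\<exists>i. r ^ i < s" using real_arch_pow_inv[OF s(1) r(2)] by blast
  have i: "r ^ i < s" unfolding i_def by (rule LeastI_ex[OF ex])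
  have "i > J"
  proof (rule ccontr)
    assume "\<not> i > J"
    hence "r ^ J \<le> r ^ i" using r by (intro power_decreasing) auto
    thus False using i s by linarith
  qed
  then obtain j where j: "i = Suc j" "j \<ge> J" by (cases i) auto
  have "\<not> r ^ j < s" using not_less_Least[of j "\<lambda>i. r ^ i < s"] j(1) unfolding i_def[symmetric] by simp
  thus ?thesis using i j by (intro exI[of _ j]) auto
qed

text \<open>On the grid with r = 1 - 1/m the values are nearly optimal. Between neighbouring points
  the relative increment of s is at most 1/r - 1, and it multiplies \<open>lip_const\<close>, which
  is the same for every grid. Both losses vanish as m grows.\<close>

lemma grid_to_path:
  fixes f :: "real \<Rightarrow> real" and lip_const D b :: real
  assumes b: "b > 0" and D: "D > 0" and lip_const: "lip_const \<ge> 0" and A: "A \<ge> 0"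
    and lip: "\<And>s s'. 0 < s \<Longrightarrow> s < exp (- exp 1) \<Longrightarrow> s \<le> s' \<Longrightarrow> \<bar>f s' - f s\<bar> \<le> (s' - s) / s * (A + lip_const * lil_scale b s)"
    and grid: "\<And>m::nat. m \<ge> 2 \<Longrightarrow> \<forall>\<^sub>F j in sequentially.
       \<bar>f ((1 - 1 / real m) ^ j)\<bar> \<le> (1 + 1 / real m) * sqrt (2 * (1 + 1 / real m) * D) * lil_scale b ((1 - 1 / real m) ^ j)"
    and e: "e > 0"
  shows "\<forall>\<^sub>F s in at_right 0. \<bar>f s\<bar> \<le> (1+e) * sqrt (2 * D) * lil_scale b s"
proof -
  \<comment> \<open>The grid bound plus the oscillation, times the cost of replacing the scale at a
    grid point by that at s. The extra 1 in lip_const + 1 absorbs A, which is eventually below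
    \<open>lil_scale\<close>.\<close>
  define F where "F m = ((1 + 1/m) * sqrt (2 * (1 + 1/m) * D) + (1/(1 - 1/m) - 1) * (lip_const+1)) * ((1 + 1/m) * (1 - 1/m) powr (-b/2))" for m :: real
  have "((\<lambda>m. F (real m)) \<longlongrightarrow> sqrt (2 * D)) sequentially" proof -
    have "((\<lambda>m. F (real m)) \<longlongrightarrow> (2 * D) powr (1/2)) sequentially" unfolding F_def using D by real_asymp
    thus ?thesis using D by (simp add: powr_half_sqrt)
  qed
  hence "\<forall>\<^sub>F m in sequentially. F (real m) < (1 + e) * sqrt (2 * D)"
    using e D by (intro order_tendstoD) auto
  from eventually_conj[OF this eventually_ge_at_top[of 2]] obtain m :: nat
    where m: "F (real m) < (1 + e) * sqrt (2 * D)" "m \<ge> 2" by (auto simp: eventually_sequentially)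
  define r where "r = 1 - 1 / real m"
  have r: "0 < r" "r < 1" using m(2) by (auto simp: r_def field_simps)
  from grid[OF m(2), folded r_def] obtain J where J: "\<And>j. j \<ge> J \<Longrightarrow> \<bar>f (r ^ j)\<bar> \<le> (1 + 1 / real m) * sqrt (2 * (1 + 1 / real m) * D) * lil_scale b (r ^ j)"
    by (auto simp: eventually_sequentially)
  have "\<forall>\<^sub>F s in at_right (0::real). 0 < s \<and> s < exp (- exp 1) \<and> s \<le> r ^ J"
    using eventually_at_right_real[of 0 "exp (- exp 1)"] eventually_at_right_real[of 0 "r ^ J"] r
    by (auto elim: eventually_elim2)
  moreover have "\<forall>\<^sub>F s in at_right 0. lil_scale b (r * s) \<le> (1 + 1 / real m) * r powr (-b/2) * lil_scale b s"
    using r m(2) by (intro lil_scale_mult_le) auto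
  moreover have "\<forall>\<^sub>F s in at_right 0. lil_scale b s \<ge> A" using lil_scale_at_top[OF b] by (auto simp: filterlim_at_top)
  ultimately show ?thesis
  proof eventually_elim
    case (elim s)
    from grid_interval[OF r, of s J] elim obtain j where j: "j \<ge> J" "r ^ Suc j < s" "s \<le> r ^ j" by blast
    define u where "u = r ^ Suc j"
    have u: "0 < u" "u < s" "r * s \<le> u" "u < exp (- exp 1)" using j r elim by (auto simp: u_def)
    have rs: "r * s > 0" using r elim by simp
    note pu = iterated_ln_small(3)[OF u(1,4), of b] and ps = iterated_ln_small(3)[of s b]
    have "lil_scale b s \<le> lil_scale b u" using u elim b by (intro lil_scale_antimono) auto
    hence Au: "A \<le> lil_scale b u" using elim by simp
    have "(s - u) / u \<le> 1/r - 1" using u r by (simp add: field_simps)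
    hence "(s - u) / u * (A + lip_const * lil_scale b u) \<le> (1/r - 1) * ((lip_const + 1) * lil_scale b u)"
      using u A lip_const pu Au r by (intro mult_mono) (auto simp: algebra_simps)
    with lip[OF u(1,4), of s] u have 1: "\<bar>f s - f u\<bar> \<le> (1/r - 1) * (lip_const + 1) * lil_scale b u" by simp
    have "\<bar>f u\<bar> \<le> (1 + 1 / real m) * sqrt (2 * (1 + 1 / real m) * D) * lil_scale b u"
      unfolding u_def using j by (intro J) auto
    hence "\<bar>f s\<bar> \<le> ((1 + 1 / real m) * sqrt (2 * (1 + 1 / real m) * D) + (1/r - 1) * (lip_const + 1)) * lil_scale b u"
      using 1 by (simp add: algebra_simps)
    also have "\<dots> \<le> ((1 + 1 / real m) * sqrt (2 * (1 + 1 / real m) * D) + (1/r - 1) * (lip_const + 1)) * ((1 + 1 / real m) * r powr (-b/2) * lil_scale b s)"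
    proof (intro mult_left_mono)
      have "lil_scale b u \<le> lil_scale b (r * s)" using u b rs by (intro lil_scale_antimono) auto
      thus "lil_scale b u \<le> (1 + 1 / real m) * r powr (-b/2) * lil_scale b s" using elim by simp
      show "0 \<le> (1 + 1 / real m) * sqrt (2 * (1 + 1 / real m) * D) + (1/r - 1) * (lip_const + 1)"
        using D lip_const r by (intro add_nonneg_nonneg mult_nonneg_nonneg) (auto simp: field_simps)
    qed
    also have "\<dots> = F (real m) * lil_scale b s" unfolding F_def r_def by (simp add: mult.assoc)
    also have "\<dots> \<le> (1 + e) * sqrt (2 * D) * lil_scale b s" using m(1) ps elim by (intro mult_right_mono) auto
    finally show ?case .
  qed
qed

section \<open>Upper half of the law of the iterated logarithm\<close>

context dirichlet_core
begin

text \<open>The threshold for s is uniform in \<open>w\<close> and \<open>W\<close> because the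
  weights themselves will depend on s: they are all of k^(-s), with either sign, in the upper bound
  and its part outside a block in the lower bound. \<open>th\<close> is the variance relative to D
  s^(-b), small in the latter use.\<close>

lemma chernoff_core:
  assumes e: "e > 0" and th: "th > 0"
  shows "\<forall>\<^sub>F s in at_right 0. \<forall>w W. (\<forall>k\<ge>1. \<bar>w k\<bar> \<le> real k powr (-s)) \<longrightarrow>
     (\<forall>n. (\<Sum>k=1..n. (w k)\<^sup>2 * moment2 k) \<le> th * D * s powr (-b)) \<longrightarrow>
     W \<in> borel_measurable M \<longrightarrow> (AE \<omega> in M. (\<lambda>n. \<Sum>k=1..n. w k * Y k \<omega>) \<longlonglongrightarrow> W \<omega>) \<longrightarrow>
     prob {\<omega>\<in>space M. W \<omega> > (1+e) * sqrt (2 * th * D) * lil_scale b s} \<le> exp (- (1+e) * llog s)"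
proof -
  \<comment> \<open>With this choice 1 - d = 1 / (1 + e), so the exponent (1 - d)/2 times 2 (1 +
    e)^2 \<open>llog s\<close> is exactly (1 + e) \<open>llog s\<close>.\<close>
  define d where "d = e / (1 + e)"
  have d: "0 < d" "d \<le> 1" using e by (auto simp: d_def)
  \<comment> \<open>The optimal Gaussian parameter: \<open>l\<close> is the level x divided by the
    variance bound, so that l x equals l^2 times that bound.\<close>
  define c where "c = (1+e) * sqrt (2 * th * D) / (th * D)"
  have "\<forall>\<^sub>F s in at_right 0. err (c * s powr (b/2) * sqrt (llog s)) s \<le> d" by (rule err_small[OF d(1)])
  with small_eventually show ?thesis
  proof eventually_elim
    case (elim s)
    hence s: "0 < s" "s < exp (- exp 1)" "s < s0" by auto
    have llog: "llog s > 1" using iterated_ln_small[OF s(1,2)] by simp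
    define l where "l = c * s powr (b/2) * sqrt (llog s)"
    define x where "x = (1+e) * sqrt (2 * th * D) * lil_scale b s"
    have thD: "th * D > 0" using th D by simp
    have c: "c > 0" using e th D by (simp add: c_def)
    have l: "l \<ge> 0" "err l s \<le> d" using elim llog c by (auto simp: l_def)
    have c2: "c * ((1+e) * sqrt (2 * th * D)) = 2 * (1+e)\<^sup>2"
    proof -
      have "c * ((1+e) * sqrt (2 * th * D)) = (1+e)\<^sup>2 * (sqrt (2 * th * D) * sqrt (2 * th * D)) / (th * D)"
        unfolding c_def by (simp add: power2_eq_square)
      also have "sqrt (2 * th * D) * sqrt (2 * th * D) = 2 * (th * D)" using thD by simp
      finally show ?thesis using th D by simp
    qed
    have lx: "l * x = 2 * (1+e)\<^sup>2 * llog s"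
    proof -
      have "l * x = (c * ((1+e) * sqrt (2 * th * D))) * (s powr (b/2) * s powr (-b/2)) * (sqrt (llog s) * sqrt (llog s))"
        unfolding l_def x_def lil_scale_def by (simp only: ac_simps)
      also have "s powr (b/2) * s powr (-b/2) = 1" using s by (simp add: powr_add[symmetric])
      finally show ?thesis using llog c2 by simp
    qed
    have l2: "l\<^sup>2 * (th * D * s powr (-b)) = l * x"
    proof -
      have "c * (th * D) = (1+e) * sqrt (2 * th * D)" using thD by (simp add: c_def)
      moreover have "s powr (b/2) * s powr (-b) = s powr (-b/2)" by (simp only: powr_add[symmetric]) simp
      moreover have "l * (th * D * s powr (-b)) = (c * (th * D)) * (s powr (b/2) * s powr (-b)) * sqrt (llog s)"
        unfolding l_def by (simp only: ac_simps)
      ultimately have "l * (th * D * s powr (-b)) = x" by (simp add: x_def lil_scale_def)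
      thus ?thesis by (simp add: power2_eq_square)
    qed
    show ?case
    proof (intro allI impI)
      fix w W
      assume w: "\<forall>k\<ge>1. \<bar>w k\<bar> \<le> real k powr (-s)" and v: "\<forall>n. (\<Sum>k=1..n. (w k)\<^sup>2 * moment2 k) \<le> th * D * s powr (-b)"
        and [measurable]: "W \<in> borel_measurable M" and lim: "AE \<omega> in M. (\<lambda>n. \<Sum>k=1..n. w k * Y k \<omega>) \<longlonglongrightarrow> W \<omega>"
      have "prob {\<omega>\<in>space M. W \<omega> > x} \<le> exp (- (1+e) * llog s)"
      proof (rule prob_limit_le[OF _ _ lim])
        show Vm: "(\<lambda>\<omega>. \<Sum>k=1..n. w k * Y k \<omega>) \<in> borel_measurable M" for n by (intro borel_measurable_sum) auto
        fix n :: nat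
        have F: "finite {1..n}" "{1..n} \<subseteq> {1..}" by auto
        note m = mgf_core[OF F s(1,3), of w l d, OF _ l(1,2) less_imp_le[OF d(1)] d(2)]
        have w': "\<bar>w k\<bar> \<le> real k powr (-s)" if "k \<in> {1..n}" for k using w that by auto
        have "prob {\<omega>\<in>space M. (\<Sum>k=1..n. w k * Y k \<omega>) \<ge> x} \<le> exp (- l * x) * expectation (\<lambda>\<omega>. exp (l * (\<Sum>k=1..n. w k * Y k \<omega>)))"
          using m(1) w' by (intro chernoff[OF Vm l(1)]) auto
        also have "\<dots> \<le> exp (- l * x) * exp ((1+d)/2 * (l\<^sup>2 * (\<Sum>k=1..n. (w k)\<^sup>2 * moment2 k)))"
          using m(2) w' by (intro mult_left_mono) auto
        also have "\<dots> \<le> exp (- l * x) * exp ((1+d)/2 * (l * x))"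
          unfolding l2[symmetric] using v d by (intro mult_left_mono iffD2[OF exp_le_cancel_iff]) auto
        also have "\<dots> = exp (- ((1 - d)/2 * (l * x)))" by (simp only: exp_add[symmetric]) (simp add: field_simps)
        also have "(1 - d)/2 * (l * x) = (1+e) * llog s"
          unfolding lx d_def using e by (simp add: field_simps power2_eq_square)
        finally show "prob {\<omega>\<in>space M. (\<Sum>k=1..n. w k * Y k \<omega>) \<ge> x} \<le> exp (- (1+e) * llog s)" by (simp only: minus_mult_left)
      qed auto
      thus "prob {\<omega>\<in>space M. W \<omega> > (1+e) * sqrt (2 * th * D) * lil_scale b s} \<le> exp (- (1+e) * llog s)" by (simp add: x_def)
    qed
  qed
qed

definition X :: "real \<Rightarrow> 'a \<Rightarrow> real" where "X s \<omega> = dsum (\<lambda>k. Y k \<omega>) s"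

lemma X_measurable[measurable]: "X s \<in> borel_measurable M"
  unfolding X_def dsum_def by (intro borel_measurable_suminf) auto

definition lip_const :: real where "lip_const = crude_const * (2 + Gamma (1 + (b/2+1)) + Gamma (2 + (b/2+1)))"

lemma lip_const_nonneg: "lip_const \<ge> 0"
  using b D unfolding lip_const_def crude_const_def max_const_def
  by (intro mult_nonneg_nonneg add_nonneg_nonneg Gamma_real_nonneg) auto

text \<open>Only the additive \<open>A\<close> is random. The coefficient \<open>lip_const\<close>
  of the leading term is deterministic, so the grid may be refined against it afterwards.\<close>

lemma path_AE: "AE \<omega> in M. (\<forall>s>0. summable (\<lambda>k. Y (Suc k) \<omega> * real (Suc k) powr (-s))) \<and>
    continuous_on {0<..} (\<lambda>s. X s \<omega>) \<and>
    (\<exists>A\<ge>0. \<forall>s s'. 0 < s \<longrightarrow> s < exp (- exp 1) \<longrightarrow> s \<le> s' \<longrightarrow> \<bar>X s' \<omega> - X s \<omega>\<bar> \<le> (s' - s) / s * (A + lip_const * lil_scale b s))"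
  using crude_bound
proof eventually_elim
  case (elim \<omega>)
  then obtain n0 where n0: "\<And>n. n \<ge> n0 \<Longrightarrow> \<bar>\<Sum>k=1..n. Y k \<omega>\<bar> \<le> crude_const * lil_scale b (1 / ln (real n))" by blast
  have "crude_const \<ge> 0" using D by (simp add: crude_const_def max_const_def)
  note p = path_bounds[OF b this n0]
  show ?case unfolding X_def lip_const_def using p by auto
qed

lemma X_lim: "AE \<omega> in M. \<forall>s>0. (\<lambda>n. \<Sum>k=1..n. real k powr (-s) * Y k \<omega>) \<longlonglongrightarrow> X s \<omega>"
  using path_AE
proof eventually_elim
  case (elim \<omega>)
  show ?case
  proof (intro allI impI)
    fix s :: real assume "s > 0"
    hence "summable (\<lambda>k. Y (Suc k) \<omega> * real (Suc k) powr (-s))" using elim by auto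
    from summable_LIMSEQ[OF this] show "(\<lambda>n. \<Sum>k=1..n. real k powr (-s) * Y k \<omega>) \<longlonglongrightarrow> X s \<omega>"
      using sum.atLeast1_atMost_eq[of "\<lambda>k. real k powr (-s) * Y k \<omega>"] by (simp add: X_def dsum_def mult.commute)
  qed
qed

text \<open>Taking th = 1 + e absorbs the error in the variance asymptotics; the other factor 1 + e
  makes the tail probabilities summable along the grid.\<close>

lemma upper_grid:
  assumes e: "e > 0" and r: "0 < r" "r < 1"
  shows "AE \<omega> in M. \<forall>\<^sub>F j in sequentially. \<bar>X (r ^ j) \<omega>\<bar> \<le> (1+e) * sqrt (2 * (1+e) * D) * lil_scale b (r ^ j)"
proof -
  define E where "E s = {\<omega>\<in>space M. \<bar>X s \<omega>\<bar> > (1+e) * sqrt (2 * (1+e) * D) * lil_scale b s}" for s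
  have "1 + e > 0" using e by simp
  note ch = chernoff_core[OF e this]
  have "\<forall>\<^sub>F s in at_right 0. prob (E s) \<le> 2 * exp (- (1+e) * llog s)"
    using ch small_eventually variance_eventually(1)[OF e]
  proof eventually_elim
    case (elim s)
    hence s: "s > 0" by simp
    let ?x = "(1+e) * sqrt (2 * (1+e) * D) * lil_scale b s"
    have one: "prob {\<omega>\<in>space M. c * X s \<omega> > ?x} \<le> exp (- (1+e) * llog s)" if c: "\<bar>c\<bar> = 1" for c
    proof (rule elim(1)[rule_format])
      show "\<bar>c * real k powr (-s)\<bar> \<le> real k powr (-s)" for k using c by (simp add: abs_mult)
      show "(\<Sum>k=1..n. (c * real k powr (-s))\<^sup>2 * moment2 k) \<le> (1+e) * D * s powr (-b)" for n
      proof -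
        have "(\<Sum>k=1..n. (c * real k powr (-s))\<^sup>2 * moment2 k) \<le> 1\<^sup>2 * dsum moment2 (2 * s)"
          using s c by (intro moment2_sum_le) (auto simp: abs_mult)
        thus ?thesis using elim by simp
      qed
      show "AE \<omega> in M. (\<lambda>n. \<Sum>k=1..n. c * real k powr (-s) * Y k \<omega>) \<longlonglongrightarrow> c * X s \<omega>"
        using X_lim by eventually_elim (use s in \<open>auto simp: mult.assoc sum_distrib_left[symmetric] intro!: tendsto_mult_left\<close>)
    qed auto
    have "E s \<subseteq> {\<omega>\<in>space M. 1 * X s \<omega> > ?x} \<union> {\<omega>\<in>space M. (-1) * X s \<omega> > ?x}"
      unfolding E_def by (auto simp: abs_if split: if_splits)
    hence "prob (E s) \<le> prob ({\<omega>\<in>space M. 1 * X s \<omega> > ?x} \<union> {\<omega>\<in>space M. (-1) * X s \<omega> > ?x})"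
      by (intro finite_measure_mono) auto
    also have "\<dots> \<le> prob {\<omega>\<in>space M. 1 * X s \<omega> > ?x} + prob {\<omega>\<in>space M. (-1) * X s \<omega> > ?x}" by (intro measure_Un_le) auto
    also have "\<dots> \<le> exp (- (1+e) * llog s) + exp (- (1+e) * llog s)" by (intro add_mono one) auto
    finally show ?case by simp
  qed
  from summable_grid[OF r e this] have "summable (\<lambda>j. prob (E (r^j)))" by simp
  hence "AE \<omega> in M. \<forall>\<^sub>F j in sequentially. \<omega> \<in> space M - E (r^j)"
    by (intro borel_cantelli_AE1) (auto simp: E_def emeasure_eq_measure)
  thus ?thesis
    by eventually_elim (auto simp: E_def not_less elim!: eventually_mono)
qed

lemma upper_bound:
  "AE \<omega> in M. \<forall>e>0. \<forall>\<^sub>F s in at_right 0. \<bar>X s \<omega>\<bar> \<le> (1+e) * sqrt (2 * D) * lil_scale b s"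
proof -
  \<comment> \<open>Countably many grids are enough, so the exceptional sets still form a null
    set.\<close>
  have "AE \<omega> in M. \<forall>m::nat. m \<ge> 2 \<longrightarrow> (\<forall>\<^sub>F j in sequentially.
       \<bar>X ((1 - 1 / real m) ^ j) \<omega>\<bar> \<le> (1 + 1 / real m) * sqrt (2 * (1 + 1 / real m) * D) * lil_scale b ((1 - 1 / real m) ^ j))"
    unfolding AE_all_countable
  proof
    fix m :: nat
    show "AE \<omega> in M. m \<ge> 2 \<longrightarrow> (\<forall>\<^sub>F j in sequentially.
       \<bar>X ((1 - 1 / real m) ^ j) \<omega>\<bar> \<le> (1 + 1 / real m) * sqrt (2 * (1 + 1 / real m) * D) * lil_scale b ((1 - 1 / real m) ^ j))"
      using upper_grid[of "1 / real m" "1 - 1 / real m"] by (cases "m \<ge> 2") auto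
  qed
  with path_AE show ?thesis
  proof eventually_elim
    case (elim \<omega>)
    then obtain A where A: "A \<ge> 0" "\<And>s s'. 0 < s \<Longrightarrow> s < exp (- exp 1) \<Longrightarrow> s \<le> s' \<Longrightarrow> \<bar>X s' \<omega> - X s \<omega>\<bar> \<le> (s' - s) / s * (A + lip_const * lil_scale b s)"
      by blast
    show ?case using elim(2) by (auto intro!: grid_to_path[OF b D lip_const_nonneg A])
  qed
qed

end

section \<open>Lower half: independent blocks and a small complement\<close>

context dirichlet_core
begin

lemma variance_eventually_scaled:
  assumes A: "A > 0"
  shows "\<forall>\<^sub>F s in at_right 0. dsum moment2 (2 * (A * s)) \<le> 2 * D * (A * s) powr (-b)"
proof -
  have "filterlim (\<lambda>s. A * s) (at_right 0) (at_right 0)"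
  proof -
    have "((\<lambda>s. A * s) \<longlongrightarrow> 0) (at_right 0)" by (auto intro!: tendsto_eq_intros)
    moreover have "\<forall>\<^sub>F s in at_right 0. A * s \<in> {0<..}" using A by (auto simp: eventually_at_filter)
    ultimately show ?thesis by (auto simp: filterlim_at eventually_at_filter elim: eventually_mono)
  qed
  from eventually_compose_filterlim[OF variance_eventually(1)[of 1] this] show ?thesis by simp
qed

definition block :: "real \<Rightarrow> real \<Rightarrow> nat set" where
  "block A s = {k. 1 \<le> k \<and> 1 / (A * s) < ln (real k) \<and> ln (real k) \<le> A / s}"

definition outside_const :: "real \<Rightarrow> real" where "outside_const A = 2 * (exp 1)\<^sup>2 * A powr (-b) + 2 * 2 powr b * exp (- A)"

lemma finite_block: "finite (block A s)"
proof -
  have "block A s \<subseteq> {..nat \<lfloor>exp (A / s)\<rfloor>}"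
  proof
    fix k assume k: "k \<in> block A s"
    hence "real k = exp (ln (real k))" by (auto simp: block_def)
    also have "\<dots> \<le> exp (A / s)" using k unfolding exp_le_cancel_iff block_def by blast
    finally show "k \<in> {..nat \<lfloor>exp (A / s)\<rfloor>}" by (simp add: le_nat_floor)
  qed
  thus ?thesis by (rule finite_subset) auto
qed

text \<open>For small indices k^(-s) \<le> 1 \<le> exp 1 * k^(-A s), which compares them with the
  much smaller variance at scale A s. For large indices k^(-s) \<le> exp (-A/2) k^(-s/2), which
  compares them with scale s/2 at an exponentially small price. The two terms of
  \<open>outside_const\<close> are these two contributions.\<close>

lemma outside_block:
  assumes A: "A > 0"
  shows "\<forall>\<^sub>F s in at_right 0. \<forall>n. (\<Sum>k\<in>{1..n} - block A s. (real k powr (-s))\<^sup>2 * moment2 k) \<le> outside_const A * D * s powr (-b)"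
proof -
  have half: "(1/2 :: real) > 0" by simp
  show ?thesis using small_eventually variance_eventually_scaled[OF A] variance_eventually_scaled[OF half]
  proof eventually_elim
    case (elim s)
    hence s: "0 < s" by simp
    show ?case
    proof
      fix n
      define P where "P = {k\<in>{1..n}. ln (real k) \<le> 1 / (A * s)}"
      define Q where "Q = {k\<in>{1..n}. ln (real k) > A / s}"
      have "(\<Sum>k\<in>{1..n} - block A s. (real k powr (-s))\<^sup>2 * moment2 k) \<le> (\<Sum>k\<in>P \<union> Q. (real k powr (-s))\<^sup>2 * moment2 k)"
        by (intro sum_mono2) (auto simp: P_def Q_def block_def intro: mult_nonneg_nonneg moment2_nonneg)
      also have "\<dots> \<le> (\<Sum>k\<in>P. (real k powr (-s))\<^sup>2 * moment2 k) + (\<Sum>k\<in>Q. (real k powr (-s))\<^sup>2 * moment2 k)"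
        by (subst sum.union_inter[symmetric]) (auto simp: P_def Q_def intro!: sum_nonneg mult_nonneg_nonneg moment2_nonneg)
      also have "(\<Sum>k\<in>P. (real k powr (-s))\<^sup>2 * moment2 k) \<le> (exp 1)\<^sup>2 * dsum moment2 (2 * (A * s))"
      proof (rule moment2_sum_le)
        fix k assume k: "k \<in> P"
        hence k1: "real k \<ge> 1" "ln (real k) \<le> 1 / (A * s)" by (auto simp: P_def)
        have "A * s * ln (real k) \<le> A * s * (1 / (A * s))" using k1 A s by (intro mult_left_mono) auto
        hence "A * s * ln (real k) \<le> 1" using A s by simp
        hence "1 \<le> exp (1 + - (A * s) * ln (real k))" by simp
        also have "\<dots> = exp 1 * real k powr (-(A * s))" using k1 by (simp only: exp_add powr_def) simp
        finally have 1: "1 \<le> exp 1 * real k powr (-(A * s))" .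
        have "\<bar>real k powr (-s)\<bar> \<le> 1" using k1 s powr_mono[of "-s" 0 "real k"] by simp
        with 1 show "\<bar>real k powr (-s)\<bar> \<le> exp 1 * real k powr (-(A * s))" by linarith
      qed (use A s in \<open>auto simp: P_def\<close>)
      also have "(exp 1)\<^sup>2 * dsum moment2 (2 * (A * s)) \<le> (exp 1)\<^sup>2 * (2 * D * (A * s) powr (-b))"
        using elim by (intro mult_left_mono) auto
      also have "(\<Sum>k\<in>Q. (real k powr (-s))\<^sup>2 * moment2 k) \<le> (exp (- A / 2))\<^sup>2 * dsum moment2 (2 * (1/2 * s))"
      proof (rule moment2_sum_le)
        fix k assume k: "k \<in> Q"
        hence k1: "real k \<ge> 1" "ln (real k) > A / s" by (auto simp: Q_def)
        have "s * (A / s) \<le> s * ln (real k)" using k1 s by (intro mult_left_mono) auto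
        hence "A \<le> s * ln (real k)" using s by simp
        hence "exp (- s * ln (real k)) \<le> exp (- A / 2 + - (1/2 * s) * ln (real k))" by simp
        thus "\<bar>real k powr (-s)\<bar> \<le> exp (- A / 2) * real k powr (-(1/2 * s))"
          using k1 by (simp add: exp_add[symmetric] powr_def)
      qed (use s in \<open>auto simp: Q_def\<close>)
      also have "(exp (- A / 2))\<^sup>2 * dsum moment2 (2 * (1/2 * s)) \<le> (exp (- A / 2))\<^sup>2 * (2 * D * (1/2 * s) powr (-b))"
        by (intro mult_left_mono elim) auto
      also have "(exp 1)\<^sup>2 * (2 * D * (A * s) powr (-b)) + (exp (- A / 2))\<^sup>2 * (2 * D * (1/2 * s) powr (-b)) = outside_const A * D * s powr (-b)"
      proof -
        have "(exp (- A / 2))\<^sup>2 = exp (- A)" by (simp add: power2_eq_square exp_add[symmetric])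
        moreover have "(A * s) powr (-b) = A powr (-b) * s powr (-b)" using A s by (simp add: powr_mult)
        moreover have "(1/2 * s) powr (-b) = 2 powr b * s powr (-b)" using s
          by (simp only: powr_mult powr_minus_divide powr_divide) (simp add: powr_divide)
        ultimately show ?thesis unfolding outside_const_def by (simp add: algebra_simps)
      qed
      finally show "(\<Sum>k\<in>{1..n} - block A s. (real k powr (-s))\<^sup>2 * moment2 k) \<le> outside_const A * D * s powr (-b)" by simp
    qed
  qed
qed

definition block_sum :: "real \<Rightarrow> real \<Rightarrow> 'a \<Rightarrow> real" where "block_sum A s \<omega> = (\<Sum>k\<in>block A s. real k powr (-s) * Y k \<omega>)"

lemma block_sum_measurable[measurable]: "block_sum A s \<in> borel_measurable M"
  unfolding block_sum_def by (intro borel_measurable_sum) (auto simp: block_def)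

text \<open>With v the variance of the block, the tilt is chosen so that l^2 v = 2 (1 - 4 e)
  \<open>llog s\<close>. Then \<open>lower_tail\<close> has exponent (1/2 + 2 e) 2 (1 - 4 e) = 1 -
  16 e^2 times \<open>llog s\<close>, just below the border of summability. Of the variance, one e
  is lost to the asymptotics and one to the complement of the block, hence 1 - 2 e in the
  level.\<close>

lemma lower_block:
  assumes e: "0 < e" "e < 1/4" and A: "A > 0" and outside_const: "outside_const A \<le> e"
  shows "\<forall>\<^sub>F s in at_right 0. exp (- (1 - 16 * e\<^sup>2) * llog s) / 2 \<le>
     prob {\<omega>\<in>space M. block_sum A s \<omega> \<ge> (1 - e) * sqrt (2 * (1 - 4*e) * (1 - 2*e) * D) * lil_scale b s}"
proof -
  \<comment> \<open>Comes from the lower bound for v: l \<le> c s^(b/2) sqrt (llog s). Below it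
    appears doubled because \<open>lower_tail\<close> needs moment generating functions up to 2
    l.\<close>
  define c where "c = sqrt (2 * (1 - 4*e) / ((1 - 2*e) * D))"
  define d where "d = e\<^sup>2 / 16"
  have d: "0 < d" "d \<le> 1" using e power_mono[of e 1 2] by (auto simp: d_def)
  have "((\<lambda>s. exp (- (5 * e\<^sup>2 / 16) * (2 * (1 - 4*e) * ln (ln (1/s))))) \<longlongrightarrow> 0) (at_right 0)"
  proof -
    have "filterlim (\<lambda>s. (5 * e\<^sup>2 / 16) * (2 * (1 - 4*e)) * ln (ln (1/s))) at_top (at_right (0::real))"
    proof (rule filterlim_tendsto_pos_mult_at_top[OF tendsto_const])
      show "0 < (5 * e\<^sup>2 / 16) * (2 * (1 - 4*e))" using e by simp
      show "filterlim (\<lambda>s. ln (ln (1/s))) at_top (at_right (0::real))" by real_asymp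
    qed
    from filterlim_compose[OF exp_at_bot filterlim_compose[OF filterlim_uminus_at_bot_at_top this]]
    show ?thesis by (simp add: mult.assoc)
  qed
  hence "\<forall>\<^sub>F s in at_right 0. exp (- (5 * e\<^sup>2 / 16) * (2 * (1 - 4*e) * ln (ln (1/s)))) < 1/4"
    by (rule order_tendstoD) simp
  moreover have "\<forall>\<^sub>F s in at_right 0. err ((2 * c) * s powr (b/2) * sqrt (llog s)) s \<le> d" by (rule err_small[OF d(1)])
  ultimately show ?thesis using small_eventually variance_eventually(2)[OF e(1)] outside_block[OF A]
  proof eventually_elim
    case (elim s)
    hence s: "0 < s" "s < exp (- exp 1)" "s < s0" by auto
    have llog: "llog s > 1" using iterated_ln_small[OF s(1,2)] by simp
    define v where "v = (\<Sum>k\<in>block A s. (real k powr (-s))\<^sup>2 * moment2 k)"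
    have vlow: "(1 - 2*e) * D * s powr (-b) \<le> v"
    proof -
      have "(\<lambda>n. \<Sum>k=1..n. (real k powr (-s))\<^sup>2 * moment2 k) \<longlonglongrightarrow> dsum moment2 (2 * s)"
      proof -
        have sq: "(real k powr (-s))\<^sup>2 = real k powr (- (2 * s))" for k by (simp add: power2_eq_square powr_add[symmetric])
        have "summable (\<lambda>k. moment2 (Suc k) * real (Suc k) powr (-(2 * s)))" using var_summable[of "2 * s"] s by (simp add: moment2_def)
        from summable_LIMSEQ[OF this] show ?thesis unfolding sq
          using sum.atLeast1_atMost_eq[of "\<lambda>k. moment2 k * real k powr (-(2 * s))"] by (simp add: dsum_def mult.commute)
      qed
      moreover have "(\<Sum>k=1..n. (real k powr (-s))\<^sup>2 * moment2 k) \<le> v + e * D * s powr (-b)" for n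
      proof -
        have "(\<Sum>k=1..n. (real k powr (-s))\<^sup>2 * moment2 k) = (\<Sum>k\<in>{1..n} \<inter> block A s. (real k powr (-s))\<^sup>2 * moment2 k) + (\<Sum>k\<in>{1..n} - block A s. (real k powr (-s))\<^sup>2 * moment2 k)"
          by (subst sum.union_disjoint[symmetric]) (auto intro!: sum.cong)
        also have "(\<Sum>k\<in>{1..n} \<inter> block A s. (real k powr (-s))\<^sup>2 * moment2 k) \<le> v"
          unfolding v_def by (intro sum_mono2 finite_block) (auto intro: mult_nonneg_nonneg moment2_nonneg)
        also have "(\<Sum>k\<in>{1..n} - block A s. (real k powr (-s))\<^sup>2 * moment2 k) \<le> outside_const A * D * s powr (-b)" using elim by blast
        also have "outside_const A * D * s powr (-b) \<le> e * D * s powr (-b)" using outside_const D by (intro mult_right_mono) auto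
        finally show ?thesis by simp
      qed
      ultimately have "dsum moment2 (2 * s) \<le> v + e * D * s powr (-b)" by (intro LIMSEQ_le_const2) auto
      thus ?thesis using elim by (simp add: algebra_simps)
    qed
    have Dp: "(1 - 2*e) * D * s powr (-b) > 0" using e D s by simp
    have v: "v > 0" using vlow Dp by linarith
    define q where "q = 2 * (1 - 4*e) * llog s"
    have q: "q > 0" using e llog by (simp add: q_def)
    define l where "l = sqrt (q / v)"
    have l: "l > 0" using q v by (simp add: l_def)
    have lv: "l\<^sup>2 * v = q" using q v by (simp add: l_def)
    have lle: "l \<le> c * s powr (b/2) * sqrt (llog s)"
    proof -
      have "l \<le> sqrt (q / ((1 - 2*e) * D * s powr (-b)))"
        unfolding l_def using vlow Dp q by (intro real_sqrt_le_mono divide_left_mono) auto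
      also have "q / ((1 - 2*e) * D * s powr (-b)) = (2 * (1 - 4*e) / ((1 - 2*e) * D)) * s powr b * llog s"
        using s by (simp add: q_def powr_minus_divide)
      also have "sqrt \<dots> = c * sqrt (s powr b) * sqrt (llog s)" by (simp only: real_sqrt_mult c_def)
      also have "sqrt (s powr b) = s powr (b/2)" using s powr_half_sqrt_powr[of s b] by simp
      finally show ?thesis .
    qed
    have errm: "err m s \<le> d" if "m \<le> 2 * l" for m
    proof -
      have "exp 1 < ln (1/s)" by (rule iterated_ln_small[OF s(1,2)])
      hence "ln (1/s) > 0" by (rule less_trans[OF exp_gt_zero])
      hence "C0 * s powr (-b/2) / ln (1/s) \<ge> 0" using C0 by simp
      hence "err m s \<le> err ((2 * c) * s powr (b/2) * sqrt (llog s)) s"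
        unfolding err_def using that lle by (intro mult_right_mono) auto
      thus ?thesis using elim by simp
    qed
    have sub: "block A s \<subseteq> {1..}" by (auto simp: block_def)
    note m = mgf_core[OF finite_block sub s(1,3), where w="\<lambda>k. real k powr (-s)" and d=d, folded v_def block_sum_def]
    have "exp (- (1/2 + 2 * e) * (l\<^sup>2 * v)) / 2 \<le> prob {\<omega>\<in>space M. block_sum A s \<omega> \<ge> l * v * (1 - e)}"
    proof (rule lower_tail[where d=d])
      show "exp (- (5 * e\<^sup>2 / 16) * (l\<^sup>2 * v)) \<le> 1 / 4" using elim unfolding lv q_def llog_def by simp
    qed (use l v e d errm m in \<open>auto simp: d_def\<close>)
    also have "- (1/2 + 2 * e) * (l\<^sup>2 * v) = - (1 - 16 * e\<^sup>2) * llog s"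
      unfolding lv q_def by (simp add: algebra_simps power2_eq_square)
    also have "prob {\<omega>\<in>space M. block_sum A s \<omega> \<ge> l * v * (1 - e)} \<le>
      prob {\<omega>\<in>space M. block_sum A s \<omega> \<ge> (1 - e) * sqrt (2 * (1 - 4*e) * (1 - 2*e) * D) * lil_scale b s}"
    proof -
      have "sqrt (2 * (1 - 4*e) * (1 - 2*e) * D) * lil_scale b s = sqrt ((2 * (1 - 4*e) * (1 - 2*e) * D) * s powr (-b) * llog s)"
        using powr_half_sqrt_powr[of s "-b"] s by (simp add: real_sqrt_mult lil_scale_def)
      also have "(2 * (1 - 4*e) * (1 - 2*e) * D) * s powr (-b) * llog s = q * ((1 - 2*e) * D * s powr (-b))" by (simp add: q_def)
      also have "sqrt (q * ((1 - 2*e) * D * s powr (-b))) \<le> sqrt (q * v)"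
        using vlow q by (intro real_sqrt_le_mono mult_left_mono) auto
      also have "q * v = (l * v)\<^sup>2" using lv by (simp add: power2_eq_square)
      also have "sqrt ((l * v)\<^sup>2) = l * v" using l v by simp
      finally have "(1 - e) * (sqrt (2 * (1 - 4*e) * (1 - 2*e) * D) * lil_scale b s) \<le> (1 - e) * (l * v)"
        using e by (intro mult_left_mono) auto
      thus ?thesis by (intro finite_measure_mono) (auto simp: mult_ac)
    qed
    finally show ?case .
  qed
qed

lemma outside_const_tendsto: "(outside_const \<longlongrightarrow> 0) at_top"
  unfolding outside_const_def using b by real_asymp

text \<open>The ratio 1 / A^2 is chosen so that the upper end A / s of one window of logarithms is
  the lower end 1 / (A s') of the next. As the windows are half-open, they do not meet.\<close>

lemma block_disjoint:
  assumes A: "A > 1" and ij: "i < j"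
  shows "block A ((1 / A\<^sup>2) ^ i) \<inter> block A ((1 / A\<^sup>2) ^ j) = {}"
proof -
  have "A / (1 / A\<^sup>2) ^ i \<le> 1 / (A * (1 / A\<^sup>2) ^ j)"
  proof -
    have "A * (A * (A\<^sup>2) ^ i) = (A\<^sup>2) ^ Suc i" by (simp add: power2_eq_square)
    also have "\<dots> \<le> (A\<^sup>2) ^ j" using A ij power2_le_imp_le by (intro power_increasing) auto
    finally show ?thesis using A by (simp add: power_one_over field_simps)
  qed
  thus ?thesis by (auto simp: block_def)
qed

lemma block_sum_indep:
  assumes A: "A > 1"
  shows "indep_vars (\<lambda>_. borel) (\<lambda>j. block_sum A ((1 / A\<^sup>2) ^ j)) UNIV"
proof -
  let ?B = "\<lambda>j::nat. block A ((1 / A\<^sup>2) ^ j)"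
  have "disjoint_family_on ?B UNIV"
    unfolding disjoint_family_on_def using block_disjoint[OF A] by (metis Int_commute linorder_neqE_nat)
  hence "indep_vars (\<lambda>j. PiM (?B j) (\<lambda>_. borel)) (\<lambda>j \<omega>. restrict (\<lambda>k. Y k \<omega>) (?B j)) UNIV"
    by (intro indep_vars_restrict[OF ind]) (auto simp: block_def)
  hence "indep_vars (\<lambda>_. borel) (\<lambda>j \<omega>. (\<lambda>f. \<Sum>k\<in>?B j. real k powr (-((1 / A\<^sup>2) ^ j)) * f k) (restrict (\<lambda>k. Y k \<omega>) (?B j))) UNIV"
    by (rule indep_vars_compose2) auto
  thus ?thesis by (simp add: block_sum_def[abs_def])
qed

text \<open>Infinitely many blocks are large by independence, and the difference between block and
  full series is eventually at most 2 sqrt (2 e D) \<open>lil_scale\<close>, because its relative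
  variance is at most e. \<open>A\<close> is taken large after e has been fixed.\<close>

lemma lower_fixed:
  assumes e: "0 < e" "e < 1/4"
  shows "AE \<omega> in M. \<exists>\<^sub>F s in at_right 0.
     X s \<omega> \<ge> ((1 - e) * sqrt (2 * (1 - 4*e) * (1 - 2*e) * D) - 2 * sqrt (2 * e * D)) * lil_scale b s"
proof -
  have "\<forall>\<^sub>F A in at_top. outside_const A < e" using outside_const_tendsto e by (intro order_tendstoD) auto
  from eventually_happens[OF eventually_conj[OF this eventually_gt_at_top[of 1]]]
  obtain A where A': "outside_const A < e" "A > 1" by auto
  hence A: "outside_const A \<le> e" "A > 1" by auto
  have A0: "A > 0" using A by simp
  define r where "r = 1 / A\<^sup>2"
  have r: "0 < r" "r < 1" using A by (auto simp: r_def power_gt1 one_less_power)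
  define c1 where "c1 = (1 - e) * sqrt (2 * (1 - 4*e) * (1 - 2*e) * D)"
  have i: "indep_vars (\<lambda>_. borel) (\<lambda>j. block_sum A (r ^ j)) UNIV" unfolding r_def by (rule block_sum_indep[OF A(2)])
  have e16: "16 * e\<^sup>2 < 1" using e power_strict_mono[of e "1/4" 2] by (simp add: power2_eq_square)
  have ns: "\<not> summable (\<lambda>j. prob {\<omega>\<in>space M. block_sum A (r ^ j) \<omega> \<ge> c1 * lil_scale b (r ^ j)})"
  proof
    assume sm: "summable (\<lambda>j. prob {\<omega>\<in>space M. block_sum A (r ^ j) \<omega> \<ge> c1 * lil_scale b (r ^ j)})"
    define c where "c = ln (1/r)"
    have c: "c > 0" using r by (simp add: c_def)
    define C where "C = c powr (-(1 - 16 * e\<^sup>2)) / 2"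
    have "\<forall>\<^sub>F j in sequentially. exp (- (1 - 16 * e\<^sup>2) * llog (r ^ j)) / 2 \<le> prob {\<omega>\<in>space M. block_sum A (r ^ j) \<omega> \<ge> c1 * lil_scale b (r ^ j)}"
      unfolding c1_def using A e by (intro eventually_compose_filterlim[OF lower_block grid_tendsto[OF r]]) auto
    hence "\<forall>\<^sub>F j in sequentially. norm (C * real j powr (-(1 - 16 * e\<^sup>2))) \<le> prob {\<omega>\<in>space M. block_sum A (r ^ j) \<omega> \<ge> c1 * lil_scale b (r ^ j)}"
      using eventually_ge_at_top[of 1]
    proof eventually_elim
      case (elim j)
      have "exp (- (1 - 16 * e\<^sup>2) * llog (r ^ j)) = (real j * c) powr (-(1 - 16 * e\<^sup>2))"
        using elim r c unfolding llog_grid[OF r elim(2)] c_def[symmetric] by (simp add: powr_def)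
      also have "\<dots> = c powr (-(1 - 16 * e\<^sup>2)) * real j powr (-(1 - 16 * e\<^sup>2))" using c elim by (simp add: powr_mult)
      finally show ?case using elim by (simp add: C_def)
    qed
    hence "summable (\<lambda>j. C * real j powr (-(1 - 16 * e\<^sup>2)))" by (rule summable_comparison_test_ev[OF _ sm])
    moreover have "C \<noteq> 0" using c by (simp add: C_def)
    ultimately have "summable (\<lambda>j. real j powr (-(1 - 16 * e\<^sup>2)))" by (simp add: summable_cmult_iff)
    thus False using e by (simp add: summable_real_powr_iff)
  qed
  define E where "E s = {\<omega>\<in>space M. block_sum A s \<omega> - X s \<omega> > (1+1) * sqrt (2 * e * D) * lil_scale b s}" for s
  \<comment> \<open>Precision is irrelevant for the complement, so the Chernoff bound is used with e
    = 1; the small quantity is th.\<close>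
  have "\<forall>\<^sub>F s in at_right 0. prob (E s) \<le> 1 * exp (- (1+1) * llog s)"
    using chernoff_core[OF zero_less_one e(1)] small_eventually outside_block[OF A0]
  proof eventually_elim
    case (elim s)
    hence s: "s > 0" by simp
    define w where "w k = (if k \<in> block A s then 0 else - (real k powr (-s)))" for k
    have "prob (E s) \<le> exp (- (1+1) * llog s)"
      unfolding E_def
    proof (rule elim(1)[rule_format, of w "\<lambda>\<omega>. block_sum A s \<omega> - X s \<omega>"])
      show "\<bar>w k\<bar> \<le> real k powr (-s)" for k by (simp add: w_def)
      show "(\<Sum>k=1..n. (w k)\<^sup>2 * moment2 k) \<le> e * D * s powr (-b)" for n
      proof -
        have "(\<Sum>k=1..n. (w k)\<^sup>2 * moment2 k) = (\<Sum>k\<in>{1..n} - block A s. (real k powr (-s))\<^sup>2 * moment2 k)"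
          by (rule sum.mono_neutral_cong_right) (auto simp: w_def)
        also have "\<dots> \<le> outside_const A * D * s powr (-b)" using elim by blast
        also have "\<dots> \<le> e * D * s powr (-b)" using A D by (intro mult_right_mono) auto
        finally show ?thesis .
      qed
      show "AE \<omega> in M. (\<lambda>n. \<Sum>k=1..n. w k * Y k \<omega>) \<longlonglongrightarrow> block_sum A s \<omega> - X s \<omega>"
        using X_lim
      proof eventually_elim
        case (elim \<omega>)
        obtain n0 where n0: "block A s \<subseteq> {..n0}" using finite_block[of A s] finite_nat_iff_bounded_le by auto
        have "(\<Sum>k=1..n. w k * Y k \<omega>) = block_sum A s \<omega> - (\<Sum>k=1..n. real k powr (-s) * Y k \<omega>)" if n: "n \<ge> n0" for n
        proof -
          have "block_sum A s \<omega> = (\<Sum>k=1..n. if k \<in> block A s then real k powr (-s) * Y k \<omega> else 0)"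
            unfolding block_sum_def using n0 n by (intro sum.mono_neutral_cong_left) (auto simp: block_def)
          thus ?thesis by (simp add: sum_subtractf[symmetric] w_def) (intro sum.cong, auto)
        qed
        hence "\<forall>\<^sub>F n in sequentially. block_sum A s \<omega> - (\<Sum>k=1..n. real k powr (-s) * Y k \<omega>) = (\<Sum>k=1..n. w k * Y k \<omega>)"
          unfolding eventually_sequentially by (intro exI[of _ n0]) auto
        moreover have "(\<lambda>n. block_sum A s \<omega> - (\<Sum>k=1..n. real k powr (-s) * Y k \<omega>)) \<longlonglongrightarrow> block_sum A s \<omega> - X s \<omega>"
          using elim s by (intro tendsto_diff tendsto_const) auto
        ultimately show ?case by (rule Lim_transform_eventually[rotated])
      qed
    qed auto
    thus ?case by simp
  qed
  from summable_grid[OF r _ this] have "summable (\<lambda>j. prob (E (r^j)))" by simp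
  hence "AE \<omega> in M. \<forall>\<^sub>F j in sequentially. \<omega> \<in> space M - E (r^j)"
    by (intro borel_cantelli_AE1) (auto simp: E_def emeasure_eq_measure)
  with borel_cantelli_2[OF i ns] show ?thesis
  proof eventually_elim
    case (elim \<omega>)
    have "\<exists>\<^sub>F j in sequentially. X (r ^ j) \<omega> \<ge> (c1 - 2 * sqrt (2 * e * D)) * lil_scale b (r ^ j)"
      using frequently_eventually_conj[OF elim] by (rule frequently_elim1) (auto simp: E_def algebra_simps)
    thus ?case
      unfolding c1_def frequently_def using eventually_compose_filterlim[OF _ grid_tendsto[OF r]] by blast
  qed
qed

lemma lower_bound:
  "AE \<omega> in M. \<forall>e>0. \<exists>\<^sub>F s in at_right 0. X s \<omega> \<ge> (1 - e) * sqrt (2 * D) * lil_scale b s"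
proof -
  \<comment> \<open>The constant of \<open>lower_fixed\<close> at e = 1/m. From m = 5 on this e is
    below 1/4.\<close>
  define F where "F m = (1 - 1/m) * sqrt (2 * (1 - 4*(1/m)) * (1 - 2*(1/m)) * D) - 2 * sqrt (2 * (1/m) * D)" for m :: real
  have "AE \<omega> in M. \<forall>m::nat. m \<ge> 5 \<longrightarrow> (\<exists>\<^sub>F s in at_right 0. X s \<omega> \<ge> F (real m) * lil_scale b s)"
    unfolding AE_all_countable
  proof
    fix m :: nat
    show "AE \<omega> in M. m \<ge> 5 \<longrightarrow> (\<exists>\<^sub>F s in at_right 0. X s \<omega> \<ge> F (real m) * lil_scale b s)"
      using lower_fixed[of "1 / real m"] unfolding F_def by (cases "m \<ge> 5") auto
  qed
  thus ?thesis
  proof eventually_elim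
    case (elim \<omega>)
    show ?case
    proof (intro allI impI)
      fix e :: real assume e: "e > 0"
      have "((\<lambda>m. F (real m)) \<longlongrightarrow> (2 * D) powr (1/2)) sequentially" unfolding F_def using D by real_asymp
      hence "((\<lambda>m. F (real m)) \<longlongrightarrow> sqrt (2 * D)) sequentially" using D by (simp add: powr_half_sqrt)
      hence "\<forall>\<^sub>F m in sequentially. F (real m) > (1 - e) * sqrt (2 * D)"
        using e D by (intro order_tendstoD) auto
      from eventually_conj[OF this eventually_ge_at_top[of 5]] obtain m :: nat
        where m: "F (real m) > (1 - e) * sqrt (2 * D)" "m \<ge> 5" by (auto simp: eventually_sequentially)
      have "\<exists>\<^sub>F s in at_right 0. X s \<omega> \<ge> F (real m) * lil_scale b s" using elim m by blast
      from frequently_eventually_conj[OF this small_eventually]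
      show "\<exists>\<^sub>F s in at_right 0. X s \<omega> \<ge> (1 - e) * sqrt (2 * D) * lil_scale b s"
      proof (rule frequently_elim1)
        fix s assume *: "(0 < s \<and> s < exp (- exp 1) \<and> s < s0) \<and> X s \<omega> \<ge> F (real m) * lil_scale b s"
        hence "(1 - e) * sqrt (2 * D) * lil_scale b s \<le> F (real m) * lil_scale b s"
          using m iterated_ln_small(3)[of s b] by (intro mult_right_mono) auto
        thus "X s \<omega> \<ge> (1 - e) * sqrt (2 * D) * lil_scale b s" using * by auto
      qed
    qed
  qed
qed

end

section \<open>Variance and limit points\<close>

text \<open>A Cesaro argument: a finite initial error is negligible against a divergent sum. The
  hypothesis is multiplicative instead of a limit of y k / x k because x k may vanish for many
  k.\<close>

lemma partial_sums_ratio: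
  fixes x y :: "nat \<Rightarrow> real"
  assumes V: "(\<lambda>n. \<Sum>k=1..n. x k) \<sim>[at_top] g" and g: "filterlim g at_top at_top" and x: "\<And>k. x k \<ge> 0" and L: "L > 0"
    and y: "\<And>e. e > 0 \<Longrightarrow> \<forall>\<^sub>F k in at_top. \<bar>y k - L * x k\<bar> \<le> e * x k"
  shows "(\<lambda>n. \<Sum>k=1..n. y k) \<sim>[at_top] (\<lambda>n. L * g n)"
proof -
  define V where "V n = (\<Sum>k=1..n. x k)" for n
  have VG: "V \<sim>[at_top] g" using V by (simp add: V_def[abs_def])
  have Vinf: "filterlim V at_top at_top" using asymp_equiv_at_top_transfer[OF asymp_equiv_symI[OF VG] g] .
  have "(\<lambda>n. (\<Sum>k=1..n. y k) - L * V n) \<in> o[at_top](\<lambda>n. L * V n)"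
  proof (rule landau_o.smallI)
    fix e :: real assume e: "e > 0"
    from y[of "e * L / 2"] e L obtain n0 where n0: "\<And>k. k \<ge> n0 \<Longrightarrow> \<bar>y k - L * x k\<bar> \<le> e * L / 2 * x k"
      by (auto simp: eventually_sequentially)
    define A where "A = (\<Sum>k\<le>n0. \<bar>y k - L * x k\<bar>)"
    have bd: "\<bar>(\<Sum>k=1..n. y k) - L * V n\<bar> \<le> A + e * L / 2 * V n" for n
    proof -
      have "\<bar>(\<Sum>k=1..n. y k) - L * V n\<bar> = \<bar>\<Sum>k=1..n. y k - L * x k\<bar>"
        by (simp add: V_def sum_subtractf sum_distrib_left)
      also have "\<dots> \<le> (\<Sum>k=1..n. \<bar>y k - L * x k\<bar>)" by (rule sum_abs)
      also have "\<dots> \<le> (\<Sum>k=1..n. (if k \<le> n0 then \<bar>y k - L * x k\<bar> else 0) + e * L / 2 * x k)"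
        using n0 x e L by (intro sum_mono) (auto simp: not_le intro: less_imp_le)
      also have "\<dots> = (\<Sum>k=1..n. if k \<le> n0 then \<bar>y k - L * x k\<bar> else 0) + e * L / 2 * V n"
        by (simp add: sum.distrib V_def sum_distrib_left)
      also have "(\<Sum>k=1..n. if k \<le> n0 then \<bar>y k - L * x k\<bar> else 0) \<le> A"
        unfolding A_def by (subst sum.inter_filter[symmetric]) (auto intro!: sum_mono2)
      finally show ?thesis by simp
    qed
    have "\<forall>\<^sub>F n in at_top. V n \<ge> A / (e * L / 2)" using Vinf by (simp add: filterlim_at_top)
    thus "\<forall>\<^sub>F n in at_top. norm ((\<Sum>k=1..n. y k) - L * V n) \<le> e * norm (L * V n)"
    proof eventually_elim
      case (elim n)
      have "V n \<ge> 0" using x by (simp add: V_def sum_nonneg)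
      moreover have "A \<le> e * L / 2 * V n" using elim e L by (simp add: field_simps)
      ultimately show ?case using bd[of n] e L by (simp add: abs_mult mult.assoc)
    qed
  qed
  hence "(\<lambda>n. \<Sum>k=1..n. y k) \<sim>[at_top] (\<lambda>n. L * V n)" by (simp add: asymp_equiv_altdef)
  also have "(\<lambda>n. L * V n) \<sim>[at_top] (\<lambda>n. L * g n)" using VG by (intro asymp_equiv_mult) auto
  finally show ?thesis .
qed

section \<open>Variance of an almost surely convergent series\<close>

context prob_space
begin

lemma square_sum_indep:
  fixes Z :: "nat \<Rightarrow> 'a \<Rightarrow> real"
  assumes ind: "indep_vars (\<lambda>_. borel) Z UNIV" and sq: "\<And>k. integrable M (\<lambda>\<omega>. (Z k \<omega>)\<^sup>2)"
    and mean: "\<And>k. expectation (Z k) = 0" and F: "finite F"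
  shows "integrable M (\<lambda>\<omega>. (\<Sum>k\<in>F. Z k \<omega>)\<^sup>2) \<and> expectation (\<lambda>\<omega>. (\<Sum>k\<in>F. Z k \<omega>)\<^sup>2) = (\<Sum>k\<in>F. expectation (\<lambda>\<omega>. (Z k \<omega>)\<^sup>2))"
  using F
proof induction
  case (insert k F)
  have rv[measurable]: "Z k \<in> borel_measurable M" for k using ind by (auto simp: indep_vars_def)
  have iZ: "integrable M (Z k)" for k by (rule square_integrable_imp_integrable[OF rv sq])
  have iS: "integrable M (\<lambda>\<omega>. \<Sum>k\<in>F. Z k \<omega>)" using iZ by auto
  have iv: "indep_var borel (Z k) borel (\<lambda>\<omega>. \<Sum>k\<in>F. Z k \<omega>)"
    using insert by (intro indep_vars_sum indep_vars_subset[OF ind]) auto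
  note p = indep_var_integrable[OF iv iZ iS] indep_var_lebesgue_integral[OF iv iZ iS]
  have e: "(\<Sum>k\<in>insert k F. Z k \<omega>)\<^sup>2 = (Z k \<omega>)\<^sup>2 + 2 * (Z k \<omega> * (\<Sum>k\<in>F. Z k \<omega>)) + (\<Sum>k\<in>F. Z k \<omega>)\<^sup>2" for \<omega>
    using insert by (simp add: power2_eq_square algebra_simps)
  show ?case unfolding e using insert p sq mean by simp
qed simp

lemma expectation_square_le:
  fixes X :: "'a \<Rightarrow> real"
  assumes [measurable]: "X \<in> borel_measurable M" and i: "integrable M (\<lambda>\<omega>. (X \<omega>)\<^sup>2)"
  shows "(expectation X)\<^sup>2 \<le> expectation (\<lambda>\<omega>. (X \<omega>)\<^sup>2)"
  using variance_positive[of X] variance_eq[OF square_integrable_imp_integrable[OF assms] i] by simp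

text \<open>The series is known to converge only almost surely. Fatou's lemma for the differences of
  partial sums bounds the second moment of the tail by the tail of the variances, which upgrades
  this to convergence in mean square; mean and second moment then pass to the limit.\<close>

lemma variance_suminf:
  fixes Z :: "nat \<Rightarrow> 'a \<Rightarrow> real"
  assumes ind: "indep_vars (\<lambda>_. borel) Z UNIV" and sq: "\<And>k. integrable M (\<lambda>\<omega>. (Z k \<omega>)\<^sup>2)"
    and mean: "\<And>k. expectation (Z k) = 0" and conv: "AE \<omega> in M. summable (\<lambda>k. Z k \<omega>)"
    and sm: "summable (\<lambda>k. expectation (\<lambda>\<omega>. (Z k \<omega>)\<^sup>2))"
  shows "variance (\<lambda>\<omega>. \<Sum>k. Z k \<omega>) = (\<Sum>k. expectation (\<lambda>\<omega>. (Z k \<omega>)\<^sup>2))"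
proof -
  have rv[measurable]: "Z k \<in> borel_measurable M" for k using ind by (auto simp: indep_vars_def)
  define v where "v k = expectation (\<lambda>\<omega>. (Z k \<omega>)\<^sup>2)" for k
  define T where "T \<omega> = (\<Sum>k. Z k \<omega>)" for \<omega>
  define S where "S n \<omega> = (\<Sum>k<n. Z k \<omega>)" for n \<omega>
  define r where "r n = (\<Sum>k. v (k + n))" for n
  have smv: "summable v" using sm by (simp add: v_def[abs_def])
  have v0: "v k \<ge> 0" for k by (simp add: v_def)
  have r0: "r \<longlonglongrightarrow> 0" unfolding r_def by (rule suminf_exist_split2[OF smv])
  have rn: "r n \<ge> 0" for n unfolding r_def using v0 smv by (intro suminf_nonneg) (auto simp: summable_iff_shift)
  have [measurable]: "T \<in> borel_measurable M" "S n \<in> borel_measurable M" for n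
    unfolding T_def S_def by measurable
  have lim: "AE \<omega> in M. (\<lambda>n. S n \<omega>) \<longlonglongrightarrow> T \<omega>"
    using conv unfolding T_def S_def by eventually_elim (rule summable_LIMSEQ)
  have dS: "(S (m + n) \<omega> - S n \<omega>)\<^sup>2 = (\<Sum>k\<in>{n..<m+n}. Z k \<omega>)\<^sup>2" for m n \<omega>
  proof -
    have "{..<m+n} = {..<n} \<union> {n..<m+n}" by auto
    hence "S (m + n) \<omega> = S n \<omega> + (\<Sum>k\<in>{n..<m+n}. Z k \<omega>)"
      unfolding S_def by (simp only: sum.union_disjoint[of "{..<n}" "{n..<m+n}"] finite_lessThan finite_atLeastLessThan ivl_disj_int)
    thus ?thesis by simp
  qed
  have ES: "integrable M (\<lambda>\<omega>. (S (m + n) \<omega> - S n \<omega>)\<^sup>2) \<and> expectation (\<lambda>\<omega>. (S (m + n) \<omega> - S n \<omega>)\<^sup>2) \<le> r n" for m n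
  proof -
    have "(\<Sum>k\<in>{n..<m+n}. v k) = (\<Sum>k<m. v (k + n))"
      using sum.shift_bounds_nat_ivl[of v 0 n m] by (simp add: lessThan_atLeast0 add.commute)
    also have "\<dots> \<le> r n" unfolding r_def using v0 smv by (intro sum_le_suminf) (auto simp: summable_iff_shift)
    finally show ?thesis unfolding dS using square_sum_indep[OF ind sq mean, of "{n..<m+n}"] by (simp add: v_def)
  qed
  have nn: "(\<integral>\<^sup>+\<omega>. ennreal ((T \<omega> - S n \<omega>)\<^sup>2) \<partial>M) \<le> ennreal (r n)" for n
  proof -
    have "(\<integral>\<^sup>+\<omega>. ennreal ((T \<omega> - S n \<omega>)\<^sup>2) \<partial>M) = (\<integral>\<^sup>+\<omega>. liminf (\<lambda>m. ennreal ((S (m + n) \<omega> - S n \<omega>)\<^sup>2)) \<partial>M)"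
    proof (rule nn_integral_cong_AE, use lim in eventually_elim)
      case (elim \<omega>)
      have "(\<lambda>m. ennreal ((S (m + n) \<omega> - S n \<omega>)\<^sup>2)) \<longlonglongrightarrow> ennreal ((T \<omega> - S n \<omega>)\<^sup>2)"
        by (intro tendsto_ennrealI tendsto_power tendsto_diff tendsto_const LIMSEQ_ignore_initial_segment elim)
      thus ?case by (intro lim_imp_Liminf[symmetric]) auto
    qed
    also have "\<dots> \<le> liminf (\<lambda>m. \<integral>\<^sup>+\<omega>. ennreal ((S (m + n) \<omega> - S n \<omega>)\<^sup>2) \<partial>M)"
      by (rule nn_integral_liminf) auto
    also have "\<dots> \<le> limsup (\<lambda>m. \<integral>\<^sup>+\<omega>. ennreal ((S (m + n) \<omega> - S n \<omega>)\<^sup>2) \<partial>M)" by (rule Liminf_le_Limsup) auto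
    also have "\<dots> \<le> ennreal (r n)"
    proof (rule Limsup_bounded, intro always_eventually allI)
      fix m
      have "(\<integral>\<^sup>+\<omega>. ennreal ((S (m + n) \<omega> - S n \<omega>)\<^sup>2) \<partial>M) = ennreal (expectation (\<lambda>\<omega>. (S (m + n) \<omega> - S n \<omega>)\<^sup>2))"
        using ES by (intro nn_integral_eq_integral) auto
      also have "\<dots> \<le> ennreal (r n)" using ES rn by (intro ennreal_leI) auto
      finally show "(\<integral>\<^sup>+\<omega>. ennreal ((S (m + n) \<omega> - S n \<omega>)\<^sup>2) \<partial>M) \<le> ennreal (r n)" .
    qed
    finally show ?thesis .
  qed
  have iT: "integrable M (\<lambda>\<omega>. (T \<omega> - S n \<omega>)\<^sup>2)" for n
  proof (rule integrableI_bounded)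
    show "(\<integral>\<^sup>+\<omega>. ennreal (norm ((T \<omega> - S n \<omega>)\<^sup>2)) \<partial>M) < \<infinity>" using nn[of n] by (auto simp: less_top[symmetric] top_unique)
  qed auto
  have eT: "expectation (\<lambda>\<omega>. (T \<omega> - S n \<omega>)\<^sup>2) \<le> r n" for n
    using nn[of n] nn_integral_eq_integral[OF iT[of n]] rn[of n] by simp
  have S0: "S 0 \<omega> = 0" for \<omega> by (simp add: S_def)
  have iT2: "integrable M (\<lambda>\<omega>. (T \<omega>)\<^sup>2)" and eT2: "expectation (\<lambda>\<omega>. (T \<omega>)\<^sup>2) \<le> suminf v"
    using iT[of 0] eT[of 0] by (auto simp: S0 r_def)
  have iT1: "integrable M T" by (rule square_integrable_imp_integrable[OF _ iT2]) auto
  have iZ: "integrable M (Z k)" for k by (rule square_integrable_imp_integrable[OF rv sq])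
  have "(expectation T)\<^sup>2 \<le> r n" for n
  proof -
    have "expectation (\<lambda>\<omega>. T \<omega> - S n \<omega>) = expectation T" using iT1 iZ mean by (simp add: S_def)
    thus ?thesis using expectation_square_le[OF _ iT[of n]] eT[of n] by simp
  qed
  hence "(expectation T)\<^sup>2 \<le> 0" by (intro LIMSEQ_le_const[OF r0]) auto
  hence ET: "expectation T = 0" by simp
  \<comment> \<open>Fatou gives only an upper bound for the second moment of T. The converse splits
    S n into T and the tail, with a weight d that is sent to 0 after n has gone to infinity.\<close>
  have ge: "suminf v \<le> (1 + d) * expectation (\<lambda>\<omega>. (T \<omega>)\<^sup>2)" if d: "d > 0" for d
  proof -
    have "(\<Sum>k<n. v k) \<le> (1 + d) * expectation (\<lambda>\<omega>. (T \<omega>)\<^sup>2) + (1 + 1/d) * r n" for n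
    proof -
      have iSn: "integrable M (\<lambda>\<omega>. (S n \<omega>)\<^sup>2)" "expectation (\<lambda>\<omega>. (S n \<omega>)\<^sup>2) = (\<Sum>k<n. v k)"
        using square_sum_indep[OF ind sq mean, of "{..<n}"] by (auto simp: S_def v_def)
      have "expectation (\<lambda>\<omega>. (S n \<omega>)\<^sup>2) \<le> expectation (\<lambda>\<omega>. (1 + d) * (T \<omega>)\<^sup>2 + (1 + 1/d) * (T \<omega> - S n \<omega>)\<^sup>2)"
      proof (intro integral_mono iSn Bochner_Integration.integrable_add integrable_mult_right iT2 iT)
        fix \<omega>
        define x y where "x = T \<omega>" and "y = T \<omega> - S n \<omega>"
        \<comment> \<open>The square behind (x - y)^2 \<le> (1 + d) x^2 + (1 + 1/d) y^2.\<close>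
        have "0 \<le> (d * x + y)\<^sup>2 / d" using d by simp
        also have "\<dots> = (1 + d) * x\<^sup>2 + (1 + 1/d) * y\<^sup>2 - (x - y)\<^sup>2"
          using d by (simp add: power2_eq_square field_simps)
        finally show "(S n \<omega>)\<^sup>2 \<le> (1 + d) * (T \<omega>)\<^sup>2 + (1 + 1/d) * (T \<omega> - S n \<omega>)\<^sup>2"
          by (simp add: x_def y_def)
      qed
      also have "\<dots> = (1 + d) * expectation (\<lambda>\<omega>. (T \<omega>)\<^sup>2) + (1 + 1/d) * expectation (\<lambda>\<omega>. (T \<omega> - S n \<omega>)\<^sup>2)"
        using iT2 iT by simp
      also have "(1 + 1/d) * expectation (\<lambda>\<omega>. (T \<omega> - S n \<omega>)\<^sup>2) \<le> (1 + 1/d) * r n" using d eT by (intro mult_left_mono) auto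
      finally show ?thesis using iSn by simp
    qed
    moreover have "(\<lambda>n. (1 + d) * expectation (\<lambda>\<omega>. (T \<omega>)\<^sup>2) + (1 + 1/d) * r n) \<longlonglongrightarrow> (1 + d) * expectation (\<lambda>\<omega>. (T \<omega>)\<^sup>2) + (1 + 1/d) * 0"
      by (intro tendsto_intros r0)
    ultimately show ?thesis using LIMSEQ_le[OF summable_LIMSEQ[OF smv]] by fastforce
  qed
  have "((\<lambda>d. (1 + d) * expectation (\<lambda>\<omega>. (T \<omega>)\<^sup>2)) \<longlongrightarrow> (1 + 0) * expectation (\<lambda>\<omega>. (T \<omega>)\<^sup>2)) (at_right 0)"
    by (intro tendsto_intros)
  hence "suminf v \<le> (1 + 0) * expectation (\<lambda>\<omega>. (T \<omega>)\<^sup>2)"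
    by (rule tendsto_lowerbound) (use ge in \<open>auto simp: eventually_at_filter\<close>)
  hence "expectation (\<lambda>\<omega>. (T \<omega>)\<^sup>2) = suminf v" using eT2 by simp
  thus ?thesis using ET unfolding T_def[symmetric] v_def[symmetric] by simp
qed

end

context dirichlet_core
begin

lemma dirichlet_core_minus: "dirichlet_core M (\<lambda>k \<omega>. - Y k \<omega>) b D C0 s0"
proof unfold_locales
  show "indep_vars (\<lambda>_. borel) (\<lambda>k \<omega>. - Y k \<omega>) {1..}"
    using indep_vars_compose2[OF ind, of "\<lambda>_ y. - y" "\<lambda>_. borel"] by simp
  show "\<bar>- Y k \<omega>\<bar> * real k powr (-s) \<le> C0 * s powr (-b/2) / ln (1/s)"
    if "k \<ge> 1" "0 < s" "s < s0" "\<omega> \<in> space M" for k s \<omega> using bdd[OF that] by simp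
qed (use b D C0 s0 mean var var_summable in auto)

text \<open>The lower bound for the negated terms. \<open>path_AE\<close> enters because the sign
  may be moved through \<open>suminf\<close> only where the series converges.\<close>

lemma upper_frequent:
  "AE \<omega> in M. \<forall>e>0. \<exists>\<^sub>F s in at_right 0. X s \<omega> \<le> - ((1 - e) * sqrt (2 * D) * lil_scale b s)"
proof -
  interpret neg: dirichlet_core M "\<lambda>k \<omega>. - Y k \<omega>" b D C0 s0 by (rule dirichlet_core_minus)
  show ?thesis using neg.lower_bound path_AE
  proof eventually_elim
    case (elim \<omega>)
    have eq: "neg.X s \<omega> = - X s \<omega>" if "s > 0" for s
      using elim(2) that by (simp add: neg.X_def X_def dsum_def suminf_minus)
    show ?case
    proof (intro allI impI)
      fix e :: real assume "e > 0"
      hence "\<exists>\<^sub>F s in at_right 0. neg.X s \<omega> \<ge> (1 - e) * sqrt (2 * D) * lil_scale b s" using elim by blast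
      from frequently_eventually_conj[OF this small_eventually]
      show "\<exists>\<^sub>F s in at_right 0. X s \<omega> \<le> - ((1 - e) * sqrt (2 * D) * lil_scale b s)"
        by (rule frequently_elim1) (use eq in auto)
    qed
  qed
qed

end

text \<open>Arbitrarily close to 0, Q comes near both 1 and -1, and the image of an interval is
  connected, so every value between is attained. Continuity is asked of \<open>Q\<close>, which is
  normalized explicitly; W has the variance in its normalizer and is reached through the factor
  \<open>\<rho>\<close>.\<close>

lemma limit_points_interval:
  fixes Q W \<rho> :: "real \<Rightarrow> real"
  assumes cont: "continuous_on {0<..<d0} Q" and d0: "d0 > 0"
    and W: "\<forall>\<^sub>F s in at_right 0. W s = \<rho> s * Q s" and \<rho>: "(\<rho> \<longlongrightarrow> 1) (at_right 0)"
    and up: "\<And>e. e > 0 \<Longrightarrow> \<forall>\<^sub>F s in at_right 0. \<bar>Q s\<bar> \<le> 1 + e"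
    and lo: "\<And>e. e > 0 \<Longrightarrow> \<exists>\<^sub>F s in at_right 0. Q s \<ge> 1 - e" "\<And>e. e > 0 \<Longrightarrow> \<exists>\<^sub>F s in at_right 0. Q s \<le> - (1 - e)"
  shows "limit_points_at_right_0 W = {-1..1}"
    and "Limsup (at_right 0) (\<lambda>s. ereal (W s)) = 1"
    and "Liminf (at_right 0) (\<lambda>s. ereal (W s)) = -1"
proof -
  have Wup: "\<forall>\<^sub>F s in at_right 0. \<bar>W s\<bar> < 1 + e" if e: "e > 0" for e
  proof -
    have "((\<lambda>s. \<bar>\<rho> s\<bar> * (1 + e/2)) \<longlongrightarrow> \<bar>1\<bar> * (1 + e/2)) (at_right 0)" by (intro tendsto_intros \<rho>)
    hence "\<forall>\<^sub>F s in at_right 0. \<bar>\<rho> s\<bar> * (1 + e/2) < 1 + e" using e by (intro order_tendstoD) auto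
    with W up[of "e/2"] e show ?thesis
    proof -
      have "\<forall>\<^sub>F s in at_right 0. \<bar>Q s\<bar> \<le> 1 + e/2" using up[of "e/2"] e by simp
      with W \<open>\<forall>\<^sub>F s in at_right 0. \<bar>\<rho> s\<bar> * (1 + e/2) < 1 + e\<close> show ?thesis
      proof eventually_elim
        case (elim s)
        have "\<bar>W s\<bar> = \<bar>\<rho> s\<bar> * \<bar>Q s\<bar>" using elim by (simp add: abs_mult)
        also have "\<dots> \<le> \<bar>\<rho> s\<bar> * (1 + e/2)" using elim by (intro mult_left_mono) auto
        finally show ?case using elim by simp
      qed
    qed
  qed
  have sub: "limit_points_at_right_0 W \<subseteq> {-1..1}"
  proof
    fix y assume "y \<in> limit_points_at_right_0 W"
    then obtain s where s: "filterlim s (at_right 0) sequentially" "(\<lambda>n. W (s n)) \<longlonglongrightarrow> y" by (auto simp: limit_points_at_right_0_def)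
    have "\<bar>y\<bar> \<le> 1 + e" if e: "e > 0" for e
    proof (rule tendsto_upperbound[OF tendsto_rabs[OF s(2)]])
      show "\<forall>\<^sub>F n in sequentially. \<bar>W (s n)\<bar> \<le> 1 + e"
        using eventually_compose_filterlim[OF Wup[OF e] s(1)] by (auto elim: eventually_mono)
    qed auto
    hence "\<bar>y\<bar> \<le> 1" by (rule field_le_epsilon)
    thus "y \<in> {-1..1}" by auto
  qed
  have sup: "y \<in> limit_points_at_right_0 W" if y: "-1 \<le> y" "y \<le> 1" for y
  proof -
    have ex: "\<exists>s. 0 < s \<and> s < d \<and> \<bar>Q s - y\<bar> \<le> d" if d: "0 < d" "d \<le> 1" "d \<le> d0" for d
    proof -
      have ev: "\<forall>\<^sub>F s in at_right 0. s \<in> {0<..<d}" using d by (intro eventually_at_right_real)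
      have "\<exists>s1. Q s1 \<ge> 1 - d \<and> s1 \<in> {0<..<d}" "\<exists>s2. Q s2 \<le> - (1 - d) \<and> s2 \<in> {0<..<d}"
        using frequently_ex[OF frequently_eventually_conj[OF lo(1)[OF d(1)] ev]]
          frequently_ex[OF frequently_eventually_conj[OF lo(2)[OF d(1)] ev]] by auto
      then obtain s1 s2 where s: "Q s1 \<ge> 1 - d" "s1 \<in> {0<..<d}" "Q s2 \<le> - (1 - d)" "s2 \<in> {0<..<d}" by blast
      \<comment> \<open>Clamping y to the range that is surely attained moves it by at most d; this
        includes the endpoints 1 and -1.\<close>
      define y' where "y' = max (- (1 - d)) (min y (1 - d))"
      have y': "- (1 - d) \<le> y'" "y' \<le> 1 - d" "\<bar>y' - y\<bar> \<le> d" using y d by (auto simp: y'_def)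
      have "connected (Q ` {0<..<d})"
        by (intro connected_continuous_image continuous_on_subset[OF cont]) (use d in auto)
      moreover have "Q s2 \<in> Q ` {0<..<d}" "Q s1 \<in> Q ` {0<..<d}" using s by auto
      ultimately have "y' \<in> Q ` {0<..<d}" using s y' by (meson connectedD_interval order_trans)
      thus ?thesis using y' by auto
    qed
    define d where "d n = min (min 1 d0) (1 / real (Suc n))" for n
    have d: "0 < d n" "d n \<le> 1" "d n \<le> d0" "d n \<le> 1 / real (Suc n)" for n using d0 by (auto simp: d_def)
    obtain s where s: "\<And>n. 0 < s n \<and> s n < d n \<and> \<bar>Q (s n) - y\<bar> \<le> d n" using ex[OF d(1-3)] by metis
    have sd: "s n \<le> 1 / real (Suc n)" "\<bar>Q (s n) - y\<bar> \<le> 1 / real (Suc n)" for n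
      using s[of n] d(4)[of n] by linarith+
    have z: "(\<lambda>n. 1 / real (Suc n)) \<longlonglongrightarrow> 0" by real_asymp
    have "s \<longlonglongrightarrow> 0"
      by (rule tendsto_sandwich[OF _ _ tendsto_const z]) (use s sd(1) in \<open>auto intro!: always_eventually intro: less_imp_le\<close>)
    moreover have "0 < s n" "s n \<noteq> 0" for n using s[of n] by auto
    ultimately have fl: "filterlim s (at_right 0) sequentially" by (auto simp: filterlim_at)
    have "(\<lambda>n. Q (s n) - y) \<longlonglongrightarrow> 0"
      by (rule Lim_null_comparison[OF _ z]) (use sd(2) in \<open>auto intro!: always_eventually\<close>)
    hence "(\<lambda>n. Q (s n)) \<longlonglongrightarrow> y" by (simp add: LIM_zero_iff)
    moreover have "(\<lambda>n. \<rho> (s n)) \<longlonglongrightarrow> 1" by (rule filterlim_compose[OF \<rho> fl])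
    ultimately have "(\<lambda>n. \<rho> (s n) * Q (s n)) \<longlonglongrightarrow> 1 * y" by (intro tendsto_mult)
    moreover have "\<forall>\<^sub>F n in sequentially. \<rho> (s n) * Q (s n) = W (s n)"
      using eventually_compose_filterlim[OF W fl] by (auto elim: eventually_mono)
    ultimately have "(\<lambda>n. W (s n)) \<longlonglongrightarrow> y" using Lim_transform_eventually by fastforce
    thus ?thesis using fl by (auto simp: limit_points_at_right_0_def)
  qed
  show eq: "limit_points_at_right_0 W = {-1..1}" using sub sup by auto
  have fr: "\<exists>\<^sub>F s in at_right 0. P (W s)" if y: "y \<in> {-1..1}" and P: "open {x. P x}" "P y" for y P
  proof -
    have "y \<in> limit_points_at_right_0 W" using y eq by simp
    then obtain s where s: "filterlim s (at_right 0) sequentially" "(\<lambda>n. W (s n)) \<longlonglongrightarrow> y"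
      unfolding limit_points_at_right_0_def by blast
    have ev: "\<forall>\<^sub>F n in sequentially. W (s n) \<in> {x. P x}" by (rule topological_tendstoD[OF s(2) P(1)]) (use P in simp)
    show ?thesis
      unfolding frequently_def
    proof
      assume "\<forall>\<^sub>F s in at_right 0. \<not> P (W s)"
      from eventually_compose_filterlim[OF this s(1)] ev have "\<forall>\<^sub>F n in sequentially. False"
        by eventually_elim simp
      thus False by simp
    qed
  qed
  show "Limsup (at_right 0) (\<lambda>s. ereal (W s)) = 1"
  proof (rule antisym)
    show "Limsup (at_right 0) (\<lambda>s. ereal (W s)) \<le> 1"
      unfolding Limsup_le_iff
    proof (intro allI impI)
      fix y :: ereal assume "1 < y"
      thus "\<forall>\<^sub>F s in at_right 0. ereal (W s) < y"
      proof (cases y)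
        case (real r)
        hence "r - 1 > 0" using \<open>1 < y\<close> by simp
        from Wup[OF this] show ?thesis by eventually_elim (use real in auto)
      qed auto
    qed
    show "1 \<le> Limsup (at_right 0) (\<lambda>s. ereal (W s))"
    proof (rule ccontr)
      assume "\<not> 1 \<le> Limsup (at_right 0) (\<lambda>s. ereal (W s))"
      then obtain r where r: "Limsup (at_right 0) (\<lambda>s. ereal (W s)) < ereal r" "ereal r < 1"
        using ereal_dense2[of _ 1] by (auto simp: not_le)
      have ev: "\<forall>\<^sub>F s in at_right 0. ereal (W s) < ereal r" by (rule Limsup_lessD[OF r(1)])
      have "\<exists>\<^sub>F s in at_right 0. r < W s"
        using fr[of 1 "\<lambda>x. r < x"] r(2) by (simp add: greaterThan_def[symmetric])
      from frequently_ex[OF frequently_eventually_conj[OF this ev]] show False by auto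
    qed
  qed
  show "Liminf (at_right 0) (\<lambda>s. ereal (W s)) = -1"
  proof (rule antisym)
    show "-1 \<le> Liminf (at_right 0) (\<lambda>s. ereal (W s))"
      unfolding le_Liminf_iff
    proof (intro allI impI)
      fix y :: ereal assume "y < -1"
      thus "\<forall>\<^sub>F s in at_right 0. y < ereal (W s)"
      proof (cases y)
        case (real r)
        hence "-1 - r > 0" using \<open>y < -1\<close> by (simp add: one_ereal_def)
        from Wup[OF this] show ?thesis by eventually_elim (use real in auto)
      qed auto
    qed
    show "Liminf (at_right 0) (\<lambda>s. ereal (W s)) \<le> -1"
    proof (rule ccontr)
      assume "\<not> Liminf (at_right 0) (\<lambda>s. ereal (W s)) \<le> -1"
      then obtain r where r: "ereal r < Liminf (at_right 0) (\<lambda>s. ereal (W s))" "-1 < ereal r"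
        using ereal_dense2[of "-1"] by (auto simp: not_le)
      have ev: "\<forall>\<^sub>F s in at_right 0. ereal r < ereal (W s)" by (rule less_LiminfD[OF r(1)])
      have "\<exists>\<^sub>F s in at_right 0. W s < r"
        using fr[of "-1" "\<lambda>x. x < r"] r(2) by (simp add: lessThan_def[symmetric] one_ereal_def)
      from frequently_ex[OF frequently_eventually_conj[OF this ev]] show False by auto
    qed
  qed
qed

section \<open>Truncation\<close>

text \<open>exp (exp 1) lies between 15 and 16, so 16 is the first integer whose third iterated
  logarithm is positive. The estimate exp 17 < 2^25 gives ln 2 > 17/25 and hence ln 16 >
  2.72.\<close>

lemma ln_16_gt_e: "exp 1 < ln (16::real)"
proof -
  have "exp (17::real) = exp 1 ^ 17" by (simp add: exp_of_nat_mult[symmetric])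
  also have "\<dots> \<le> (272/100) ^ 17" using e_less_272 by (intro power_mono) auto
  also have "\<dots> < 2 ^ 25" by (simp add: power_divide)
  also have "\<dots> = exp (25 * ln 2)" using exp_of_nat_mult[of 25 "ln (2::real)"] by simp
  finally have "17 < 25 * ln (2::real)" by (simp only: exp_less_cancel_iff)
  moreover have "ln (16::real) = 4 * ln 2" using ln_realpow[of 2 4] by simp
  ultimately show ?thesis using e_less_272 by linarith
qed

lemma powr_exp_le:
  fixes p x :: real assumes p: "p > 0" and x: "x > 0"
  shows "x powr p * exp (- x) \<le> exp (p * ln p - p)"
proof -
  have "ln (x / p) \<le> x / p - 1" using p x by (intro ln_le_minus_one) auto
  hence "p * (ln x - ln p) \<le> p * (x / p - 1)" using p x by (intro mult_left_mono) (auto simp: ln_div)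
  hence "p * ln x - x \<le> p * ln p - p" using p by (simp add: algebra_simps)
  thus ?thesis using x by (simp add: powr_def exp_diff[symmetric] exp_minus field_simps)
qed

text \<open>Split at t = s^(-1/2). Above, ln t is at least half of ln (1/s) and (s t)^(b/2) exp (-s
  t) is bounded by its maximum. Below, t^(b/2) is at most s^(-b/4), and the other factor s^(-b/4)
  outgrows ln (1/s). The summands 2 P and 4 / b of the constant belong to these two cases.\<close>

lemma truncation_level_bound:
  fixes b :: real assumes b: "b > 0"
  shows "\<exists>C>0. \<forall>s t. 0 < s \<longrightarrow> s < 1 \<longrightarrow> t \<ge> exp 1 \<longrightarrow>
     t powr (b/2) / ln t * exp (- s * t) \<le> C * s powr (-b/2) / ln (1/s)"
proof -
  define P where "P = exp (b/2 * ln (b/2) - b/2)"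
  define C where "C = 2 * P + 4 / b"
  have P: "P > 0" by (simp add: P_def)
  have "t powr (b/2) / ln t * exp (- s * t) \<le> C * s powr (-b/2) / ln (1/s)" if s: "0 < s" "s < 1" and t: "t \<ge> exp 1" for s t
  proof -
    have t0: "t > 0" using less_le_trans[OF exp_gt_zero t] .
    have t1: "t > 1" using less_le_trans[OF _ t, of 1] by simp
    have lt: "ln t \<ge> 1" using t t0 by (simp add: ln_ge_iff)
    define L where "L = ln (1/s)"
    have L: "L > 0" using s by (simp add: L_def)
    have sp: "s powr (-b/2) > 0" using s by simp
    show ?thesis
    proof (cases "t \<ge> s powr (-1/2)")
      case True
      have "ln (s powr (-1/2)) \<le> ln t" using True s t0 by (subst ln_le_cancel_iff) auto
      hence lnt: "ln t \<ge> L / 2" using s by (simp add: L_def ln_div ln_powr)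
      have "t powr (b/2) * exp (- s * t) = s powr (-b/2) * ((s * t) powr (b/2) * exp (- (s * t)))"
        using s t0 by (simp add: powr_mult powr_minus field_simps)
      also have "\<dots> \<le> s powr (-b/2) * P"
        unfolding P_def using s t0 b by (intro mult_left_mono powr_exp_le) auto
      finally have "t powr (b/2) * exp (- s * t) / ln t \<le> s powr (-b/2) * P / (L/2)"
        using lnt L P sp by (intro frac_le) auto
      also have "\<dots> \<le> C * s powr (-b/2) / L"
        using L sp b by (simp add: C_def field_simps)
      finally show ?thesis by (simp add: L_def)
    next
      case False
      have "t powr (b/2) \<le> (s powr (-1/2)) powr (b/2)" using False t0 b by (intro powr_mono2) auto
      also have "\<dots> = s powr (-b/4)" by (simp add: powr_powr)
      finally have 1: "t powr (b/2) \<le> s powr (-b/4)" .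
      have "L \<le> (1/s) powr (b/4) / (b/4)" unfolding L_def using s b by (intro ln_powr_bound) auto
      also have "(1/s) powr (b/4) = s powr (-b/4)" using s by (simp add: powr_divide powr_minus_divide)
      finally have 2: "L \<le> 4 / b * s powr (-b/4)" using b by (simp add: field_simps)
      have "t powr (b/2) / ln t * exp (- s * t) \<le> t powr (b/2) / 1 * 1"
        using lt t0 t1 s by (intro mult_mono divide_left_mono) auto
      also have "\<dots> \<le> s powr (-b/4)" using 1 by simp
      also have "\<dots> \<le> (4 / b * s powr (-b/4)) / L * s powr (-b/4)"
      proof -
        have "1 \<le> (4 / b * s powr (-b/4)) / L" using 2 L by (simp only: pos_le_divide_eq mult_1_left)
        from mult_right_mono[OF this, of "s powr (-b/4)"] show ?thesis by simp
      qed
      also have "\<dots> = 4 / b * (s powr (-b/4) * s powr (-b/4)) / L" by simp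
      also have "s powr (-b/4) * s powr (-b/4) = s powr (-b/2)" by (simp add: powr_add[symmetric])
      also have "4 / b * s powr (-b/2) / L \<le> C * s powr (-b/2) / L"
        using L sp P by (intro divide_right_mono mult_right_mono) (auto simp: C_def)
      finally show ?thesis by (simp add: L_def)
    qed
  qed
  moreover have "C > 0" using P b by (auto simp: C_def intro!: add_pos_pos)
  ultimately show ?thesis by blast
qed

text \<open>The iterated logarithm does not feel constant factors, so v is first sandwiched between
  D/2 and 2 D times s^(-b) inside the logarithms; the sharp asymptotics are needed only for the
  factor v itself.\<close>

lemma normalizer_ratio:
  fixes v :: "real \<Rightarrow> real" and D b :: real
  assumes v: "v \<sim>[at_right 0] (\<lambda>s. D * s powr (-b))" and D: "D > 0" and b: "b > 0"
  shows "((\<lambda>s. sqrt (2 * D) * lil_scale b s / sqrt (2 * v s * ln (ln (v s)))) \<longlongrightarrow> 1) (at_right 0)"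
proof -
  have "(\<lambda>s. v s - D * s powr (-b)) \<in> o[at_right 0](\<lambda>s. D * s powr (-b))"
    using v by (simp add: asymp_equiv_altdef)
  from landau_o.smallD[OF this, of "1/2"]
  have ev: "\<forall>\<^sub>F s in at_right 0. \<bar>v s - D * s powr (-b)\<bar> \<le> 1/2 * (D * s powr (-b))"
    using D by (simp add: abs_mult)
  have pos: "\<forall>\<^sub>F s in at_right (0::real). 0 < s \<and> s < exp (- exp 1)"
    using eventually_at_right_real[of 0 "exp (- exp 1)"] by (auto elim: eventually_mono)
  have big: "\<forall>\<^sub>F s in at_right 0. D/2 * s powr (-b) > exp (exp 1)" using D b by real_asymp
  have l1: "((\<lambda>s. ln (ln (D/2 * s powr (-b))) / ln (ln (1/s))) \<longlongrightarrow> 1) (at_right 0)" using D b by real_asymp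
  have l2: "((\<lambda>s. ln (ln (2 * D * s powr (-b))) / ln (ln (1/s))) \<longlongrightarrow> 1) (at_right 0)" using D b by real_asymp
  have evs: "\<forall>\<^sub>F s in at_right 0. ln (ln (D/2 * s powr (-b))) \<le> ln (ln (v s)) \<and> ln (ln (v s)) \<le> ln (ln (2 * D * s powr (-b))) \<and> 1 < ln (ln (v s)) \<and> v s > 0 \<and> llog s > 1 \<and> s > 0"
    using ev pos big
  proof eventually_elim
    case (elim s)
    have s: "0 < s" "s < exp (- exp 1)" using elim by auto
    have 1: "D/2 * s powr (-b) \<le> v s" "v s \<le> 2 * D * s powr (-b)"
    proof -
      define w where "w = D * s powr (-b)"
      have "\<bar>v s - w\<bar> \<le> 1/2 * w" "w > 0" using elim(1) D s by (auto simp: w_def)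
      hence "w / 2 \<le> v s" "v s \<le> 2 * w" by linarith+
      thus "D/2 * s powr (-b) \<le> v s" "v s \<le> 2 * D * s powr (-b)" by (auto simp: w_def)
    qed
    define u where "u = D/2 * s powr (-b)"
    have u: "u > exp (exp 1)" using elim by (simp add: u_def)
    have u0: "u > 0" using u by (rule less_trans[OF exp_gt_zero])
    have lu: "ln u > exp 1" using u u0 by (metis exp_gt_zero ln_exp ln_less_cancel_iff)
    have lu0: "ln u > 0" using lu by (rule less_trans[OF exp_gt_zero])
    have llu: "ln (ln u) > 1" using lu lu0 by (metis exp_gt_zero ln_exp ln_less_cancel_iff)
    have a: "ln u \<le> ln (v s)" using 1(1) u0 by (subst ln_le_cancel_iff) (auto simp: u_def)
    have b': "ln (v s) \<le> ln (2 * D * s powr (-b))" using 1 u0 by (subst ln_le_cancel_iff) (auto simp: u_def)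
    have "ln (ln u) \<le> ln (ln (v s))" using a lu0 by (subst ln_le_cancel_iff) auto
    moreover have "ln (ln (v s)) \<le> ln (ln (2 * D * s powr (-b)))" using a b' lu0 by (subst ln_le_cancel_iff) auto
    moreover have "v s > 0" using 1 u0 by (simp add: u_def)
    ultimately show ?case using llu iterated_ln_small(2)[OF s] s by (simp add: u_def)
  qed
  have "((\<lambda>s. ln (ln (v s)) / ln (ln (1/s))) \<longlongrightarrow> 1) (at_right 0)"
  proof (rule tendsto_sandwich[OF _ _ l1 l2])
    show "\<forall>\<^sub>F s in at_right 0. ln (ln (D/2 * s powr (-b))) / ln (ln (1/s)) \<le> ln (ln (v s)) / ln (ln (1/s))"
      using evs by eventually_elim (auto simp: llog_def intro!: divide_right_mono)
    show "\<forall>\<^sub>F s in at_right 0. ln (ln (v s)) / ln (ln (1/s)) \<le> ln (ln (2 * D * s powr (-b))) / ln (ln (1/s))"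
      using evs by eventually_elim (auto simp: llog_def intro!: divide_right_mono)
  qed
  from tendsto_inverse[OF this] have r1: "((\<lambda>s. inverse (ln (ln (v s)) / ln (ln (1/s)))) \<longlongrightarrow> 1) (at_right 0)" by simp
  have "((\<lambda>s. v s / (D * s powr (-b))) \<longlongrightarrow> 1) (at_right 0)"
  proof (rule asymp_equivD_strong[OF v])
    show "\<forall>\<^sub>F s in at_right 0. v s \<noteq> 0 \<or> D * s powr (-b) \<noteq> 0" using evs by eventually_elim auto
  qed
  from tendsto_inverse[OF this] have r2: "((\<lambda>s. inverse (v s / (D * s powr (-b)))) \<longlongrightarrow> 1) (at_right 0)" by simp
  have "((\<lambda>s. sqrt (inverse (v s / (D * s powr (-b))) * inverse (ln (ln (v s)) / ln (ln (1/s))))) \<longlongrightarrow> sqrt (1 * 1)) (at_right 0)"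
    by (intro tendsto_intros r1 r2)
  moreover have "\<forall>\<^sub>F s in at_right 0. sqrt (inverse (v s / (D * s powr (-b))) * inverse (ln (ln (v s)) / ln (ln (1/s)))) =
     sqrt (2 * D) * lil_scale b s / sqrt (2 * v s * ln (ln (v s)))"
    using evs
  proof eventually_elim
    case (elim s)
    have "sqrt (2 * D) * lil_scale b s = sqrt (2 * D * s powr (-b) * llog s)"
      using powr_half_sqrt_powr[of s "-b"] elim by (simp add: real_sqrt_mult lil_scale_def)
    hence "sqrt (2 * D) * lil_scale b s / sqrt (2 * v s * ln (ln (v s))) = sqrt (2 * D * s powr (-b) * llog s / (2 * v s * ln (ln (v s))))"
      by (simp only: real_sqrt_divide)
    also have "2 * D * s powr (-b) * llog s / (2 * v s * ln (ln (v s))) = inverse (v s / (D * s powr (-b))) * inverse (ln (ln (v s)) / ln (ln (1/s)))"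
      using elim by (simp add: llog_def field_simps)
    finally show ?case by simp
  qed
  ultimately show ?thesis using Lim_transform_eventually by fastforce
qed

section \<open>Truncation of independent identically distributed terms\<close>

locale dirichlet_iid = M: prob_space M + N: prob_space N
  for M :: "'a measure" and N :: "'b measure" +
  fixes \<eta> :: "nat \<Rightarrow> 'a \<Rightarrow> real" and \<eta>\<^sub>0 :: "'b \<Rightarrow> real" and a :: "nat \<Rightarrow> real" and \<sigma> c \<beta> :: real
  assumes eta0[measurable]: "\<eta>\<^sub>0 \<in> borel_measurable N"
    and int1: "integrable N \<eta>\<^sub>0" and int2: "integrable N (\<lambda>\<omega>. (\<eta>\<^sub>0 \<omega>)\<^sup>2)"
    and mean0: "N.expectation \<eta>\<^sub>0 = 0" and sigma: "\<sigma> > 0" and var0: "N.variance \<eta>\<^sub>0 = \<sigma>\<^sup>2"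
    and ind: "M.indep_vars (\<lambda>_. borel) \<eta> {1..}"
    and dist: "\<And>k. k \<ge> 1 \<Longrightarrow> distr M borel (\<eta> k) = distr N borel \<eta>\<^sub>0"
    and c: "c > 0" and beta: "\<beta> > 0"
    and sums: "(\<lambda>n::nat. \<Sum>k=1..n. (a k)\<^sup>2 / real k) \<sim>[at_top] (\<lambda>n. c * ln (real n) powr \<beta>)"
    and gfin: "\<forall>\<^sub>F x in at_top. finite (growth_set a \<beta> x)"
    and gO: "(\<lambda>x::real. real (card (growth_set a \<beta> x))) \<in> O[at_top](\<lambda>x. x)"
begin

definition coeff :: "nat \<Rightarrow> real" where "coeff k = a k / sqrt (real k)"

lemma coeff_square: "(coeff k)\<^sup>2 = (a k)\<^sup>2 / real k" by (simp add: coeff_def power_divide)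

definition supp :: "nat set" where "supp = {k. k \<ge> 16 \<and> a k \<noteq> 0}"
text \<open>The quantity counted in the hypothesis. Multiplied by \<open>(coeff k)\<^sup>2\<close>
  it loses k and a k, and what remains is (ln k)^beta over iterated logarithms.\<close>

definition trunc_level :: "nat \<Rightarrow> real" where
  "trunc_level k = real k * ln (real k) powr \<beta> / ((a k)\<^sup>2 * (ln (ln (real k)))\<^sup>2 * ln (ln (ln (real k))))"

lemma growth_set_eq: "growth_set a \<beta> x = {k\<in>supp. trunc_level k \<le> x}"
  by (auto simp: growth_set_def supp_def trunc_level_def)

lemma N_var: "N.expectation (\<lambda>\<omega>. (\<eta>\<^sub>0 \<omega>)\<^sup>2) = \<sigma>\<^sup>2" using var0 mean0 by simp

lemma eta_measurable[measurable]: "k \<ge> 1 \<Longrightarrow> \<eta> k \<in> borel_measurable M"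
  using ind by (auto simp: M.indep_vars_def)

text \<open>Moments are computed for the generic variable \<open>\<eta>\<^sub>0\<close> on its own
  space and carried to each \<open>\<eta> k\<close> by equality of laws.\<close>

lemma transfer:
  fixes f :: "real \<Rightarrow> real"
  assumes k: "k \<ge> 1" and [measurable]: "f \<in> borel_measurable borel"
  shows "M.expectation (\<lambda>\<omega>. f (\<eta> k \<omega>)) = N.expectation (\<lambda>\<omega>. f (\<eta>\<^sub>0 \<omega>))"
    and "integrable M (\<lambda>\<omega>. f (\<eta> k \<omega>)) \<longleftrightarrow> integrable N (\<lambda>\<omega>. f (\<eta>\<^sub>0 \<omega>))"
proof -
  note [measurable] = eta_measurable[OF k]
  have "M.expectation (\<lambda>\<omega>. f (\<eta> k \<omega>)) = integral\<^sup>L (distr M borel (\<eta> k)) f" by (subst integral_distr) auto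
  also have "\<dots> = N.expectation (\<lambda>\<omega>. f (\<eta>\<^sub>0 \<omega>))" unfolding dist[OF k] by (subst integral_distr) auto
  finally show "M.expectation (\<lambda>\<omega>. f (\<eta> k \<omega>)) = N.expectation (\<lambda>\<omega>. f (\<eta>\<^sub>0 \<omega>))" .
  have "integrable M (\<lambda>\<omega>. f (\<eta> k \<omega>)) \<longleftrightarrow> integrable (distr M borel (\<eta> k)) f" by (subst integrable_distr_eq) auto
  also have "\<dots> \<longleftrightarrow> integrable N (\<lambda>\<omega>. f (\<eta>\<^sub>0 \<omega>))" unfolding dist[OF k] by (subst integrable_distr_eq) auto
  finally show "integrable M (\<lambda>\<omega>. f (\<eta> k \<omega>)) \<longleftrightarrow> integrable N (\<lambda>\<omega>. f (\<eta>\<^sub>0 \<omega>))" .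
qed

text \<open>\<open>card\<close> is 0 on infinite sets, so finiteness has to be secured apart from
  the growth bound. It is given for large x and passes to smaller x by inclusion; it also says that
  the levels tend to infinity along \<open>supp\<close>.\<close>

lemma finite_level: "finite {k\<in>supp. trunc_level k \<le> x}"
proof -
  obtain x0 where "\<And>x. x \<ge> x0 \<Longrightarrow> finite (growth_set a \<beta> x)" using gfin by (auto simp: eventually_at_top_linorder)
  hence "finite {k\<in>supp. trunc_level k \<le> max x x0}" unfolding growth_set_eq by auto
  thus ?thesis by (rule rev_finite_subset) auto
qed

lemma card_level: "\<exists>C\<ge>0. \<forall>x\<ge>0. real (card {k\<in>supp. trunc_level k \<le> x}) \<le> C * (x + 1)"
proof -
  from landau_o.bigE[OF gO] obtain C where C: "C > 0" "\<forall>\<^sub>F x in at_top. norm (real (card (growth_set a \<beta> x))) \<le> C * norm x" by blast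
  then obtain x0 where x0: "\<And>x. x \<ge> x0 \<Longrightarrow> real (card {k\<in>supp. trunc_level k \<le> x}) \<le> C * \<bar>x\<bar>"
    by (auto simp: eventually_at_top_linorder growth_set_eq)
  \<comment> \<open>Shifting the argument to x + \<bar>x0\<bar> makes the eventual bound valid for
    all x \<ge> 0; this is the origin of x + 1.\<close>
  have "real (card {k\<in>supp. trunc_level k \<le> x}) \<le> C * (1 + \<bar>x0\<bar>) * (x + 1)" if x: "x \<ge> 0" for x
  proof -
    have "card {k\<in>supp. trunc_level k \<le> x} \<le> card {k\<in>supp. trunc_level k \<le> x + \<bar>x0\<bar>}" by (intro card_mono finite_level) auto
    hence "real (card {k\<in>supp. trunc_level k \<le> x}) \<le> C * \<bar>x + \<bar>x0\<bar>\<bar>" using x0[of "x + \<bar>x0\<bar>"] x by linarith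
    also have "\<bar>x + \<bar>x0\<bar>\<bar> \<le> (1 + \<bar>x0\<bar>) * (x + 1)" using x by (simp add: algebra_simps)
    finally show ?thesis using C by (simp add: mult.assoc)
  qed
  thus ?thesis using C by (intro exI[of _ "C * (1 + \<bar>x0\<bar>)"]) auto
qed

definition exceed_prob :: "nat \<Rightarrow> real" where "exceed_prob k = N.expectation (\<lambda>\<omega>. of_bool (k \<in> supp \<and> trunc_level k < (\<eta>\<^sub>0 \<omega>)\<^sup>2))"

lemma exceed_prob_nonneg: "exceed_prob k \<ge> 0" by (simp add: exceed_prob_def)

lemma N_integrable_of_bool: "Measurable.pred N P \<Longrightarrow> integrable N (\<lambda>\<omega>. of_bool (P \<omega>) :: real)"
  by (rule N.integrable_bounded[of _ 1]) auto

text \<open>Exchange sum and expectation: the sum of the indicators counts the k whose level is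
  below \<open>\<eta>\<^sub>0\<close> squared, which by the counting hypothesis is at most C times
  that square plus 1, and the second moment is finite.\<close>

lemma exceed_prob_sum: "\<exists>B\<ge>0. \<forall>n. (\<Sum>k\<le>n. exceed_prob k) \<le> B"
proof -
  obtain C where C: "C \<ge> 0" "\<And>x. x \<ge> 0 \<Longrightarrow> real (card {k\<in>supp. trunc_level k \<le> x}) \<le> C * (x + 1)" using card_level by blast
  have "(\<Sum>k\<le>n. exceed_prob k) \<le> C * (\<sigma>\<^sup>2 + 1)" for n
  proof -
    have i: "integrable N (\<lambda>\<omega>. of_bool (k \<in> supp \<and> trunc_level k < (\<eta>\<^sub>0 \<omega>)\<^sup>2) :: real)" for k
      by (rule N_integrable_of_bool) measurable
    have "(\<Sum>k\<le>n. exceed_prob k) = N.expectation (\<lambda>\<omega>. \<Sum>k\<le>n. of_bool (k \<in> supp \<and> trunc_level k < (\<eta>\<^sub>0 \<omega>)\<^sup>2))"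
      unfolding exceed_prob_def using i by (subst Bochner_Integration.integral_sum) auto
    also have "\<dots> \<le> N.expectation (\<lambda>\<omega>. C * ((\<eta>\<^sub>0 \<omega>)\<^sup>2 + 1))"
    proof (intro integral_mono Bochner_Integration.integrable_sum i integrable_mult_right Bochner_Integration.integrable_add int2 N.integrable_const)
      fix \<omega>
      have "(\<Sum>k\<le>n. of_bool (k \<in> supp \<and> trunc_level k < (\<eta>\<^sub>0 \<omega>)\<^sup>2) :: real) = real (card {k\<in>{..n}. k \<in> supp \<and> trunc_level k < (\<eta>\<^sub>0 \<omega>)\<^sup>2})"
        by (simp add: of_bool_def sum.If_cases Int_def)
      also have "\<dots> \<le> real (card {k\<in>supp. trunc_level k \<le> (\<eta>\<^sub>0 \<omega>)\<^sup>2})"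
        by (intro of_nat_mono card_mono finite_level) auto
      also have "\<dots> \<le> C * ((\<eta>\<^sub>0 \<omega>)\<^sup>2 + 1)" by (intro C) auto
      finally show "(\<Sum>k\<le>n. of_bool (k \<in> supp \<and> trunc_level k < (\<eta>\<^sub>0 \<omega>)\<^sup>2)) \<le> C * ((\<eta>\<^sub>0 \<omega>)\<^sup>2 + 1)" .
    qed
    also have "\<dots> = C * (\<sigma>\<^sup>2 + 1)" using int2 N_var by (simp add: N.prob_space)
    finally show ?thesis .
  qed
  thus ?thesis using C by (intro exI[of _ "C * (\<sigma>\<^sup>2 + 1)"]) auto
qed

text \<open>The value 0 off \<open>supp\<close> also discards the indices below 16, where the
  iterated logarithms are not under control; they end up in the remainder.\<close>

definition trunc :: "nat \<Rightarrow> real \<Rightarrow> real" where "trunc k y = (if k \<in> supp \<and> y\<^sup>2 \<le> trunc_level k then y else 0)"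

lemma trunc_measurable[measurable]: "trunc k \<in> borel_measurable borel"
  unfolding trunc_def by measurable

definition trunc_mean :: "nat \<Rightarrow> real" where "trunc_mean k = N.expectation (\<lambda>\<omega>. trunc k (\<eta>\<^sub>0 \<omega>))"

definition trunc_term :: "nat \<Rightarrow> 'a \<Rightarrow> real" where "trunc_term k \<omega> = coeff k * (trunc k (\<eta> k \<omega>) - trunc_mean k)"

lemma iterated_ln_bounds: assumes "k \<ge> 16" shows "ln (real k) > exp 1" "ln (ln (real k)) > 1" "ln (ln (ln (real k))) \<ge> ln (ln (ln 16))" "ln (ln (ln 16)) > (0::real)"
proof -
  have e: "exp 1 > (1::real)" by simp
  have a: "ln (real k) \<ge> ln 16" using assms by (subst ln_le_cancel_iff) auto
  thus 1: "ln (real k) > exp 1" using ln_16_gt_e by linarith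
  have l16: "ln (ln (16::real)) > 1" using ln_16_gt_e less_trans[OF exp_gt_zero ln_16_gt_e] by (metis exp_gt_zero ln_exp ln_less_cancel_iff)
  have b: "ln (ln (real k)) \<ge> ln (ln 16)" using a less_trans[OF exp_gt_zero ln_16_gt_e] less_le_trans[OF less_trans[OF exp_gt_zero ln_16_gt_e] a]
    by (subst ln_le_cancel_iff) auto
  thus "ln (ln (real k)) > 1" using l16 by linarith
  show "ln (ln (ln (real k))) \<ge> ln (ln (ln 16))" using b l16 less_trans[OF e ln_16_gt_e] less_trans[OF e 1] by (subst ln_le_cancel_iff) auto
  show "ln (ln (ln 16)) > (0::real)" using l16 by (rule ln_gt_zero)
qed

lemma trunc_level_pos: "k \<in> supp \<Longrightarrow> trunc_level k > 0"
  using iterated_ln_bounds[of k] unfolding supp_def trunc_level_def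
  by (auto intro!: divide_pos_pos mult_pos_pos)

lemma trunc_abs: "\<bar>trunc k y\<bar> \<le> (if k \<in> supp then sqrt (trunc_level k) else 0)"
  unfolding trunc_def using trunc_level_pos[of k] by (auto simp: real_le_rsqrt)

lemma trunc_integrable: "integrable N (\<lambda>\<omega>. trunc k (\<eta>\<^sub>0 \<omega>))" "integrable N (\<lambda>\<omega>. (trunc k (\<eta>\<^sub>0 \<omega>))\<^sup>2)"
proof -
  show "integrable N (\<lambda>\<omega>. trunc k (\<eta>\<^sub>0 \<omega>))" using trunc_abs by (intro N.integrable_bounded) auto
  show "integrable N (\<lambda>\<omega>. (trunc k (\<eta>\<^sub>0 \<omega>))\<^sup>2)"
    by (rule Bochner_Integration.integrable_bound[OF int2]) (auto simp: trunc_def)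
qed

lemma trunc_mean_abs: "\<bar>trunc_mean k\<bar> \<le> (if k \<in> supp then sqrt (trunc_level k) else 0)"
proof -
  have "\<bar>trunc_mean k\<bar> \<le> N.expectation (\<lambda>\<omega>. \<bar>trunc k (\<eta>\<^sub>0 \<omega>)\<bar>)" unfolding trunc_mean_def by (rule integral_abs_bound)
  also have "\<dots> \<le> N.expectation (\<lambda>\<omega>. if k \<in> supp then sqrt (trunc_level k) else 0)"
    using trunc_abs trunc_integrable by (intro integral_mono) auto
  finally show ?thesis by (simp add: N.prob_space)
qed

lemma coeff_trunc_level:
  assumes k: "k \<in> supp"
  shows "\<bar>coeff k\<bar> * sqrt (trunc_level k) \<le> 1 / sqrt (ln (ln (ln 16))) * (ln (real k) powr (\<beta>/2) / ln (ln (real k)))"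
proof -
  have k16: "k \<ge> 16" "a k \<noteq> 0" using k by (auto simp: supp_def)
  note l = iterated_ln_bounds[OF k16(1)]
  have lp: "ln (real k) > 0" using l(1) by (rule less_trans[OF exp_gt_zero])
  have "\<bar>coeff k\<bar> * sqrt (trunc_level k) = sqrt ((coeff k)\<^sup>2 * trunc_level k)" by (simp add: real_sqrt_mult)
  also have "(coeff k)\<^sup>2 * trunc_level k = ln (real k) powr \<beta> / (ln (ln (real k)))\<^sup>2 / ln (ln (ln (real k)))"
    using k16 by (simp add: coeff_square trunc_level_def field_simps)
  also have "sqrt \<dots> = ln (real k) powr (\<beta>/2) / ln (ln (real k)) / sqrt (ln (ln (ln (real k))))"
    using l lp by (simp add: real_sqrt_divide real_sqrt_mult powr_half_sqrt_powr)
  also have "\<dots> \<le> ln (real k) powr (\<beta>/2) / ln (ln (real k)) / sqrt (ln (ln (ln 16)))"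
    using l lp less_trans[OF _ l(1), of 1] by (intro divide_left_mono divide_nonneg_pos mult_pos_pos) auto
  finally show ?thesis by (simp add: mult.commute)
qed

text \<open>\<open>truncation_level_bound\<close> at t = ln k, where k^(-s) = exp (-s t). The factor
  2 accounts for the centering.\<close>

lemma trunc_term_bound: "\<exists>C>0. \<forall>k\<ge>1. \<forall>s \<omega>. 0 < s \<longrightarrow> s < 1 \<longrightarrow> \<bar>trunc_term k \<omega>\<bar> * real k powr (-s) \<le> C * s powr (-\<beta>/2) / ln (1/s)"
proof -
  obtain C where C: "C > 0" "\<And>s t. 0 < s \<Longrightarrow> s < 1 \<Longrightarrow> t \<ge> exp 1 \<Longrightarrow>
     t powr (\<beta>/2) / ln t * exp (- s * t) \<le> C * s powr (-\<beta>/2) / ln (1/s)" using truncation_level_bound[OF beta] by blast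
  define c3 where "c3 = 1 / sqrt (ln (ln (ln (16::real))))"
  have c3: "c3 > 0" using iterated_ln_bounds(4)[of 16] by (simp add: c3_def)
  have "\<bar>trunc_term k \<omega>\<bar> * real k powr (-s) \<le> (2 * c3 * C) * s powr (-\<beta>/2) / ln (1/s)" if s: "0 < s" "s < 1" for k \<omega> s
  proof (cases "k \<in> supp")
    case True
    hence k: "k \<ge> 16" by (simp add: supp_def)
    have "\<bar>trunc k (\<eta> k \<omega>) - trunc_mean k\<bar> \<le> 2 * sqrt (trunc_level k)"
      using trunc_abs[of k "\<eta> k \<omega>"] trunc_mean_abs[of k] True by simp
    hence "\<bar>trunc_term k \<omega>\<bar> \<le> \<bar>coeff k\<bar> * (2 * sqrt (trunc_level k))" unfolding trunc_term_def abs_mult by (intro mult_left_mono) auto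
    also have "\<dots> \<le> 2 * (c3 * (ln (real k) powr (\<beta>/2) / ln (ln (real k))))"
      using coeff_trunc_level[OF True] by (simp add: c3_def)
    finally have "\<bar>trunc_term k \<omega>\<bar> * real k powr (-s) \<le> 2 * (c3 * (ln (real k) powr (\<beta>/2) / ln (ln (real k)))) * real k powr (-s)"
      by (intro mult_right_mono) auto
    also have "\<dots> = 2 * c3 * (ln (real k) powr (\<beta>/2) / ln (ln (real k)) * exp (- s * ln (real k)))"
      using k by (simp add: powr_def)
    also have "\<dots> \<le> 2 * c3 * (C * s powr (-\<beta>/2) / ln (1/s))"
      using c3 iterated_ln_bounds(1)[OF k] s by (intro mult_left_mono C(2)) auto
    finally show ?thesis by simp
  next
    case False
    have "trunc_mean k = 0" using trunc_mean_abs[of k] False by simp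
    moreover have "trunc k (\<eta> k \<omega>) = 0" using False by (simp add: trunc_def)
    ultimately show ?thesis using s c3 C by (simp add: trunc_term_def)
  qed
  thus ?thesis using c3 C by (intro exI[of _ "2 * c3 * C"]) auto
qed

lemma trunc_term_moments:
  assumes k: "k \<ge> 1"
  shows "M.expectation (trunc_term k) = 0"
    and "M.expectation (\<lambda>\<omega>. (trunc_term k \<omega>)\<^sup>2) = (coeff k)\<^sup>2 * (N.expectation (\<lambda>\<omega>. (trunc k (\<eta>\<^sub>0 \<omega>))\<^sup>2) - (trunc_mean k)\<^sup>2)"
proof -
  have "M.expectation (trunc_term k) = N.expectation (\<lambda>\<omega>. coeff k * (trunc k (\<eta>\<^sub>0 \<omega>) - trunc_mean k))"
    unfolding trunc_term_def[abs_def] by (rule transfer(1)[OF k, of "\<lambda>y. coeff k * (trunc k y - trunc_mean k)"]) measurable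
  also have "\<dots> = 0" using trunc_integrable[of k] by (simp add: N.prob_space trunc_mean_def)
  finally show "M.expectation (trunc_term k) = 0" .
  have "M.expectation (\<lambda>\<omega>. (trunc_term k \<omega>)\<^sup>2) = N.expectation (\<lambda>\<omega>. (coeff k * (trunc k (\<eta>\<^sub>0 \<omega>) - trunc_mean k))\<^sup>2)"
    unfolding trunc_term_def[abs_def] by (rule transfer(1)[OF k, of "\<lambda>y. (coeff k * (trunc k y - trunc_mean k))\<^sup>2"]) measurable
  also have "\<dots> = (coeff k)\<^sup>2 * N.variance (\<lambda>\<omega>. trunc k (\<eta>\<^sub>0 \<omega>))" by (simp add: power_mult_distrib trunc_mean_def)
  also have "\<dots> = (coeff k)\<^sup>2 * (N.expectation (\<lambda>\<omega>. (trunc k (\<eta>\<^sub>0 \<omega>))\<^sup>2) - (trunc_mean k)\<^sup>2)"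
    using N.variance_eq[OF trunc_integrable] by (simp add: trunc_mean_def)
  finally show "M.expectation (\<lambda>\<omega>. (trunc_term k \<omega>)\<^sup>2) = (coeff k)\<^sup>2 * (N.expectation (\<lambda>\<omega>. (trunc k (\<eta>\<^sub>0 \<omega>))\<^sup>2) - (trunc_mean k)\<^sup>2)" .
qed

lemma truncated_moments:
  "((\<lambda>x. N.expectation (\<lambda>\<omega>. (\<eta>\<^sub>0 \<omega>)\<^sup>2 * of_bool ((\<eta>\<^sub>0 \<omega>)\<^sup>2 \<le> x))) \<longlongrightarrow> \<sigma>\<^sup>2) at_top"
  "((\<lambda>x. N.expectation (\<lambda>\<omega>. \<eta>\<^sub>0 \<omega> * of_bool ((\<eta>\<^sub>0 \<omega>)\<^sup>2 \<le> x))) \<longlongrightarrow> 0) at_top"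
proof -
  have lim: "((\<lambda>x. f * of_bool (y \<le> x)) \<longlongrightarrow> f) at_top" for f y :: real
    by (rule tendsto_eventually) (use eventually_ge_at_top[of y] in \<open>eventually_elim, simp\<close>)
  have "((\<lambda>x. N.expectation (\<lambda>\<omega>. (\<eta>\<^sub>0 \<omega>)\<^sup>2 * of_bool ((\<eta>\<^sub>0 \<omega>)\<^sup>2 \<le> x))) \<longlongrightarrow> N.expectation (\<lambda>\<omega>. (\<eta>\<^sub>0 \<omega>)\<^sup>2)) at_top"
    by (rule integral_dominated_convergence_at_top[where w = "\<lambda>\<omega>. (\<eta>\<^sub>0 \<omega>)\<^sup>2"]) (use int2 lim in auto)
  thus "((\<lambda>x. N.expectation (\<lambda>\<omega>. (\<eta>\<^sub>0 \<omega>)\<^sup>2 * of_bool ((\<eta>\<^sub>0 \<omega>)\<^sup>2 \<le> x))) \<longlongrightarrow> \<sigma>\<^sup>2) at_top" by (simp add: N_var)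
  have "((\<lambda>x. N.expectation (\<lambda>\<omega>. \<eta>\<^sub>0 \<omega> * of_bool ((\<eta>\<^sub>0 \<omega>)\<^sup>2 \<le> x))) \<longlongrightarrow> N.expectation \<eta>\<^sub>0) at_top"
    by (rule integral_dominated_convergence_at_top[where w = "\<lambda>\<omega>. \<bar>\<eta>\<^sub>0 \<omega>\<bar>"]) (use int1 lim in auto)
  thus "((\<lambda>x. N.expectation (\<lambda>\<omega>. \<eta>\<^sub>0 \<omega> * of_bool ((\<eta>\<^sub>0 \<omega>)\<^sup>2 \<le> x))) \<longlongrightarrow> 0) at_top" by (simp add: mean0)
qed

lemma coeff_partial_sums: "(\<lambda>n. \<Sum>k=1..n. (coeff k)\<^sup>2) \<sim>[at_top] (\<lambda>n. c * ln (real n) powr \<beta>)"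
  using sums by (simp add: coeff_square)

text \<open>By \<open>finite_level\<close> the levels tend to infinity along \<open>supp\<close>, so
  the truncated variances tend to the full one by dominated convergence. For k \<ge> 16 off
  \<open>supp\<close> both sides vanish with \<open>coeff k\<close>.\<close>

lemma variance_partial_sums:
  "(\<lambda>n. \<Sum>k=1..n. M.expectation (\<lambda>\<omega>. (trunc_term k \<omega>)\<^sup>2)) \<sim>[at_top] (\<lambda>n. \<sigma>\<^sup>2 * (c * ln (real n) powr \<beta>))"
proof (rule partial_sums_ratio[OF coeff_partial_sums])
  show "filterlim (\<lambda>n. c * ln (real n) powr \<beta>) at_top at_top" using c beta by real_asymp
  fix e :: real assume e: "e > 0"
  define H where "H x = N.expectation (\<lambda>\<omega>. (\<eta>\<^sub>0 \<omega>)\<^sup>2 * of_bool ((\<eta>\<^sub>0 \<omega>)\<^sup>2 \<le> x)) - (N.expectation (\<lambda>\<omega>. \<eta>\<^sub>0 \<omega> * of_bool ((\<eta>\<^sub>0 \<omega>)\<^sup>2 \<le> x)))\<^sup>2" for x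
  have "(H \<longlongrightarrow> \<sigma>\<^sup>2 - 0\<^sup>2) at_top" unfolding H_def by (intro tendsto_intros truncated_moments)
  hence "(H \<longlongrightarrow> \<sigma>\<^sup>2) at_top" by simp
  from tendstoD[OF this e] obtain x1 where x1: "\<And>x. x \<ge> x1 \<Longrightarrow> \<bar>H x - \<sigma>\<^sup>2\<bar> < e"
    by (auto simp: eventually_at_top_linorder dist_real_def)
  obtain n1 where n1: "{k\<in>supp. trunc_level k \<le> x1} \<subseteq> {..n1}" using finite_level[of x1] finite_nat_iff_bounded_le by auto
  show "\<forall>\<^sub>F k in at_top. \<bar>M.expectation (\<lambda>\<omega>. (trunc_term k \<omega>)\<^sup>2) - \<sigma>\<^sup>2 * (coeff k)\<^sup>2\<bar> \<le> e * (coeff k)\<^sup>2"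
    using eventually_gt_at_top[of n1] eventually_ge_at_top[of 16]
  proof eventually_elim
    case (elim k)
    have "M.expectation (\<lambda>\<omega>. (trunc_term k \<omega>)\<^sup>2) = (coeff k)\<^sup>2 * (N.expectation (\<lambda>\<omega>. (trunc k (\<eta>\<^sub>0 \<omega>))\<^sup>2) - (trunc_mean k)\<^sup>2)"
      using elim by (intro trunc_term_moments) auto
    show ?case
    proof (cases "k \<in> supp")
      case True
      have "trunc_level k > x1" using n1 True elim by (auto simp: not_le[symmetric])
      moreover have "N.expectation (\<lambda>\<omega>. (trunc k (\<eta>\<^sub>0 \<omega>))\<^sup>2) - (trunc_mean k)\<^sup>2 = H (trunc_level k)"
      proof -
        have "(trunc k y)\<^sup>2 = y\<^sup>2 * of_bool (y\<^sup>2 \<le> trunc_level k)" "trunc k y = y * of_bool (y\<^sup>2 \<le> trunc_level k)" for y using True by (auto simp: trunc_def)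
        thus ?thesis unfolding H_def trunc_mean_def by simp
      qed
      ultimately have "\<bar>(N.expectation (\<lambda>\<omega>. (trunc k (\<eta>\<^sub>0 \<omega>))\<^sup>2) - (trunc_mean k)\<^sup>2) - \<sigma>\<^sup>2\<bar> \<le> e" using x1[of "trunc_level k"] by simp
      hence "(coeff k)\<^sup>2 * \<bar>(N.expectation (\<lambda>\<omega>. (trunc k (\<eta>\<^sub>0 \<omega>))\<^sup>2) - (trunc_mean k)\<^sup>2) - \<sigma>\<^sup>2\<bar> \<le> (coeff k)\<^sup>2 * e" by (intro mult_left_mono) auto
      moreover have "M.expectation (\<lambda>\<omega>. (trunc_term k \<omega>)\<^sup>2) - \<sigma>\<^sup>2 * (coeff k)\<^sup>2 = (coeff k)\<^sup>2 * ((N.expectation (\<lambda>\<omega>. (trunc k (\<eta>\<^sub>0 \<omega>))\<^sup>2) - (trunc_mean k)\<^sup>2) - \<sigma>\<^sup>2)"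
        using elim by (subst trunc_term_moments(2)) (auto simp: algebra_simps)
      ultimately show ?thesis by (simp add: abs_mult mult.commute)
    next
      case False
      hence "coeff k = 0" using elim by (simp add: supp_def coeff_def)
      thus ?thesis using elim by (simp add: trunc_term_moments(2))
    qed
  qed
qed (use sigma in auto)

text \<open>The power of 2 arises because the variance at s is a Dirichlet series at 2 s.\<close>

definition var_const :: real where "var_const = \<sigma>\<^sup>2 * c * Gamma (1 + \<beta>) / 2 powr \<beta>"

lemma var_const_pos: "var_const > 0"
  using sigma c beta unfolding var_const_def by (intro divide_pos_pos mult_pos_pos Gamma_real_pos) auto

lemma abelian_double:
  assumes "(\<lambda>n. \<Sum>k=1..n. z k) \<sim>[at_top] (\<lambda>n. \<sigma>\<^sup>2 * (c * ln (real n) powr \<beta>))"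
  shows "(\<lambda>s. dsum z (2 * s)) \<sim>[at_right 0] (\<lambda>s. var_const * s powr (-\<beta>))" "s > 0 \<Longrightarrow> summable (\<lambda>k. z (Suc k) * real (Suc k) powr (-s))"
proof -
  have A: "(\<lambda>n. \<Sum>k=1..n. z k) \<sim>[at_top] (\<lambda>n. (\<sigma>\<^sup>2 * c) * ln (real n) powr \<beta>)" using assms by (simp add: mult.assoc)
  have sc: "\<sigma>\<^sup>2 * c > 0" using sigma c by simp
  note ab = abelian_asymp[OF A sc beta]
  show "s > 0 \<Longrightarrow> summable (\<lambda>k. z (Suc k) * real (Suc k) powr (-s))" by (rule ab(2))
  have fl: "filterlim (\<lambda>s. 2 * s) (at_right 0) (at_right (0::real))" by real_asymp
  have "(\<lambda>s. dsum z (2 * s)) \<sim>[at_right 0] (\<lambda>s. (\<sigma>\<^sup>2 * c) * Gamma (1 + \<beta>) * (2 * s) powr (-\<beta>))"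
    by (rule asymp_equiv_compose'[OF ab(1) fl])
  also have "(\<lambda>s. (\<sigma>\<^sup>2 * c) * Gamma (1 + \<beta>) * (2 * s) powr (-\<beta>)) \<sim>[at_right 0] (\<lambda>s. var_const * s powr (-\<beta>))"
  proof (rule asymp_equiv_refl_ev)
    have "\<forall>\<^sub>F s in at_right (0::real). s > 0" by (simp add: eventually_at_filter)
    thus "\<forall>\<^sub>F s in at_right 0. (\<sigma>\<^sup>2 * c) * Gamma (1 + \<beta>) * (2 * s) powr (-\<beta>) = var_const * s powr (-\<beta>)"
      by eventually_elim (simp add: var_const_def powr_mult powr_minus_divide)
  qed
  finally show "(\<lambda>s. dsum z (2 * s)) \<sim>[at_right 0] (\<lambda>s. var_const * s powr (-\<beta>))" .
qed

lemma dirichlet_core_trunc: "\<exists>C. dirichlet_core M trunc_term \<beta> var_const C 1"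
proof -
  obtain C where C: "C > 0" "\<forall>k\<ge>1. \<forall>s \<omega>. 0 < s \<longrightarrow> s < 1 \<longrightarrow> \<bar>trunc_term k \<omega>\<bar> * real k powr (-s) \<le> C * s powr (-\<beta>/2) / ln (1/s)"
    using trunc_term_bound by blast
  have "dirichlet_core M trunc_term \<beta> var_const C 1"
  proof unfold_locales
    show "M.indep_vars (\<lambda>_. borel) trunc_term {1..}"
      using M.indep_vars_compose2[OF ind, of "\<lambda>k y. coeff k * (trunc k y - trunc_mean k)" "\<lambda>_. borel"]
      by (simp add: trunc_term_def[abs_def])
  qed (use beta var_const_pos C trunc_term_moments(1) abelian_double[OF variance_partial_sums] in auto)
  thus ?thesis ..
qed

text \<open>As \<open>\<eta>\<^sub>0\<close> is centered, the truncated mean is minus the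
  expectation over the exceedance event. There \<bar>x\<bar> \<le> (u x^2 + 1/u) / 2 separates the
  second moment from the probability, with a weight u still free.\<close>

lemma coeff_trunc_mean_le:
  assumes u: "u > 0"
  shows "\<bar>coeff k * trunc_mean k\<bar> \<le> (u * \<sigma>\<^sup>2 * (coeff k)\<^sup>2 + exceed_prob k / u) / 2"
proof (cases "k \<in> supp")
  case True
  let ?I = "\<lambda>\<omega>. of_bool (k \<in> supp \<and> trunc_level k < (\<eta>\<^sub>0 \<omega>)\<^sup>2) :: real"
  have iI: "integrable N ?I" by (rule N_integrable_of_bool) measurable
  have "trunc_mean k = N.expectation (\<lambda>\<omega>. trunc k (\<eta>\<^sub>0 \<omega>) - \<eta>\<^sub>0 \<omega>)"
    using trunc_integrable int1 mean0 by (simp add: trunc_mean_def)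
  hence "coeff k * trunc_mean k = N.expectation (\<lambda>\<omega>. coeff k * (trunc k (\<eta>\<^sub>0 \<omega>) - \<eta>\<^sub>0 \<omega>))" by simp
  also have "\<bar>\<dots>\<bar> \<le> N.expectation (\<lambda>\<omega>. \<bar>coeff k * (trunc k (\<eta>\<^sub>0 \<omega>) - \<eta>\<^sub>0 \<omega>)\<bar>)" by (rule integral_abs_bound)
  also have "\<dots> \<le> N.expectation (\<lambda>\<omega>. (u * (coeff k)\<^sup>2 * (\<eta>\<^sub>0 \<omega>)\<^sup>2 + ?I \<omega> / u) / 2)"
  proof (intro integral_mono)
    show "integrable N (\<lambda>\<omega>. \<bar>coeff k * (trunc k (\<eta>\<^sub>0 \<omega>) - \<eta>\<^sub>0 \<omega>)\<bar>)" using trunc_integrable int1 by simp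
    show "integrable N (\<lambda>\<omega>. (u * (coeff k)\<^sup>2 * (\<eta>\<^sub>0 \<omega>)\<^sup>2 + ?I \<omega> / u) / 2)" using iI int2 by simp
    fix \<omega>
    define x where "x = \<bar>coeff k * \<eta>\<^sub>0 \<omega>\<bar>"
    have "0 \<le> (u * x - 1)\<^sup>2 / u" using u by simp
    also have "(u * x - 1)\<^sup>2 / u = u * x\<^sup>2 + 1 / u - 2 * x" using u by (simp add: power2_eq_square field_simps)
    finally have *: "x \<le> (u * x\<^sup>2 + 1 / u) / 2" by simp
    have x2: "x\<^sup>2 = (coeff k)\<^sup>2 * (\<eta>\<^sub>0 \<omega>)\<^sup>2" by (simp add: x_def power_mult_distrib)
    show "\<bar>coeff k * (trunc k (\<eta>\<^sub>0 \<omega>) - \<eta>\<^sub>0 \<omega>)\<bar> \<le> (u * (coeff k)\<^sup>2 * (\<eta>\<^sub>0 \<omega>)\<^sup>2 + ?I \<omega> / u) / 2"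
    proof (cases "trunc_level k < (\<eta>\<^sub>0 \<omega>)\<^sup>2")
      case T: True
      hence "\<bar>coeff k * (trunc k (\<eta>\<^sub>0 \<omega>) - \<eta>\<^sub>0 \<omega>)\<bar> = x" using True by (simp add: trunc_def x_def abs_mult)
      thus ?thesis using * T True unfolding x2 by (simp add: mult.assoc)
    next
      case False
      thus ?thesis using True u by (simp add: trunc_def)
    qed
  qed
  also have "\<dots> = (u * \<sigma>\<^sup>2 * (coeff k)\<^sup>2 + exceed_prob k / u) / 2"
    using iI int2 N_var by (simp add: exceed_prob_def algebra_simps)
  finally show ?thesis .
next
  case False
  hence "trunc_mean k = 0" using trunc_mean_abs[of k] by simp
  thus ?thesis using u exceed_prob_nonneg[of k] by simp
qed

lemma coeff_trunc_mean_sum: "\<exists>A\<ge>0. \<exists>B\<ge>0. \<forall>n\<ge>1. (\<Sum>k=1..n. \<bar>coeff k * trunc_mean k\<bar>) \<le> A + B * ln (real n) powr (\<beta>/2)"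
proof -
  obtain Bp where Bp: "Bp \<ge> 0" "\<And>n. (\<Sum>k\<le>n. exceed_prob k) \<le> Bp" using exceed_prob_sum by blast
  obtain AV where AV: "AV \<ge> 0" "\<And>n t. n \<ge> 1 \<Longrightarrow> t \<in> piece n \<Longrightarrow> \<bar>(\<Sum>k=1..n. (coeff k)\<^sup>2) - c * t powr \<beta>\<bar> \<le> AV + c * t powr \<beta>"
    using partial_sums_compare[OF coeff_partial_sums c beta c] by blast
  define B where "B = (2 * c * \<sigma>\<^sup>2 + Bp) / 2"
  have "(\<Sum>k=1..n. \<bar>coeff k * trunc_mean k\<bar>) \<le> \<sigma>\<^sup>2 * AV / 2 + B * ln (real n) powr (\<beta>/2)" if n: "n \<ge> 1" for n
  proof (cases "n \<ge> 16")
    case True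
    define L where "L = ln (real n) powr (\<beta>/2)"
    have l: "ln (real n) \<ge> 1" using iterated_ln_bounds(1)[OF True] one_le_exp_iff[of 1] by linarith
    have L: "L \<ge> 1" unfolding L_def using l beta by (intro ge_one_powr_ge_zero) auto
    have llog: "L * L = ln (real n) powr \<beta>" unfolding L_def by (simp add: powr_add[symmetric])
    have V: "(\<Sum>k=1..n. (coeff k)\<^sup>2) \<le> AV + 2 * c * (L * L)"
      using AV(2)[OF n, of "ln (real n)"] n unfolding llog by (auto simp: piece_def)
    \<comment> \<open>The weight u = 1/L depends on n but not on k. It balances the sum of squares,
      of order L^2, against the bounded sum of probabilities: both contribute order L.\<close>
    have "(\<Sum>k=1..n. \<bar>coeff k * trunc_mean k\<bar>) \<le> (\<Sum>k=1..n. ((1/L) * \<sigma>\<^sup>2 * (coeff k)\<^sup>2 + exceed_prob k / (1/L)) / 2)"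
      using L by (intro sum_mono coeff_trunc_mean_le) auto
    also have "\<dots> = ((1/L) * \<sigma>\<^sup>2 * (\<Sum>k=1..n. (coeff k)\<^sup>2) + L * (\<Sum>k=1..n. exceed_prob k)) / 2"
      by (simp add: sum.distrib sum_distrib_left sum_divide_distrib[symmetric] mult.commute)
    also have "\<dots> \<le> ((1/L) * \<sigma>\<^sup>2 * (AV + 2 * c * (L * L)) + L * Bp) / 2"
    proof -
      have "(\<Sum>k=1..n. exceed_prob k) \<le> (\<Sum>k\<le>n. exceed_prob k)" using exceed_prob_nonneg by (intro sum_mono2) auto
      also have "\<dots> \<le> Bp" by (rule Bp)
      finally show ?thesis using V L by (intro divide_right_mono add_mono mult_left_mono) auto
    qed
    also have "\<dots> = \<sigma>\<^sup>2 * AV / 2 * (1/L) + B * L" using L by (simp add: B_def field_simps)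
    also have "\<sigma>\<^sup>2 * AV / 2 * (1/L) \<le> \<sigma>\<^sup>2 * AV / 2 * 1" using L AV by (intro mult_left_mono) auto
    finally show ?thesis by (simp add: L_def)
  next
    case False
    have "trunc_mean k = 0" if "k \<le> n" for k using trunc_mean_abs[of k] that False by (auto simp: supp_def)
    hence "(\<Sum>k=1..n. \<bar>coeff k * trunc_mean k\<bar>) = 0" by (intro sum.neutral) auto
    thus ?thesis using AV Bp c by (simp add: B_def)
  qed
  moreover have "\<sigma>\<^sup>2 * AV / 2 \<ge> 0" "B \<ge> 0" using AV Bp c by (auto simp: B_def)
  ultimately show ?thesis by blast
qed

section \<open>The remainder after truncation and the full series\<close>

definition remainder_term :: "nat \<Rightarrow> 'a \<Rightarrow> real" where "remainder_term k \<omega> = coeff k * \<eta> k \<omega> - trunc_term k \<omega>"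

lemma truncation_eventually: "AE \<omega> in M. \<forall>\<^sub>F k in sequentially. remainder_term k \<omega> = coeff k * trunc_mean k"
proof -
  define E where "E k = {\<omega>\<in>space M. k \<in> supp \<and> trunc_level k < (\<eta> k \<omega>)\<^sup>2}" for k
  have k1: "k \<ge> 1" if "k \<in> supp" for k using that by (simp add: supp_def)
  have [measurable]: "E k \<in> sets M" for k
  proof (cases "k \<in> supp")
    case True
    note [measurable] = eta_measurable[OF k1[OF True]]
    show ?thesis unfolding E_def by measurable
  qed (simp add: E_def)
  have pE: "M.prob (E k) = exceed_prob k" for k
  proof (cases "k \<in> supp")
    case True
    have "M.prob (E k) = M.expectation (indicator (E k))" by simp
    also have "\<dots> = M.expectation (\<lambda>\<omega>. of_bool (k \<in> supp \<and> trunc_level k < (\<eta> k \<omega>)\<^sup>2))"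
      by (intro Bochner_Integration.integral_cong) (auto simp: E_def indicator_def)
    also have "\<dots> = exceed_prob k" unfolding exceed_prob_def
      by (rule transfer(1)[OF k1[OF True], of "\<lambda>y. of_bool (k \<in> supp \<and> trunc_level k < y\<^sup>2)"]) measurable
    finally show ?thesis .
  qed (simp add: E_def exceed_prob_def)
  obtain Bp where Bp: "\<And>n. (\<Sum>k\<le>n. exceed_prob k) \<le> Bp" using exceed_prob_sum by blast
  have "(\<Sum>k<n. exceed_prob k) \<le> Bp" for n
  proof -
    have "(\<Sum>k<n. exceed_prob k) \<le> (\<Sum>k\<le>n. exceed_prob k)" using exceed_prob_nonneg by (intro sum_mono2) auto
    thus ?thesis using Bp[of n] by linarith
  qed
  hence "summable exceed_prob" using exceed_prob_nonneg by (intro summableI_nonneg_bounded)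
  hence "summable (\<lambda>k. M.prob (E k))" unfolding pE .
  hence "AE \<omega> in M. \<forall>\<^sub>F k in sequentially. \<omega> \<in> space M - E k"
    by (intro borel_cantelli_AE1) (auto simp: M.emeasure_eq_measure)
  thus ?thesis
  proof eventually_elim
    case (elim \<omega>)
    from elim eventually_ge_at_top[of 16] show ?case
    proof eventually_elim
      case (elim k)
      show ?case
      proof (cases "k \<in> supp")
        case True
        hence "trunc k (\<eta> k \<omega>) = \<eta> k \<omega>" using elim by (auto simp: E_def trunc_def)
        thus ?thesis by (simp add: remainder_term_def trunc_term_def algebra_simps)
      next
        case False
        hence "coeff k = 0" using elim by (simp add: supp_def coeff_def)
        thus ?thesis by (simp add: remainder_term_def trunc_term_def)
      qed
    qed
  qed
qed

lemma remainder_AE: "AE \<omega> in M. \<exists>A\<ge>0. \<exists>B\<ge>0. \<forall>n\<ge>1. \<bar>\<Sum>k=1..n. remainder_term k \<omega>\<bar> \<le> A + B * ln (real n) powr (\<beta>/2)"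
  using truncation_eventually
proof eventually_elim
  case (elim \<omega>)
  then obtain n1 where n1: "\<And>k. k \<ge> n1 \<Longrightarrow> remainder_term k \<omega> = coeff k * trunc_mean k" by (auto simp: eventually_sequentially)
  obtain A B where AB: "A \<ge> 0" "B \<ge> 0" "\<And>n. n \<ge> 1 \<Longrightarrow> (\<Sum>k=1..n. \<bar>coeff k * trunc_mean k\<bar>) \<le> A + B * ln (real n) powr (\<beta>/2)" using coeff_trunc_mean_sum by blast
  define A1 where "A1 = (\<Sum>k\<le>n1. \<bar>remainder_term k \<omega>\<bar>)"
  have A1: "A1 \<ge> 0" by (simp add: A1_def sum_nonneg)
  have "\<bar>\<Sum>k=1..n. remainder_term k \<omega>\<bar> \<le> (A1 + A) + B * ln (real n) powr (\<beta>/2)" if n: "n \<ge> 1" for n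
  proof -
    have "\<bar>\<Sum>k=1..n. remainder_term k \<omega>\<bar> \<le> (\<Sum>k=1..n. \<bar>remainder_term k \<omega>\<bar>)" by (rule sum_abs)
    also have "\<dots> \<le> (\<Sum>k=1..n. (if k \<le> n1 then \<bar>remainder_term k \<omega>\<bar> else 0) + \<bar>coeff k * trunc_mean k\<bar>)"
      using n1 by (intro sum_mono) auto
    also have "\<dots> = (\<Sum>k=1..n. if k \<le> n1 then \<bar>remainder_term k \<omega>\<bar> else 0) + (\<Sum>k=1..n. \<bar>coeff k * trunc_mean k\<bar>)" by (simp add: sum.distrib)
    also have "(\<Sum>k=1..n. if k \<le> n1 then \<bar>remainder_term k \<omega>\<bar> else 0) \<le> A1"
      unfolding A1_def by (subst sum.inter_filter[symmetric]) (auto intro!: sum_mono2)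
    finally show ?thesis using AB(3)[OF n] by simp
  qed
  thus ?case using A1 AB by (intro exI[of _ "A1 + A"] conjI exI[of _ B]) auto
qed

definition series :: "real \<Rightarrow> 'a \<Rightarrow> real" where "series s \<omega> = dsum (\<lambda>k. coeff k * \<eta> k \<omega>) s"

lemma summand_eq: "a (Suc k) * y / real (Suc k) powr (1/2 + s) = coeff (Suc k) * y * real (Suc k) powr (-s)"
  by (simp add: coeff_def powr_add powr_half_sqrt powr_minus_divide)

lemma random_dirichlet_eq: "random_dirichlet a \<eta> s \<omega> = series s \<omega>"
  unfolding random_dirichlet_def series_def dsum_def summand_eq ..

text \<open>The remainder has partial sums O((ln n)^(beta/2)) without an iterated logarithm, so Abel
  summation leaves O(s^(-beta/2)), smaller than \<open>lil_scale\<close> by the factor sqrt (llog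
  s).\<close>

lemma Z_decomposition:
  assumes "dirichlet_core M trunc_term \<beta> var_const C 1"
  shows "AE \<omega> in M. (\<forall>s>0. summable (\<lambda>k. coeff (Suc k) * \<eta> (Suc k) \<omega> * real (Suc k) powr (-s))) \<and>
     continuous_on {0<..} (\<lambda>s. series s \<omega>) \<and>
     (\<exists>A\<ge>0. \<exists>B\<ge>0. \<forall>s>0. \<bar>series s \<omega> - dirichlet_core.X trunc_term s \<omega>\<bar> \<le> A + B * s powr (-\<beta>/2))"
proof -
  interpret Y: dirichlet_core M trunc_term \<beta> var_const C 1 by fact
  show ?thesis using Y.path_AE remainder_AE
  proof eventually_elim
    case (elim \<omega>)
    from elim(2) obtain A B where AB: "A \<ge> 0" "B \<ge> 0" "\<And>n. n \<ge> 1 \<Longrightarrow> \<bar>\<Sum>k=1..n. remainder_term k \<omega>\<bar> \<le> A + B * ln (real n) powr (\<beta>/2)" by blast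
    have b2: "\<beta>/2 > 0" using beta by simp
    note ab = abel_bound[OF _ b2 AB(2,3)]
    have G0: "Gamma (1 + \<beta>/2) > 0" using beta by (intro Gamma_real_pos) auto
    have e: "coeff k * \<eta> k \<omega> = trunc_term k \<omega> + remainder_term k \<omega>" for k by (simp add: remainder_term_def)
    have sm: "summable (\<lambda>k. trunc_term (Suc k) \<omega> * real (Suc k) powr (-s))" "summable (\<lambda>k. remainder_term (Suc k) \<omega> * real (Suc k) powr (-s))" if "s > 0" for s
      using elim(1) ab(1) that by auto
    have sumZ: "summable (\<lambda>k. coeff (Suc k) * \<eta> (Suc k) \<omega> * real (Suc k) powr (-s))" if "s > 0" for s
      unfolding e distrib_right by (intro summable_add sm that)
    have Zeq: "series s \<omega> = Y.X s \<omega> + dsum (\<lambda>k. remainder_term k \<omega>) s" if "s > 0" for s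
      unfolding series_def Y.X_def dsum_def e distrib_right by (intro suminf_add[symmetric] sm that)
    have "continuous_on {0<..} (\<lambda>s. Y.X s \<omega> + dsum (\<lambda>k. remainder_term k \<omega>) s)"
      using elim(1) by (intro continuous_on_add abel_continuous[OF b2 AB]) auto
    hence "continuous_on {0<..} (\<lambda>s. series s \<omega>)" by (rule continuous_on_eq) (simp add: Zeq)
    moreover have "\<bar>series s \<omega> - Y.X s \<omega>\<bar> \<le> A + (B * Gamma (1 + \<beta>/2)) * s powr (-\<beta>/2)" if "s > 0" for s
      using ab(2)[OF that] Zeq[OF that] by simp
    moreover have "B * Gamma (1 + \<beta>/2) \<ge> 0" using AB G0 by simp
    ultimately show ?case using sumZ AB(1) by blast
  qed
qed

text \<open>The almost sure convergence required by \<open>variance_suminf\<close> is taken from the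
  decomposition into truncated terms and remainder.\<close>

lemma dirichlet_variance_eq:
  assumes s: "s > 0"
  shows "dirichlet_variance M a \<eta> s = \<sigma>\<^sup>2 * dsum (\<lambda>k. (coeff k)\<^sup>2) (2 * s)"
proof -
  obtain C where "dirichlet_core M trunc_term \<beta> var_const C 1" using dirichlet_core_trunc by blast
  note ZD = Z_decomposition[OF this]
  define Z where "Z k \<omega> = coeff (Suc k) * \<eta> (Suc k) \<omega> * real (Suc k) powr (-s)" for k \<omega>
  have indZ: "M.indep_vars (\<lambda>_. borel) Z UNIV"
  proof -
    have "M.indep_vars (\<lambda>j. PiM {Suc j} (\<lambda>_. borel)) (\<lambda>j \<omega>. restrict (\<lambda>k. \<eta> k \<omega>) {Suc j}) UNIV"
      by (rule M.indep_vars_restrict[OF ind]) (auto simp: disjoint_family_on_def)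
    hence "M.indep_vars (\<lambda>_. borel) (\<lambda>j \<omega>. (\<lambda>f. coeff (Suc j) * f (Suc j) * real (Suc j) powr (-s)) (restrict (\<lambda>k. \<eta> k \<omega>) {Suc j})) UNIV"
      by (rule M.indep_vars_compose2) auto
    thus ?thesis by (simp add: Z_def[abs_def])
  qed
  have eZ: "integrable M (Z k)" "M.expectation (Z k) = 0" for k
    using transfer[of "Suc k" "\<lambda>y. y"] int1 mean0 by (auto simp: Z_def[abs_def])
  have e2: "integrable M (\<lambda>\<omega>. (\<eta> (Suc k) \<omega>)\<^sup>2)" "M.expectation (\<lambda>\<omega>. (\<eta> (Suc k) \<omega>)\<^sup>2) = \<sigma>\<^sup>2" for k
    using transfer[of "Suc k" "\<lambda>y. y\<^sup>2"] int2 N_var by auto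
  have pw: "(real (Suc k) powr (-s))\<^sup>2 = real (Suc k) powr (-(2 * s))" for k by (simp add: power2_eq_square powr_add[symmetric])
  have Zsq: "(Z k \<omega>)\<^sup>2 = ((coeff (Suc k))\<^sup>2 * real (Suc k) powr (-(2 * s))) * (\<eta> (Suc k) \<omega>)\<^sup>2" for k \<omega>
    unfolding Z_def power_mult_distrib pw by (simp only: ac_simps)
  have sqZ: "integrable M (\<lambda>\<omega>. (Z k \<omega>)\<^sup>2)" "M.expectation (\<lambda>\<omega>. (Z k \<omega>)\<^sup>2) = \<sigma>\<^sup>2 * ((coeff (Suc k))\<^sup>2 * real (Suc k) powr (-(2 * s)))" for k
    unfolding Zsq using e2 by auto
  have sm: "summable (\<lambda>k. (coeff (Suc k))\<^sup>2 * real (Suc k) powr (-(2 * s)))"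
    using abelian_asymp(2)[OF coeff_partial_sums c beta] s by simp
  have "dirichlet_variance M a \<eta> s = M.variance (\<lambda>\<omega>. \<Sum>k. Z k \<omega>)"
    unfolding dirichlet_variance_def random_dirichlet_eq[abs_def] series_def dsum_def Z_def
    by (simp only: random_dirichlet_eq series_def dsum_def)
  also have "\<dots> = (\<Sum>k. M.expectation (\<lambda>\<omega>. (Z k \<omega>)\<^sup>2))"
  proof (rule M.variance_suminf[OF indZ sqZ(1) eZ(2)])
    show "AE \<omega> in M. summable (\<lambda>k. Z k \<omega>)" using ZD by eventually_elim (use s in \<open>auto simp: Z_def\<close>)
    show "summable (\<lambda>k. M.expectation (\<lambda>\<omega>. (Z k \<omega>)\<^sup>2))" unfolding sqZ(2) by (intro summable_mult sm)
  qed
  also have "\<dots> = \<sigma>\<^sup>2 * dsum (\<lambda>k. (coeff k)\<^sup>2) (2 * s)"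
    unfolding sqZ(2) dsum_def by (rule suminf_mult[OF sm])
  finally show ?thesis .
qed

lemma dirichlet_variance_asymp:
  "dirichlet_variance M a \<eta> \<sim>[at_right 0] (\<lambda>s. var_const * s powr (-\<beta>))"
proof -
  have ps: "(\<Sum>k=1..n. \<sigma>\<^sup>2 * (coeff k)\<^sup>2) = \<sigma>\<^sup>2 * (\<Sum>k=1..n. (coeff k)\<^sup>2)" for n by (simp add: sum_distrib_left)
  have "(\<lambda>n. \<Sum>k=1..n. \<sigma>\<^sup>2 * (coeff k)\<^sup>2) \<sim>[at_top] (\<lambda>n. \<sigma>\<^sup>2 * (c * ln (real n) powr \<beta>))"
    unfolding ps by (intro asymp_equiv_mult asymp_equiv_refl coeff_partial_sums)
  from abelian_double(1)[OF this] have *: "(\<lambda>s. dsum (\<lambda>k. \<sigma>\<^sup>2 * (coeff k)\<^sup>2) (2 * s)) \<sim>[at_right 0] (\<lambda>s. var_const * s powr (-\<beta>))" .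
  have "\<forall>\<^sub>F s in at_right (0::real). s > 0" by (simp add: eventually_at_filter)
  hence "\<forall>\<^sub>F s in at_right 0. dsum (\<lambda>k. \<sigma>\<^sup>2 * (coeff k)\<^sup>2) (2 * s) = dirichlet_variance M a \<eta> s"
  proof eventually_elim
    case (elim s)
    have "summable (\<lambda>k. (coeff (Suc k))\<^sup>2 * real (Suc k) powr (-(2 * s)))"
      using abelian_asymp(2)[OF coeff_partial_sums c beta] elim by simp
    from suminf_mult[OF this, of "\<sigma>\<^sup>2"] show ?case
      unfolding dirichlet_variance_eq[OF elim] dsum_def by (simp only: mult.assoc)
  qed
  from asymp_equiv_cong[OF this, of "\<lambda>s. var_const * s powr (-\<beta>)" "\<lambda>s. var_const * s powr (-\<beta>)"] *
  show ?thesis by simp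
qed

lemma limit_points:
  "AE \<omega> in M. limit_points_at_right_0 (\<lambda>s. normalized_dirichlet M a \<eta> s \<omega>) = {-1..1} \<and>
     Limsup (at_right 0) (\<lambda>s. ereal (normalized_dirichlet M a \<eta> s \<omega>)) = 1 \<and>
     Liminf (at_right 0) (\<lambda>s. ereal (normalized_dirichlet M a \<eta> s \<omega>)) = -1"
proof -
  obtain C where core': "dirichlet_core M trunc_term \<beta> var_const C 1" using dirichlet_core_trunc by blast
  interpret Y: dirichlet_core M trunc_term \<beta> var_const C 1 by fact
  define v where "v = dirichlet_variance M a \<eta>"
  define \<rho> where "\<rho> s = sqrt (2 * var_const) * lil_scale \<beta> s / sqrt (2 * v s * ln (ln (v s)))" for s
  have \<rho>: "(\<rho> \<longlongrightarrow> 1) (at_right 0)"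
    unfolding \<rho>_def by (rule normalizer_ratio[OF dirichlet_variance_asymp[folded v_def] var_const_pos beta])
  have sD: "sqrt (2 * var_const) > 0" using var_const_pos by simp
  have pos: "\<forall>\<^sub>F s in at_right (0::real). 0 < s \<and> s < exp (- exp 1)"
    using eventually_at_right_real[of 0 "exp (- exp 1)"] by (auto elim: eventually_mono)
  show ?thesis using Z_decomposition[OF core'] Y.upper_bound Y.lower_bound Y.upper_frequent
  proof eventually_elim
    case (elim \<omega>)
    from elim(1) obtain A B where AB: "A \<ge> 0" "B \<ge> 0" "\<And>s. s > 0 \<Longrightarrow> \<bar>series s \<omega> - Y.X s \<omega>\<bar> \<le> A + B * s powr (-\<beta>/2)" by blast
    \<comment> \<open>Normalized by the explicit scale instead of the variance, so continuity in s
      follows from that of the series.\<close>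
    define Q where "Q s = series s \<omega> / (sqrt (2 * var_const) * lil_scale \<beta> s)" for s
    have negl: "\<forall>\<^sub>F s in at_right 0. 0 < s \<and> 0 < lil_scale \<beta> s \<and> \<bar>series s \<omega> - Y.X s \<omega>\<bar> \<le> e * (sqrt (2 * var_const) * lil_scale \<beta> s)" if e: "e > 0" for e
    proof -
      define K where "K = e * sqrt (2 * var_const)"
      have K: "K > 0" using e sD by (simp add: K_def)
      have "\<forall>\<^sub>F s in at_right 0. A + B * s powr (-\<beta>/2) \<le> K * (s powr (-\<beta>/2) * sqrt (ln (ln (1/s))))"
      proof -
        \<comment> \<open>Dividing by s^(-beta/2) leaves a bounded function on the left and K sqrt
          (ln (ln (1/s))), which is unbounded, on the right.\<close>
        have "((\<lambda>s. A * s powr (\<beta>/2) + B) \<longlongrightarrow> B) (at_right 0)" using beta by real_asymp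
        hence "\<forall>\<^sub>F s in at_right 0. A * s powr (\<beta>/2) + B < B + 1" by (rule order_tendstoD) simp
        moreover have "filterlim (\<lambda>s. sqrt (ln (ln (1/s)))) at_top (at_right (0::real))" by real_asymp
        hence "\<forall>\<^sub>F s in at_right (0::real). sqrt (ln (ln (1/s))) \<ge> (B + 1) / K" by (simp add: filterlim_at_top)
        ultimately show ?thesis using pos
        proof eventually_elim
          case (elim s)
          have "s powr (\<beta>/2) * s powr (-\<beta>/2) = 1" using elim by (simp add: powr_add[symmetric])
          hence "A + B * s powr (-\<beta>/2) = (A * s powr (\<beta>/2) + B) * s powr (-\<beta>/2)" by (simp add: algebra_simps)
          also have "\<dots> \<le> (K * sqrt (ln (ln (1/s)))) * s powr (-\<beta>/2)"
            using elim K by (intro mult_right_mono) (auto simp: field_simps)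
          finally show ?case by (simp add: mult_ac)
        qed
      qed
      with pos show ?thesis
      proof eventually_elim
        case (elim s)
        thus ?case using AB(3)[of s] iterated_ln_small(3)[of s \<beta>] by (auto simp: lil_scale_def llog_def K_def mult_ac)
      qed
    qed
    have cont: "continuous_on {0<..<exp (- exp 1)} Q"
    proof -
      have "continuous_on {0<..<exp (- exp 1)} (\<lambda>s. series s \<omega>)" using elim(1) by (auto intro: continuous_on_subset)
      moreover have "continuous_on {0<..<exp (- exp 1)} (lil_scale \<beta>)"
      proof -
        have l: "\<forall>s\<in>{0<..<exp (- exp (1::real))}. ln (1/s) \<noteq> 0"
        proof
          fix s :: real assume "s \<in> {0<..<exp (- exp 1)}"
          hence "exp 1 < ln (1/s)" by (intro iterated_ln_small) auto
          hence "0 < ln (1/s)" by (rule less_trans[OF exp_gt_zero])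
          thus "ln (1/s) \<noteq> 0" by simp
        qed
        show ?thesis unfolding lil_scale_def[abs_def] llog_def
          by (intro continuous_intros l) auto
      qed
      moreover have "sqrt (2 * var_const) * lil_scale \<beta> s \<noteq> 0" if "s \<in> {0<..<exp (- exp 1)}" for s
        using iterated_ln_small(3)[of s \<beta>] that sD by auto
      ultimately show ?thesis unfolding Q_def by (intro continuous_intros) auto
    qed
    have W: "\<forall>\<^sub>F s in at_right 0. normalized_dirichlet M a \<eta> s \<omega> = \<rho> s * Q s"
      using pos
    proof eventually_elim
      case (elim s)
      hence "lil_scale \<beta> s > 0" by (intro iterated_ln_small) auto
      thus ?case using sD by (simp add: normalized_dirichlet_def random_dirichlet_eq \<rho>_def Q_def v_def)
    qed
    have up: "\<forall>\<^sub>F s in at_right 0. \<bar>Q s\<bar> \<le> 1 + e" if e: "e > 0" for e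
    proof -
      have "\<forall>\<^sub>F s in at_right 0. \<bar>Y.X s \<omega>\<bar> \<le> (1 + e/2) * sqrt (2 * var_const) * lil_scale \<beta> s" using elim(2) e by auto
      moreover have "\<forall>\<^sub>F s in at_right 0. 0 < s \<and> 0 < lil_scale \<beta> s \<and> \<bar>series s \<omega> - Y.X s \<omega>\<bar> \<le> e/2 * (sqrt (2 * var_const) * lil_scale \<beta> s)"
        using e by (intro negl) auto
      ultimately show ?thesis
      proof eventually_elim
        case (elim s)
        have "\<bar>series s \<omega>\<bar> \<le> \<bar>Y.X s \<omega>\<bar> + \<bar>series s \<omega> - Y.X s \<omega>\<bar>" by linarith
        also have "\<dots> \<le> (1 + e/2) * sqrt (2 * var_const) * lil_scale \<beta> s + e/2 * (sqrt (2 * var_const) * lil_scale \<beta> s)"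
          using elim by (intro add_mono) auto
        also have "\<dots> = (1 + e) * (sqrt (2 * var_const) * lil_scale \<beta> s)" by (simp add: algebra_simps)
        finally have "\<bar>series s \<omega>\<bar> \<le> (1 + e) * (sqrt (2 * var_const) * lil_scale \<beta> s)" .
        thus ?case using elim sD by (simp add: Q_def abs_mult pos_divide_le_eq)
      qed
    qed
    have lo1: "\<exists>\<^sub>F s in at_right 0. Q s \<ge> 1 - e" if e: "e > 0" for e
    proof -
      have 1: "\<exists>\<^sub>F s in at_right 0. Y.X s \<omega> \<ge> (1 - e/2) * sqrt (2 * var_const) * lil_scale \<beta> s" using elim(3) e by auto
      have 2: "\<forall>\<^sub>F s in at_right 0. 0 < s \<and> 0 < lil_scale \<beta> s \<and> \<bar>series s \<omega> - Y.X s \<omega>\<bar> \<le> e/2 * (sqrt (2 * var_const) * lil_scale \<beta> s)"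
        using e by (intro negl) auto
      from frequently_eventually_conj[OF 1 2] show ?thesis
      proof (rule frequently_elim1, goal_cases)
        case (1 s)
        have "(1 - e) * (sqrt (2 * var_const) * lil_scale \<beta> s) = (1 - e/2) * sqrt (2 * var_const) * lil_scale \<beta> s - e/2 * (sqrt (2 * var_const) * lil_scale \<beta> s)"
          by (simp add: algebra_simps)
        also have "\<dots> \<le> Y.X s \<omega> - \<bar>series s \<omega> - Y.X s \<omega>\<bar>" using 1 by (intro diff_mono) auto
        also have "\<dots> \<le> series s \<omega>" by linarith
        finally have "series s \<omega> \<ge> (1 - e) * (sqrt (2 * var_const) * lil_scale \<beta> s)" .
        thus ?case using 1 sD by (simp add: Q_def pos_le_divide_eq)
      qed
    qed
    have lo2: "\<exists>\<^sub>F s in at_right 0. Q s \<le> - (1 - e)" if e: "e > 0" for e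
    proof -
      have 1: "\<exists>\<^sub>F s in at_right 0. Y.X s \<omega> \<le> - ((1 - e/2) * sqrt (2 * var_const) * lil_scale \<beta> s)" using elim(4) e by auto
      have 2: "\<forall>\<^sub>F s in at_right 0. 0 < s \<and> 0 < lil_scale \<beta> s \<and> \<bar>series s \<omega> - Y.X s \<omega>\<bar> \<le> e/2 * (sqrt (2 * var_const) * lil_scale \<beta> s)"
        using e by (intro negl) auto
      from frequently_eventually_conj[OF 1 2] show ?thesis
      proof (rule frequently_elim1, goal_cases)
        case (1 s)
        have "series s \<omega> \<le> Y.X s \<omega> + \<bar>series s \<omega> - Y.X s \<omega>\<bar>" by linarith
        also have "\<dots> \<le> - ((1 - e/2) * sqrt (2 * var_const) * lil_scale \<beta> s) + e/2 * (sqrt (2 * var_const) * lil_scale \<beta> s)"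
          using 1 by (intro add_mono) auto
        also have "\<dots> = - (1 - e) * (sqrt (2 * var_const) * lil_scale \<beta> s)" by (simp add: algebra_simps)
        finally have "series s \<omega> \<le> - (1 - e) * (sqrt (2 * var_const) * lil_scale \<beta> s)" .
        thus ?case using 1 sD by (simp add: Q_def pos_divide_le_eq)
      qed
    qed
    show ?case using limit_points_interval[OF cont exp_gt_zero W \<rho> up lo1 lo2] by simp
  qed
qed

end

theorem theorem4:
  fixes M :: "'a measure" and \<eta> :: "nat \<Rightarrow> 'a \<Rightarrow> real"
    and N :: "'b measure" and \<eta>\<^sub>0 :: "'b \<Rightarrow> real"
    and a :: "nat \<Rightarrow> real" and \<sigma> c \<beta> :: real
  assumes "prob_space M" and "prob_space N"
    and "\<eta>\<^sub>0 \<in> borel_measurable N"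
    and "integrable N \<eta>\<^sub>0" and "integrable N (\<lambda>\<omega>. (\<eta>\<^sub>0 \<omega>)\<^sup>2)"
    and "prob_space.expectation N \<eta>\<^sub>0 = 0"
    and "\<sigma> > 0" and "prob_space.variance N \<eta>\<^sub>0 = \<sigma>\<^sup>2"
    and "prob_space.indep_vars M (\<lambda>_. borel) \<eta> {1..}"
    and "\<And>k. k \<ge> 1 \<Longrightarrow> distr M borel (\<eta> k) = distr N borel \<eta>\<^sub>0"
    and "c > 0" and "\<beta> > 0"
    and "(\<lambda>n::nat. \<Sum>k=1..n. (a k)\<^sup>2 / real k) \<sim>[at_top] (\<lambda>n. c * ln (real n) powr \<beta>)"
    and "\<forall>\<^sub>F x in at_top. finite (growth_set a \<beta> x)"
    and "(\<lambda>x::real. real (card (growth_set a \<beta> x))) \<in> O[at_top](\<lambda>x. x)"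
  shows "(AE \<omega> in M. limit_points_at_right_0 (\<lambda>s. normalized_dirichlet M a \<eta> s \<omega>) = {-1..1})
    \<and> (\<lambda>s. dirichlet_variance M a \<eta> s)
        \<sim>[at_right 0] (\<lambda>s. \<sigma>\<^sup>2 * c * Gamma (1 + \<beta>) / (2 * s) powr \<beta>)
    \<and> (AE \<omega> in M. Limsup (at_right 0) (\<lambda>s. ereal (normalized_dirichlet M a \<eta> s \<omega>)) = 1)
    \<and> (AE \<omega> in M. Liminf (at_right 0) (\<lambda>s. ereal (normalized_dirichlet M a \<eta> s \<omega>)) = -1)"
proof -
  interpret M: prob_space M by fact
  interpret N: prob_space N by fact
  interpret dirichlet_iid M N \<eta> \<eta>\<^sub>0 a \<sigma> c \<beta>
    by unfold_locales (use assms in auto)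
  have "\<forall>\<^sub>F s in at_right (0::real). s > 0" by (simp add: eventually_at_filter)
  hence "\<forall>\<^sub>F s in at_right 0. var_const * s powr (-\<beta>) = \<sigma>\<^sup>2 * c * Gamma (1 + \<beta>) / (2 * s) powr \<beta>"
    by eventually_elim (simp add: var_const_def powr_mult powr_minus_divide)
  hence "dirichlet_variance M a \<eta> \<sim>[at_right 0] (\<lambda>s. \<sigma>\<^sup>2 * c * Gamma (1 + \<beta>) / (2 * s) powr \<beta>)"
    using dirichlet_variance_asymp asymp_equiv_cong[of "dirichlet_variance M a \<eta>" "dirichlet_variance M a \<eta>"] by fastforce
  with limit_points show ?thesis by auto
qed

end
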